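(* There is a unique map $\langle\ ,\ \rangle: W(K)/\wp W(K)\times\widehat{K^*}\to\mathbb Z_p$ having the following three properties: (i) $\langle\ ,\ \rangle$ is $\mathbb Z_p$-bilinear; (ii) for every $a\in W(k)$ and every uniformizer $T'\in K^*$ one has $\langle a,T'\rangle=\mathrm{Tr}_{W(k)/W(\mathbb F_p)}(a)$; (iii) for every uniformizer $T'\in K^*$, every $c\in k$ and every integer $i>0$ with $p\nmid i$ one has $\langle [cT'^{-i}],T'\rangle=0$.
   Context: Let $k$ be a finite field of characteristic $p$ and $K=k((T))$ with its $T$-adic valuation; a uniformizer is an element of valuation $1$. $W(\cdot)$ denotes $p$-typical Witt vectors, $F$ the Frobenius on Witt vectors, $\wp=F-\mathrm{id}$, $[a]=(a,0,0,\ldots)$ the Teichmüller lift, and $W(\mathbb F_p)=\mathbb Z_p$. $\mathrm{Tr}_{W(k)/W(\mathbb F_p)}$ is the sum over the Galois group of $k/\mathbb F_p$ acting on $W(k)$. $\widehat{K^*}=\varprojlim_n K^*/(K^* )^{p^n}$ is the $p$-adic completion of $K^*$, a $\mathbb Z_p$-module (written multiplicatively). Elements of $W(K)$ and of $K^*$ are identified with their images in $W(K)/\wp W(K)$ and $\widehat{K^*}$. *)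

theory Defs
  imports
    "HOL-Library.Poly_Mapping"
    "HOL-Computational_Algebra.Formal_Laurent_Series"
    "HOL-Algebra.Algebraic_Closure_Type"
    "HOL-Algebra.Multiplicative_Group"
    "HOL-Algebra.QuotRing"
begin

section \<open>Witt vectors\<close>

text \<open>
  Integer polynomials in the variables \<open>X\<^sub>0, X\<^sub>1, \<dots>\<close> (indexed by \<open>Inl n\<close>) and
  \<open>Y\<^sub>0, Y\<^sub>1, \<dots>\<close> (indexed by \<open>Inr n\<close>): finitely supported maps from monomials to coefficients.
\<close>

type_synonym witt_poly = "((nat + nat) \<Rightarrow>\<^sub>0 nat) \<Rightarrow>\<^sub>0 int"

definition witt_var :: "nat + nat \<Rightarrow> witt_poly" where
  "witt_var v = Poly_Mapping.single (Poly_Mapping.single v 1) 1"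

definition witt_poly_eval :: "(nat + nat \<Rightarrow> 'a::comm_ring_1) \<Rightarrow> witt_poly \<Rightarrow> 'a" where
  "witt_poly_eval f q =
     (\<Sum>m\<in>Poly_Mapping.keys q. of_int (Poly_Mapping.lookup q m) *
        (\<Prod>v\<in>Poly_Mapping.keys m. f v ^ Poly_Mapping.lookup m v))"

definition witt_ghost :: "nat \<Rightarrow> nat \<Rightarrow> (nat \<Rightarrow> 'a::comm_ring_1) \<Rightarrow> 'a" where
  "witt_ghost p n x = (\<Sum>i\<le>n. of_nat (p ^ i) * x i ^ (p ^ (n - i)))"

text \<open>
  By Witt's theorem, for prime \<open>p\<close> there is exactly one sequence of integer polynomials with
  the stated ghost components, so the descriptions below are well defined.
\<close>

definition witt_add_poly :: "nat \<Rightarrow> nat \<Rightarrow> witt_poly" where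
  "witt_add_poly p = (THE S. \<forall>n. witt_ghost p n S =
     witt_ghost p n (\<lambda>i. witt_var (Inl i)) + witt_ghost p n (\<lambda>i. witt_var (Inr i)))"

definition witt_mult_poly :: "nat \<Rightarrow> nat \<Rightarrow> witt_poly" where
  "witt_mult_poly p = (THE S. \<forall>n. witt_ghost p n S =
     witt_ghost p n (\<lambda>i. witt_var (Inl i)) * witt_ghost p n (\<lambda>i. witt_var (Inr i)))"

definition teichmuller :: "'a::comm_ring_1 \<Rightarrow> nat \<Rightarrow> 'a" where
  "teichmuller a = (\<lambda>n. if n = 0 then a else 0)"

text \<open>The ring of \<open>p\<close>-typical Witt vectors with components in a subring \<open>A\<close>.\<close>

definition witt_ring :: "nat \<Rightarrow> 'a::comm_ring_1 set \<Rightarrow> (nat \<Rightarrow> 'a) ring" where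
  "witt_ring p A =
     \<lparr> carrier = {x. range x \<subseteq> A},
       monoid.mult = (\<lambda>x y n. witt_poly_eval (case_sum x y) (witt_mult_poly p n)),
       one = teichmuller 1,
       zero = (\<lambda>_. 0),
       add = (\<lambda>x y n. witt_poly_eval (case_sum x y) (witt_add_poly p n)) \<rparr>"

text \<open>
  Over rings of characteristic \<open>p\<close>, which are the only ones considered here, the Witt vector
  Frobenius raises every component to the \<open>p\<close>-th power.
\<close>

definition witt_frob :: "nat \<Rightarrow> (nat \<Rightarrow> 'a::comm_ring_1) \<Rightarrow> nat \<Rightarrow> 'a" where
  "witt_frob p x = (\<lambda>n. x n ^ p)"

definition witt_wp :: "nat \<Rightarrow> (nat \<Rightarrow> 'a::comm_ring_1) \<Rightarrow> nat \<Rightarrow> 'a" where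
  "witt_wp p x = witt_frob p x \<ominus>\<^bsub>witt_ring p UNIV\<^esub> x"

definition witt_mod_wp :: "nat \<Rightarrow> (nat \<Rightarrow> 'a::comm_ring_1) set monoid" where
  "witt_mod_wp p = witt_ring p UNIV A_Mod range (witt_wp p)"

definition witt_class :: "nat \<Rightarrow> (nat \<Rightarrow> 'a::comm_ring_1) \<Rightarrow> (nat \<Rightarrow> 'a) set" where
  "witt_class p x = range (witt_wp p) +>\<^bsub>witt_ring p UNIV\<^esub> x"

text \<open>
  For a field \<open>k\<close> of characteristic \<open>p\<close>, the set \<^term>\<open>\<int> :: 'k::ring_1 set\<close> is the image
  of the integers in \<open>k\<close>, i.e. the prime field \<open>\<bbbF>\<^sub>p\<close>.
  So this ring is \<open>W(\<bbbF>\<^sub>p) = \<int>\<^sub>p\<close>, as a subring of \<open>W(k)\<close>.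
\<close>

definition Zp :: "nat \<Rightarrow> (nat \<Rightarrow> 'k::field) ring" where
  "Zp p = witt_ring p \<int>"

definition galois_prime_field :: "('k::field \<Rightarrow> 'k) set" where
  "galois_prime_field =
     {\<sigma> \<in> ring_iso ring_of_type_algebra ring_of_type_algebra. \<forall>x\<in>\<int>. \<sigma> x = x}"

definition witt_trace :: "nat \<Rightarrow> (nat \<Rightarrow> 'k::field) \<Rightarrow> nat \<Rightarrow> 'k" where
  "witt_trace p a = (\<Oplus>\<^bsub>witt_ring p UNIV\<^esub>\<sigma>\<in>galois_prime_field. (\<lambda>n. \<sigma> (a n)))"

text \<open>The inclusion \<open>W(k) \<subseteq> W(K)\<close> for \<open>K = k((T))\<close>.\<close>

definition witt_const :: "(nat \<Rightarrow> 'k::field) \<Rightarrow> nat \<Rightarrow> 'k fls" where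
  "witt_const a = (\<lambda>n. fls_const (a n))"

definition witt_mod_wp_smult ::
    "nat \<Rightarrow> (nat \<Rightarrow> 'k::field) \<Rightarrow> (nat \<Rightarrow> 'k fls) set \<Rightarrow> (nat \<Rightarrow> 'k fls) set" where
  "witt_mod_wp_smult p r C =
     range (witt_wp p) <+>\<^bsub>witt_ring p UNIV\<^esub>
       (\<lambda>x. witt_const r \<otimes>\<^bsub>witt_ring p UNIV\<^esub> x) ` C"


section \<open>The \<open>p\<close>-adic completion of the multiplicative group\<close>

definition power_subgroup :: "('a, 'b) monoid_scheme \<Rightarrow> nat \<Rightarrow> 'a set" where
  "power_subgroup G m = (\<lambda>x. x [^]\<^bsub>G\<^esub> m) ` carrier G"

text \<open>
  The inverse limit of the groups \<open>G / G\<^bsup>p^n\<^esup>\<close>, an element being a compatible sequence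
  of cosets. The transition map from level \<open>n + 1\<close> to level \<open>n\<close> enlarges a coset
  \<open>G\<^bsup>p^(n+1)\<^esup> x\<close> to \<open>G\<^bsup>p^n\<^esup> x\<close>.
\<close>

definition p_completion :: "nat \<Rightarrow> ('a, 'b) monoid_scheme \<Rightarrow> (nat \<Rightarrow> 'a set) monoid" where
  "p_completion p G =
     \<lparr> carrier = {b. \<forall>n. b n \<in> carrier (G Mod power_subgroup G (p ^ n)) \<and>
                        b n = power_subgroup G (p ^ n) <#>\<^bsub>G\<^esub> b (Suc n)},
       monoid.mult = (\<lambda>b b' n. b n \<otimes>\<^bsub>G Mod power_subgroup G (p ^ n)\<^esub> b' n),
       one = (\<lambda>n. \<one>\<^bsub>G Mod power_subgroup G (p ^ n)\<^esub>) \<rparr>"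

definition to_p_completion :: "nat \<Rightarrow> ('a, 'b) monoid_scheme \<Rightarrow> 'a \<Rightarrow> nat \<Rightarrow> 'a set" where
  "to_p_completion p G x = (\<lambda>n. power_subgroup G (p ^ n) #>\<^bsub>G\<^esub> x)"

text \<open>The representative of \<open>r \<in> \<int>\<^sub>p\<close> modulo \<open>p\<^sup>n\<close> in \<open>{0..<p\<^sup>n}\<close>.\<close>

definition Zp_residue :: "nat \<Rightarrow> nat \<Rightarrow> (nat \<Rightarrow> 'k::field) \<Rightarrow> nat" where
  "Zp_residue p n r = (LEAST m. \<exists>s\<in>carrier (Zp p).
     r = ([m] \<cdot>\<^bsub>Zp p\<^esub> \<one>\<^bsub>Zp p\<^esub>) \<oplus>\<^bsub>Zp p\<^esub> ([(p ^ n)] \<cdot>\<^bsub>Zp p\<^esub> s))"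

definition p_completion_pow ::
    "nat \<Rightarrow> ('a, 'b) monoid_scheme \<Rightarrow> (nat \<Rightarrow> 'a set) \<Rightarrow> (nat \<Rightarrow> 'k::field) \<Rightarrow> nat \<Rightarrow> 'a set" where
  "p_completion_pow p G b r =
     (\<lambda>n. b n [^]\<^bsub>G Mod power_subgroup G (p ^ n)\<^esub> Zp_residue p n r)"

definition laurent_units :: "'k::field fls monoid" where
  "laurent_units = mult_of ring_of_type_algebra"

abbreviation laurent_units_completion :: "nat \<Rightarrow> (nat \<Rightarrow> 'k::field fls set) monoid" where
  "laurent_units_completion p \<equiv> p_completion p laurent_units"

definition uniformizer :: "'k::field fls \<Rightarrow> bool" where
  "uniformizer t \<longleftrightarrow> t \<noteq> 0 \<and> fls_subdegree t = 1"


section \<open>Bilinear maps\<close>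

definition Zp_bilinear ::
    "nat \<Rightarrow> ((nat \<Rightarrow> 'k::field fls) set \<times> (nat \<Rightarrow> 'k fls set) \<Rightarrow> nat \<Rightarrow> 'k) \<Rightarrow> bool" where
  "Zp_bilinear p f \<longleftrightarrow>
     (\<forall>x\<in>carrier (witt_mod_wp p). \<forall>x'\<in>carrier (witt_mod_wp p).
        \<forall>b\<in>carrier (laurent_units_completion p).
          f (x \<otimes>\<^bsub>witt_mod_wp p\<^esub> x', b) = f (x, b) \<oplus>\<^bsub>Zp p\<^esub> f (x', b)) \<and>
     (\<forall>x\<in>carrier (witt_mod_wp p).
        \<forall>b\<in>carrier (laurent_units_completion p). \<forall>b'\<in>carrier (laurent_units_completion p).
          f (x, b \<otimes>\<^bsub>laurent_units_completion p\<^esub> b') = f (x, b) \<oplus>\<^bsub>Zp p\<^esub> f (x, b')) \<and>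
     (\<forall>r\<in>carrier (Zp p). \<forall>x\<in>carrier (witt_mod_wp p).
        \<forall>b\<in>carrier (laurent_units_completion p).
          f (witt_mod_wp_smult p r x, b) = r \<otimes>\<^bsub>Zp p\<^esub> f (x, b) \<and>
          f (x, p_completion_pow p laurent_units b r) = r \<otimes>\<^bsub>Zp p\<^esub> f (x, b))"

end

theory Submission
  imports Defs
begin

unbundle fps_syntax

text \<open>
  Existence is the Schmid--Witt residue formula. Lift the components of \<open>x \<in> W(K)\<close> and the element
  \<open>y \<in> K\<^sup>*\<close> coefficientwise to the Laurent series ring \<open>B = W(k)((T))\<close>, which has characteristic
  zero. The element \<open>Tr Res(w\<^sub>n(x) dy / y)\<close> of \<open>W(k)\<close>, with \<open>w\<^sub>n\<close> the \<open>n\<close>-th ghost component,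
  is independent of the lift of \<open>x\<close> modulo \<open>p\<^bsup>n+1\<^esup>\<close>. It is independent of the lift of \<open>y\<close>
  because \<open>dw\<^sub>n(x)\<close> is divisible by \<open>p\<^sup>n\<close> and \<open>log(1 + pe)\<close> by \<open>p\<close>. Comparison with the
  Frobenius lift \<open>\<phi>\<close> on \<open>B\<close>, for which \<open>\<phi>(y) / y\<^sup>p \<equiv> 1\<close> modulo \<open>p\<close>, shows that
  \<open>Res(w\<^sub>n(Fx) dy / y) \<equiv> F Res(w\<^sub>n(x) dy / y)\<close>; this gives both the invariance under \<open>\<wp>\<close>
  and the compatibility in \<open>n\<close>. For a uniformizer lifted to \<open>y\<close> one has \<open>Res(dy / y) = 1\<close>, and
  \<open>y\<^bsup>-m\<^esup> dy / y\<close> is exact up to the factor \<open>-m\<close>, so its residue vanishes. Continuity extends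
  the pairing to the completion.

  For uniqueness, let \<open>A\<close> be the difference of two pairings at a fixed uniformizer \<open>t\<close>. Modulo
  \<open>\<wp>\<close> every Witt vector is \<open>[x\<^sub>0] + p x'\<close>, and \<open>x\<^sub>0\<close> is, modulo \<open>\<wp>(K)\<close>, a sum of a constant
  and terms \<open>c t\<^bsup>-i\<^esup>\<close> with \<open>p\<close> not dividing \<open>i\<close>. Hence \<open>A\<close> takes values in \<open>p\<int>\<^sub>p\<close>, and
  iterating, \<open>A = 0\<close>. Uniformizers generate \<open>K\<^sup>*\<close>, and every element of the completion is the
  product of an element of \<open>K\<^sup>*\<close> and a \<open>p\<close>-th power.
\<close>

section \<open>Integer polynomials\<close>

text \<open>In characteristic p the n-th ghost component is just the p^n-th power of x_0; hence the
  passage to W(k)((T)), where F on coefficients together with T going to T^p is a lift of Frobenius.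
  The coefficientwise Teichmueller lift respects neither sums nor products of series, so additivity
  in x and multiplicativity in y are themselves consequences of independence of the lift: a sum is
  lifted by the Witt sum of lifts, a product by the product, and there ghosts and logarithmic
  derivatives are exactly additive. The F that each comparison leaves behind is absorbed by the
  trace, because composing with Frobenius permutes the Galois group. Level n is meaningful modulo
  p^(n+1) only; as k is perfect, this amounts to knowing the first n+1 Witt components, so p-adic
  limits are assembled component by component, without a topology. Since W(k)((T)) is not a field, a
  lift of y always travels with an explicit inverse.\<close>

locale ring_map =
  fixes h :: "'a::comm_ring_1 \<Rightarrow> 'b::comm_ring_1"
  assumes add: "h (x + y) = h x + h y"
    and mult: "h (x * y) = h x * h y"
    and one: "h 1 = 1"
begin

lemma zero: "h 0 = 0"
  using add[of 0 0] by simp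

lemma uminus: "h (- x) = - h x"
  using add[of "-x" x] by (simp add: zero eq_neg_iff_add_eq_0)

lemma diff: "h (x - y) = h x - h y"
  using add[of x "-y"] by (simp add: uminus)

lemma power: "h (x ^ n) = h x ^ n"
  by (induction n) (simp_all add: one mult)

lemma of_nat: "h (of_nat n) = of_nat n"
  by (induction n) (simp_all add: one zero add)

lemma of_int: "h (of_int n) = of_int n"
  by (cases n) (simp_all add: of_nat uminus one add diff)

lemma sum: "h (sum f S) = (\<Sum>i\<in>S. h (f i))"
  by (induction S rule: infinite_finite_induct) (simp_all add: zero add)

lemma prod: "h (prod f S) = (\<Prod>i\<in>S. h (f i))"
  by (induction S rule: infinite_finite_induct) (simp_all add: one mult)

lemma dvd: "a dvd b \<Longrightarrow> h a dvd h b"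
  by (auto simp: mult elim!: dvdE)

lemmas hom_simps = add mult one zero uminus diff power of_nat of_int sum prod

end

text \<open>The variables form an arbitrary type because the elements of a ring will themselves
  serve as variables of a polynomial ring mapping onto it.\<close>

type_synonym 'v int_mpoly = "('v \<Rightarrow>\<^sub>0 nat) \<Rightarrow>\<^sub>0 int"

definition mpoly_var :: "'v \<Rightarrow> 'v int_mpoly" where
  "mpoly_var v = Poly_Mapping.single (Poly_Mapping.single v 1) 1"

definition monom_eval :: "('v \<Rightarrow> 'a::comm_ring_1) \<Rightarrow> ('v \<Rightarrow>\<^sub>0 nat) \<Rightarrow> 'a" where
  "monom_eval f m = (\<Prod>v\<in>Poly_Mapping.keys m. f v ^ Poly_Mapping.lookup m v)"

definition mpoly_eval :: "('v \<Rightarrow> 'a::comm_ring_1) \<Rightarrow> 'v int_mpoly \<Rightarrow> 'a" where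
  "mpoly_eval f q = (\<Sum>m\<in>Poly_Mapping.keys q. of_int (Poly_Mapping.lookup q m) * monom_eval f m)"

lemma witt_poly_eval_eq: "witt_poly_eval = mpoly_eval"
  by (intro ext) (simp add: witt_poly_eval_def mpoly_eval_def monom_eval_def)

lemma witt_var_eq: "witt_var = mpoly_var"
  by (intro ext) (simp add: witt_var_def mpoly_var_def)

lemma monom_eval_superset:
  assumes "finite S" "Poly_Mapping.keys m \<subseteq> S"
  shows "monom_eval f m = (\<Prod>v\<in>S. f v ^ Poly_Mapping.lookup m v)"
  unfolding monom_eval_def using assms
  by (intro prod.mono_neutral_left) (auto simp: in_keys_iff)

lemma monom_eval_add: "monom_eval f (m + n) = monom_eval f m * monom_eval f n"
proof -
  let ?S = "Poly_Mapping.keys m \<union> Poly_Mapping.keys n"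
  have "Poly_Mapping.keys (m + n) \<subseteq> ?S" by (rule Poly_Mapping.keys_add)
  then show ?thesis
    by (subst (1 2 3) monom_eval_superset[of ?S])
       (auto simp: Poly_Mapping.lookup_add power_add prod.distrib)
qed

lemma monom_eval_0 [simp]: "monom_eval f 0 = 1"
  by (simp add: monom_eval_def)

lemma monom_eval_single [simp]: "monom_eval f (Poly_Mapping.single v k) = f v ^ k"
  by (cases "k = 0") (simp_all add: monom_eval_def)

lemma mpoly_eval_superset:
  assumes "finite S" "Poly_Mapping.keys q \<subseteq> S"
  shows "mpoly_eval f q = (\<Sum>m\<in>S. of_int (Poly_Mapping.lookup q m) * monom_eval f m)"
  unfolding mpoly_eval_def using assms
  by (intro sum.mono_neutral_left) (auto simp: in_keys_iff)

lemma mpoly_eval_add: "mpoly_eval f (q + r) = mpoly_eval f q + mpoly_eval f r"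
proof -
  let ?S = "Poly_Mapping.keys q \<union> Poly_Mapping.keys r"
  have "Poly_Mapping.keys (q + r) \<subseteq> ?S" by (rule Poly_Mapping.keys_add)
  then show ?thesis
    by (subst (1 2 3) mpoly_eval_superset[of ?S])
       (auto simp: Poly_Mapping.lookup_add sum.distrib algebra_simps)
qed

lemma mpoly_eval_single [simp]:
  "mpoly_eval f (Poly_Mapping.single m c) = of_int c * monom_eval f m"
  by (cases "c = 0") (simp_all add: mpoly_eval_def)

lemma mpoly_eval_0 [simp]: "mpoly_eval f 0 = 0"
  by (simp add: mpoly_eval_def)

lemma mpoly_eval_sum: "mpoly_eval f (sum q S) = (\<Sum>i\<in>S. mpoly_eval f (q i))"
  by (induction S rule: infinite_finite_induct) (simp_all add: mpoly_eval_add)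

lemma mpoly_as_sum:
  "q = (\<Sum>m\<in>Poly_Mapping.keys q. Poly_Mapping.single m (Poly_Mapping.lookup q m))"
proof (rule poly_mapping_eqI)
  fix k
  have "(\<Sum>m\<in>Poly_Mapping.keys q. Poly_Mapping.lookup q m when m = k) =
        (\<Sum>m\<in>Poly_Mapping.keys q. if m = k then Poly_Mapping.lookup q k else 0)"
    by (intro sum.cong) (auto simp: when_def)
  then show "Poly_Mapping.lookup q k = Poly_Mapping.lookup
    (\<Sum>m\<in>Poly_Mapping.keys q. Poly_Mapping.single m (Poly_Mapping.lookup q m)) k"
    by (simp add: Poly_Mapping.lookup_sum Poly_Mapping.lookup_single in_keys_iff)
qed

lemma mpoly_eval_mult: "mpoly_eval f (q * r) = mpoly_eval f q * mpoly_eval f r"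
proof -
  have "q * r = (\<Sum>m\<in>Poly_Mapping.keys q. \<Sum>n\<in>Poly_Mapping.keys r.
     Poly_Mapping.single (m + n) (Poly_Mapping.lookup q m * Poly_Mapping.lookup r n))"
    by (subst (1) mpoly_as_sum[of q], subst (1) mpoly_as_sum[of r])
       (simp add: sum_product Poly_Mapping.mult_single)
  then have "mpoly_eval f (q * r) = (\<Sum>m\<in>Poly_Mapping.keys q. \<Sum>n\<in>Poly_Mapping.keys r.
     (of_int (Poly_Mapping.lookup q m) * monom_eval f m) * (of_int (Poly_Mapping.lookup r n) * monom_eval f n))"
    by (simp add: mpoly_eval_sum monom_eval_add mult_ac)
  then show ?thesis
    by (simp add: mpoly_eval_def sum_product)
qed

lemma mpoly_eval_1 [simp]: "mpoly_eval f 1 = 1"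
  using mpoly_eval_single[of f 0 1] by simp

lemma ring_map_mpoly_eval: "ring_map (mpoly_eval f)"
  by unfold_locales (simp_all add: mpoly_eval_add mpoly_eval_mult)

lemma mpoly_eval_var [simp]: "mpoly_eval f (mpoly_var v) = f v"
  by (simp add: mpoly_var_def)

lemma (in ring_map) mpoly_eval: "h (mpoly_eval f q) = mpoly_eval (\<lambda>v. h (f v)) q"
  by (simp add: mpoly_eval_def monom_eval_def hom_simps)

lemma single_as_mpoly_eval:
  "Poly_Mapping.single m c = of_int c * monom_eval mpoly_var m"
proof -
  have pow: "mpoly_var v ^ k = Poly_Mapping.single (Poly_Mapping.single v k) 1" for v :: 'a and k
    by (induction k) (simp_all add: mpoly_var_def Poly_Mapping.mult_single flip: Poly_Mapping.single_add)
  have prod: "(\<Prod>v\<in>S. Poly_Mapping.single (g v) 1) = Poly_Mapping.single (\<Sum>v\<in>S. g v) 1"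
    if "finite S" for S :: "'a set" and g :: "'a \<Rightarrow> ('a \<Rightarrow>\<^sub>0 nat)"
    using that by (induction S) (simp_all add: Poly_Mapping.mult_single)
  have m: "(\<Sum>v\<in>Poly_Mapping.keys m. Poly_Mapping.single v (Poly_Mapping.lookup m v)) = m"
  proof (rule poly_mapping_eqI)
    fix k
    have "(\<Sum>v\<in>Poly_Mapping.keys m. Poly_Mapping.lookup m v when v = k) =
          (\<Sum>v\<in>Poly_Mapping.keys m. if v = k then Poly_Mapping.lookup m k else 0)"
      by (intro sum.cong) (auto simp: when_def)
    then show "Poly_Mapping.lookup (\<Sum>v\<in>Poly_Mapping.keys m.
        Poly_Mapping.single v (Poly_Mapping.lookup m v)) k = Poly_Mapping.lookup m k"
      by (simp add: Poly_Mapping.lookup_sum Poly_Mapping.lookup_single in_keys_iff)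
  qed
  have "(of_int c :: 'a int_mpoly) = Poly_Mapping.single 0 c"
    using Poly_Mapping.single_of_int[of c, where ?'a = "'a \<Rightarrow>\<^sub>0 nat" and ?'b = int] by simp
  then show ?thesis
    by (simp add: monom_eval_def pow prod m Poly_Mapping.mult_single del: single_of_int)
qed

text \<open>The variables generate the polynomials as a ring, so a property stable under the ring
  operations, such as a congruence for an endomorphism, is checked on variables.\<close>

lemma int_mpoly_induct [case_names one var uminus add mult]:
  assumes 1: "P 1" and var: "\<And>v. P (mpoly_var v)" and uminus: "\<And>a. P a \<Longrightarrow> P (- a)"
    and add: "\<And>a b. P a \<Longrightarrow> P b \<Longrightarrow> P (a + b)" and mult: "\<And>a b. P a \<Longrightarrow> P b \<Longrightarrow> P (a * b)"
  shows "P (q :: 'v int_mpoly)"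
proof -
  have P0: "P 0" using add[OF 1 uminus[OF 1]] by simp
  have nat: "P (of_nat n)" for n by (induction n) (auto intro: P0 1 add)
  have int: "P (of_int c)" for c
    by (cases c rule: int_cases2) (simp_all add: nat uminus)
  have pow: "P a \<Longrightarrow> P (a ^ n)" for a n by (induction n) (auto intro: 1 mult)
  have prod: "(\<And>i. P (g i)) \<Longrightarrow> P (prod g S)" for g :: "'v \<Rightarrow> 'v int_mpoly" and S
    by (induction S rule: infinite_finite_induct) (auto intro: 1 mult)
  have sum: "(\<And>i. P (g i)) \<Longrightarrow> P (sum g S)" for g :: "('v \<Rightarrow>\<^sub>0 nat) \<Rightarrow> 'v int_mpoly" and S
    by (induction S rule: infinite_finite_induct) (auto intro: P0 add)
  have "P (\<Sum>m\<in>Poly_Mapping.keys q. of_int (Poly_Mapping.lookup q m) * monom_eval mpoly_var m)"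
    unfolding monom_eval_def by (intro sum mult int prod pow var)
  then show ?thesis
    by (subst mpoly_as_sum) (simp add: single_as_mpoly_eval del: Poly_Mapping.single_of_int)
qed

lemma lookup_of_nat_times:
  "Poly_Mapping.lookup (of_nat n * q :: 'v int_mpoly) k = int n * Poly_Mapping.lookup q k"
  by (induction n) (simp_all add: Poly_Mapping.lookup_add algebra_simps)

section \<open>Congruences and ghost components\<close>

lemma prime_dvd_binomial_power:
  assumes "prime p"
  shows "(of_nat p :: 'a::comm_ring_1) dvd (a + b) ^ p - (a ^ p + b ^ p)"
proof -
  have p: "p > 0" using assms prime_gt_0_nat by blast
  have "(a + b) ^ p = (\<Sum>k\<le>p. of_nat (p choose k) * a ^ k * b ^ (p - k))"
    by (rule binomial_ring)
  also have "{..p} = insert 0 (insert p {1..<p})" using p by auto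
  also have "(\<Sum>k\<in>\<dots>. of_nat (p choose k) * a ^ k * b ^ (p - k)) =
     b ^ p + (a ^ p + (\<Sum>k\<in>{1..<p}. of_nat (p choose k) * a ^ k * b ^ (p - k)))"
    using p by (subst sum.insert; simp)+
  finally have "(a + b) ^ p - (a ^ p + b ^ p) = (\<Sum>k\<in>{1..<p}. of_nat (p choose k) * a ^ k * b ^ (p - k))"
    by simp
  also have "(of_nat p :: 'a) dvd \<dots>"
  proof (intro dvd_sum)
    fix k assume "k \<in> {1..<p}"
    then have "p dvd (p choose k)" using assms by (intro dvd_choose_prime) auto
    then have "(of_nat p :: 'a) dvd of_nat (p choose k)" by (auto elim!: dvdE)
    then show "(of_nat p :: 'a) dvd of_nat (p choose k) * a ^ k * b ^ (p - k)"
      by (simp add: mult.assoc dvd_mult2)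
  qed
  finally show ?thesis .
qed

text \<open>In a^p - b^p = (a - b) * (sum of the b^(p-1-i) a^i) each of the p summands is congruent
  to b^(p-1) modulo p, so the second factor contributes one more p.\<close>

lemma power_p_cong:
  fixes a b :: "'a::comm_ring_1"
  assumes "of_nat p ^ Suc j dvd a - b"
  shows "of_nat p ^ Suc (Suc j) dvd a ^ p - b ^ p"
proof -
  have *: "of_nat p dvd a - b" using assms by (auto intro: dvd_mult_left)
  have "of_nat p dvd a ^ i - b ^ i" for i
    using * by (metis dvd_mult2 power_diff_sumr2)
  then have "of_nat p dvd (\<Sum>i<p. b ^ (p - Suc i) * (a ^ i - b ^ i))"
    by (intro dvd_sum dvd_mult) auto
  also have "(\<Sum>i<p. b ^ (p - Suc i) * (a ^ i - b ^ i)) =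
     (\<Sum>i<p. b ^ (p - Suc i) * a ^ i) - (\<Sum>i<p. b ^ (p - Suc i) * b ^ i)"
    by (simp add: algebra_simps sum_subtractf)
  also have "(\<Sum>i<p. b ^ (p - Suc i) * b ^ i) = (\<Sum>i<p. b ^ (p - 1))"
    by (intro sum.cong) (simp_all flip: power_add)
  also have "\<dots> = of_nat p * b ^ (p - 1)" by simp
  finally have "of_nat p dvd (\<Sum>i<p. b ^ (p - Suc i) * a ^ i) - of_nat p * b ^ (p - 1) + of_nat p * b ^ (p - 1)"
    by (intro dvd_add) simp_all
  then have "of_nat p dvd (\<Sum>i<p. b ^ (p - Suc i) * a ^ i)" by simp
  then have "of_nat p ^ Suc j * of_nat p dvd (a - b) * (\<Sum>i<p. b ^ (p - Suc i) * a ^ i)"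
    using assms by (intro mult_dvd_mono)
  then show ?thesis by (simp add: power_diff_sumr2 mult_ac)
qed

lemma power_prime_power_cong:
  fixes a b :: "'a::comm_ring_1"
  assumes "of_nat p dvd a - b"
  shows "of_nat p ^ Suc j dvd a ^ (p ^ j) - b ^ (p ^ j)"
proof (induction j)
  case (Suc j)
  from power_p_cong[OF Suc] show ?case by (simp add: mult.commute flip: power_mult)
qed (use assms in simp)

lemma (in ring_map) witt_ghost: "h (witt_ghost p n x) = witt_ghost p n (\<lambda>i. h (x i))"
  by (simp add: witt_ghost_def hom_simps)

lemma witt_ghost_0 [simp]: "witt_ghost p 0 x = x 0"
  by (simp add: witt_ghost_def)

lemma witt_ghost_Suc:
  "witt_ghost p (Suc n) x = witt_ghost p n (\<lambda>i. x i ^ p) + of_nat p ^ Suc n * x (Suc n)"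
proof -
  have "x i ^ p ^ (Suc n - i) = (x i ^ p) ^ p ^ (n - i)" if "i \<le> n" for i
    using that by (simp add: Suc_diff_le mult.commute flip: power_mult)
  then show ?thesis by (simp add: witt_ghost_def)
qed

text \<open>The anonymous \<open>g\<close> sees only the components below n; two vectors agreeing
  there differ in the n-th ghost component by p^n times the difference of their n-th
  components.\<close>

lemma witt_ghost_split_last:
  "\<exists>g. \<forall>x :: nat \<Rightarrow> 'a::comm_ring_1. witt_ghost p n x = g (\<lambda>i. if i < n then x i else 0) + of_nat p ^ n * x n"
proof (intro exI allI)
  fix x :: "nat \<Rightarrow> 'a"
  have "{..n} = insert n {..<n}" by auto
  then show "witt_ghost p n x =
      (\<Sum>i<n. of_nat (p ^ i) * (if i < n then x i else 0) ^ (p ^ (n - i))) + of_nat p ^ n * x n"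
    by (simp add: witt_ghost_def)
qed

text \<open>A congruence modulo p becomes one modulo p^(n-i+1) after raising to the power p^(n-i),
  and the coefficient p^i supplies the rest.\<close>

lemma witt_ghost_cong:
  fixes x y :: "nat \<Rightarrow> 'a::comm_ring_1"
  assumes "\<And>i. i \<le> n \<Longrightarrow> of_nat p dvd x i - y i"
  shows "of_nat p ^ Suc n dvd witt_ghost p n x - witt_ghost p n y"
proof -
  have "of_nat p ^ Suc n dvd of_nat p ^ i * (x i ^ (p ^ (n - i)) - y i ^ (p ^ (n - i)))"
    if "i \<le> n" for i
  proof -
    have "of_nat p ^ i * of_nat p ^ Suc (n - i) dvd of_nat p ^ i * (x i ^ (p ^ (n - i)) - y i ^ (p ^ (n - i)))"
      using assms[OF that] by (intro mult_dvd_mono power_prime_power_cong) auto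
    moreover have "i + Suc (n - i) = Suc n" using that by simp
    ultimately show ?thesis by (simp only: flip: power_add)
  qed
  then have "of_nat p ^ Suc n dvd (\<Sum>i\<le>n. of_nat p ^ i * (x i ^ (p ^ (n - i)) - y i ^ (p ^ (n - i))))"
    by (intro dvd_sum) auto
  then show ?thesis
    by (simp add: witt_ghost_def algebra_simps sum_subtractf)
qed

definition torsion_free :: "nat \<Rightarrow> 'a::comm_ring_1 itself \<Rightarrow> bool" where
  "torsion_free p _ \<longleftrightarrow> (\<forall>x::'a. of_nat p * x = 0 \<longrightarrow> x = 0)"

lemma torsion_free_power:
  assumes "torsion_free p TYPE('a::comm_ring_1)" "of_nat p ^ n * (x::'a) = of_nat p ^ n * y"
  shows "x = y"
  using assms(2)
proof (induction n)
  case (Suc n)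
  then have "of_nat p * (of_nat p ^ n * x - of_nat p ^ n * y) = 0"
    by (simp add: algebra_simps)
  then show ?case using assms(1) Suc.IH by (auto simp: torsion_free_def)
qed simp

lemma torsion_free_power_dvd:
  assumes "torsion_free p TYPE('a::comm_ring_1)" "of_nat p ^ (n + m) dvd of_nat p ^ n * (x::'a)"
  shows "of_nat p ^ m dvd x"
proof -
  obtain y where "of_nat p ^ n * x = of_nat p ^ n * (of_nat p ^ m * y)"
    using assms(2) by (auto elim!: dvdE simp: power_add mult_ac)
  then show ?thesis using torsion_free_power[OF assms(1)] by force
qed

lemma torsion_free_mpoly: "p > 0 \<Longrightarrow> torsion_free p TYPE('v int_mpoly)"
  by (auto simp: torsion_free_def poly_mapping_eq_iff fun_eq_iff lookup_of_nat_times)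

lemma witt_ghost_inject_le:
  fixes x y :: "nat \<Rightarrow> 'a::comm_ring_1"
  assumes "torsion_free p TYPE('a)"
    and "\<And>m. m \<le> n \<Longrightarrow> witt_ghost p m x = witt_ghost p m y"
  shows "i \<le> n \<Longrightarrow> x i = y i"
proof (induction i rule: less_induct)
  case (less i)
  obtain g where g: "\<And>x :: nat \<Rightarrow> 'a. witt_ghost p i x = g (\<lambda>j. if j < i then x j else 0) + of_nat p ^ i * x i"
    using witt_ghost_split_last by blast
  have "(\<lambda>j. if j < i then x j else 0) = (\<lambda>j. if j < i then y j else 0)"
    using less by auto
  then have "of_nat p ^ i * x i = of_nat p ^ i * y i"
    using assms(2)[OF less.prems] by (simp add: g)
  then show ?case by (rule torsion_free_power[OF assms(1)])
qed

lemma witt_ghost_inject: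
  fixes x y :: "nat \<Rightarrow> 'a::comm_ring_1"
  assumes "torsion_free p TYPE('a)" "\<And>n. witt_ghost p n x = witt_ghost p n y"
  shows "x = y"
  using witt_ghost_inject_le[OF assms(1)] assms(2) by (intro ext) blast

text \<open>Converse of \<open>witt_ghost_cong\<close>: over a torsion-free ring the ghost map
  remains injective modulo p when the n-th ghost component is read modulo p^(n+1).\<close>

lemma witt_ghost_cong_inject:
  fixes x y :: "nat \<Rightarrow> 'a::comm_ring_1"
  assumes tf: "torsion_free p TYPE('a)"
    and "\<And>n. of_nat p ^ Suc n dvd witt_ghost p n x - witt_ghost p n y"
  shows "of_nat p dvd x i - y i"
proof (induction i rule: less_induct)
  case (less i)
  obtain g where g: "\<And>x :: nat \<Rightarrow> 'a. witt_ghost p i x = g (\<lambda>j. if j < i then x j else 0) + of_nat p ^ i * x i"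
    using witt_ghost_split_last by blast
  \<comment> \<open>A hybrid of x and y: replacing the already congruent components below i changes
    the ghost component only by a multiple of p^(i+1), and what remains is p^i (x_i - y_i).\<close>
  define z where "z j = (if j < i then x j else y j)" for j
  have 1: "of_nat p ^ Suc i dvd witt_ghost p i z - witt_ghost p i y"
    by (rule witt_ghost_cong) (use less in \<open>auto simp: z_def\<close>)
  have "(\<lambda>j. if j < i then z j else 0) = (\<lambda>j. if j < i then x j else 0)"
    by (auto simp: z_def)
  then have "witt_ghost p i x - witt_ghost p i z = of_nat p ^ i * (x i - y i)"
    by (simp add: g z_def algebra_simps)
  moreover have "of_nat p ^ Suc i dvd (witt_ghost p i x - witt_ghost p i y) - (witt_ghost p i z - witt_ghost p i y)"
    by (intro dvd_diff assms 1)
  ultimately have "of_nat p ^ (i + 1) dvd of_nat p ^ i * (x i - y i)" by simp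
  from torsion_free_power_dvd[OF tf this] show ?case by simp
qed

section \<open>Frobenius lifts and Dwork's criterion for ghost sequences\<close>

locale frob_lift = ring_map h for h :: "'a::comm_ring_1 \<Rightarrow> 'a" +
  fixes p :: nat
  assumes cong: "of_nat p dvd h x - x ^ p"
begin

lemma witt_ghost_power: "of_nat p ^ Suc n dvd h (witt_ghost p n x) - witt_ghost p n (\<lambda>i. x i ^ p)"
  unfolding witt_ghost by (rule witt_ghost_cong) (rule cong)

lemma witt_ghost_step: "of_nat p ^ Suc n dvd witt_ghost p (Suc n) x - h (witt_ghost p n x)"
proof -
  have "of_nat p ^ Suc n dvd of_nat p ^ Suc n * x (Suc n) - (h (witt_ghost p n x) - witt_ghost p n (\<lambda>i. x i ^ p))"
    by (intro dvd_diff witt_ghost_power) simp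
  then show ?thesis by (simp add: witt_ghost_Suc algebra_simps)
qed

text \<open>Dwork's lemma. The congruence makes w_(n+1) - w_n(x^p) divisible by p^(n+1), and the
  quotient is the next component.\<close>

lemma dwork:
  assumes tf: "torsion_free p TYPE('a)"
    and w: "\<And>n. of_nat p ^ Suc n dvd w (Suc n) - h (w n)"
  shows "\<exists>x. \<forall>n. witt_ghost p n x = w n"
proof -
  have ex: "\<exists>x. \<forall>m\<le>n. witt_ghost p m x = w m" for n
  proof (induction n)
    case 0
    show ?case by (intro exI[of _ "\<lambda>_. w 0"]) simp
  next
    case (Suc n)
    then obtain x where x: "\<And>m. m \<le> n \<Longrightarrow> witt_ghost p m x = w m" by blast
    have "of_nat p ^ Suc n dvd (w (Suc n) - h (w n)) + (h (witt_ghost p n x) - witt_ghost p n (\<lambda>i. x i ^ p))"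
      by (intro dvd_add w witt_ghost_power)
    then obtain c where c: "w (Suc n) - witt_ghost p n (\<lambda>i. x i ^ p) = of_nat p ^ Suc n * c"
      by (auto simp: x elim!: dvdE)
    define y where "y = x(Suc n := c)"
    have "witt_ghost p m y = witt_ghost p m x" if "m \<le> n" for m
      using that unfolding witt_ghost_def by (intro sum.cong) (auto simp: y_def)
    moreover have "witt_ghost p n (\<lambda>i. y i ^ p) = witt_ghost p n (\<lambda>i. x i ^ p)"
      unfolding witt_ghost_def by (intro sum.cong) (auto simp: y_def)
    then have "witt_ghost p (Suc n) y = w (Suc n)"
      unfolding witt_ghost_Suc using c by (simp add: y_def algebra_simps)
    ultimately show ?case using x by (intro exI[of _ y]) (auto simp: le_Suc_eq)
  qed
  \<comment> \<open>The solutions chosen up to different levels need not be related a priori;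
    torsion-freeness forces them to agree where both are determined, so the diagonal is a solution
    at all levels.\<close>
  define xs :: "nat \<Rightarrow> nat \<Rightarrow> 'a" where "xs n = (SOME x. \<forall>m\<le>n. witt_ghost p m x = w m)" for n
  have xs: "witt_ghost p m (xs n) = w m" if "m \<le> n" for m n
    using someI_ex[OF ex[of n]] that unfolding xs_def by blast
  have diag: "xs n i = xs i i" if "i \<le> n" for n i
  proof -
    have "witt_ghost p m (xs n) = witt_ghost p m (xs i)" if "m \<le> i" for m
      using that \<open>i \<le> n\<close> by (simp add: xs)
    from witt_ghost_inject_le[OF tf this order.refl] show ?thesis .
  qed
  have "witt_ghost p n (\<lambda>i. xs i i) = witt_ghost p n (xs n)" for n
    unfolding witt_ghost_def by (intro sum.cong refl) (subst diag; simp)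
  then have "\<forall>n. witt_ghost p n (\<lambda>i. xs i i) = w n" using xs by simp
  then show ?thesis by blast
qed

lemma dwork_add:
  fixes x y :: "nat \<Rightarrow> 'a"
  assumes "torsion_free p TYPE('a)"
  shows "\<exists>z. \<forall>n. witt_ghost p n z = witt_ghost p n x + witt_ghost p n y"
proof (rule dwork[OF assms])
  fix n
  show "of_nat p ^ Suc n dvd witt_ghost p (Suc n) x + witt_ghost p (Suc n) y
     - h (witt_ghost p n x + witt_ghost p n y)"
    using dvd_add[OF witt_ghost_step[of n x] witt_ghost_step[of n y]]
    by (simp add: add algebra_simps)
qed

lemma dwork_uminus:
  fixes x :: "nat \<Rightarrow> 'a"
  assumes "torsion_free p TYPE('a)"
  shows "\<exists>z. \<forall>n. witt_ghost p n z = - witt_ghost p n x"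
proof (rule dwork[OF assms])
  fix n
  show "of_nat p ^ Suc n dvd - witt_ghost p (Suc n) x - h (- witt_ghost p n x)"
    using witt_ghost_step[of n x] dvd_minus_iff[of "of_nat p ^ Suc n" "witt_ghost p (Suc n) x - h (witt_ghost p n x)"]
    by (simp only: uminus minus_diff_eq) (simp add: algebra_simps)
qed

lemma dwork_mult:
  fixes x y :: "nat \<Rightarrow> 'a"
  assumes "torsion_free p TYPE('a)"
  shows "\<exists>z. \<forall>n. witt_ghost p n z = witt_ghost p n x * witt_ghost p n y"
proof (rule dwork[OF assms])
  fix n
  have "witt_ghost p (Suc n) x * witt_ghost p (Suc n) y - h (witt_ghost p n x * witt_ghost p n y)
    = (witt_ghost p (Suc n) x - h (witt_ghost p n x)) * witt_ghost p (Suc n) y +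
      h (witt_ghost p n x) * (witt_ghost p (Suc n) y - h (witt_ghost p n y))"
    by (simp add: mult algebra_simps)
  then show "of_nat p ^ Suc n dvd witt_ghost p (Suc n) x * witt_ghost p (Suc n) y
     - h (witt_ghost p n x * witt_ghost p n y)"
    using witt_ghost_step[of n x] witt_ghost_step[of n y] by (simp add: dvd_add dvd_mult dvd_mult2 del: power_Suc)
qed

end

text \<open>The polynomials q with q(X^p) congruent to q^p modulo p contain the variables and are
  closed under the ring operations.\<close>

lemma mpoly_frob_lift:
  assumes "prime p"
  shows "frob_lift (mpoly_eval (\<lambda>v. mpoly_var v ^ p) :: 'v int_mpoly \<Rightarrow> 'v int_mpoly) p"
proof -
  interpret ring_map "mpoly_eval (\<lambda>v. mpoly_var v ^ p) :: 'v int_mpoly \<Rightarrow> _"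
    by (rule ring_map_mpoly_eval)
  show ?thesis
  proof
    fix q :: "'v int_mpoly"
    let ?h = "mpoly_eval (\<lambda>v. mpoly_var v ^ p) :: 'v int_mpoly \<Rightarrow> _"
    show "of_nat p dvd ?h q - q ^ p"
    proof (induction q rule: int_mpoly_induct)
      \<comment> \<open>Expanding 0 = (a + (-a))^p modulo p gives the sign of (-a)^p without
        separating p = 2 from odd p.\<close>
      case (uminus a)
      have "of_nat p dvd ((a + - a) ^ p - (a ^ p + (- a) ^ p)) - (?h a - a ^ p)"
        by (rule dvd_diff[OF prime_dvd_binomial_power[OF assms] uminus])
      also have "((a + - a) ^ p - (a ^ p + (- a) ^ p)) - (?h a - a ^ p) = ?h (- a) - (- a) ^ p"
      proof -
        have "(0 - (x + y)) - (z - x) = - z - y" for x y z :: "'v int_mpoly" by simp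
        then show ?thesis
          using assms prime_gt_0_nat[of p] by (simp only: hom_simps(5) add.right_inverse power_0_left) simp
      qed
      finally show ?case .
    next
      case (add a b)
      have "of_nat p dvd (?h a - a ^ p) + (?h b - b ^ p) - ((a + b) ^ p - (a ^ p + b ^ p))"
        by (rule dvd_diff[OF dvd_add[OF add] prime_dvd_binomial_power[OF assms]])
      then show ?case by (simp add: mpoly_eval_add algebra_simps)
    next
      case (mult a b)
      have "of_nat p dvd (?h a - a ^ p) * ?h b + a ^ p * (?h b - b ^ p)"
        using mult by simp
      then show ?case by (simp add: mpoly_eval_mult power_mult_distrib algebra_simps)
    qed simp_all
  qed
qed

section \<open>The ring of Witt vectors\<close>

text \<open>Witt's theorem for addition: Dwork's criterion gives existence in the polynomial ring
  and torsion-freeness gives uniqueness, so the \<open>THE\<close> denotes.\<close>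

lemma witt_add_poly_ghost:
  assumes "prime p"
  shows "witt_ghost p n (witt_add_poly p) =
    witt_ghost p n (\<lambda>i. mpoly_var (Inl i)) + witt_ghost p n (\<lambda>i. mpoly_var (Inr i))"
proof -
  have tf: "torsion_free p TYPE((nat + nat) int_mpoly)"
    using assms prime_gt_0_nat by (intro torsion_free_mpoly) blast
  obtain S :: "nat \<Rightarrow> (nat + nat) int_mpoly" where S: "\<forall>n. witt_ghost p n S =
    witt_ghost p n (\<lambda>i. mpoly_var (Inl i)) + witt_ghost p n (\<lambda>i. mpoly_var (Inr i))"
    using frob_lift.dwork_add[OF mpoly_frob_lift[OF assms] tf] by blast
  have "witt_add_poly p = S"
    unfolding witt_add_poly_def witt_var_eq
    by (rule the_equality) (use S in \<open>auto intro!: witt_ghost_inject[OF tf]\<close>)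
  then show ?thesis using S by blast
qed

lemma witt_mult_poly_ghost:
  assumes "prime p"
  shows "witt_ghost p n (witt_mult_poly p) =
    witt_ghost p n (\<lambda>i. mpoly_var (Inl i)) * witt_ghost p n (\<lambda>i. mpoly_var (Inr i))"
proof -
  have tf: "torsion_free p TYPE((nat + nat) int_mpoly)"
    using assms prime_gt_0_nat by (intro torsion_free_mpoly) blast
  obtain S :: "nat \<Rightarrow> (nat + nat) int_mpoly" where S: "\<forall>n. witt_ghost p n S =
    witt_ghost p n (\<lambda>i. mpoly_var (Inl i)) * witt_ghost p n (\<lambda>i. mpoly_var (Inr i))"
    using frob_lift.dwork_mult[OF mpoly_frob_lift[OF assms] tf] by blast
  have "witt_mult_poly p = S"
    unfolding witt_mult_poly_def witt_var_eq
    by (rule the_equality) (use S in \<open>auto intro!: witt_ghost_inject[OF tf]\<close>)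
  then show ?thesis using S by blast
qed

text \<open>The operation of \<open>witt_ring\<close> as a bare function over any commutative ring,
  so that it also applies to lifts in characteristic zero.\<close>

definition witt_add :: "nat \<Rightarrow> (nat \<Rightarrow> 'a::comm_ring_1) \<Rightarrow> (nat \<Rightarrow> 'a) \<Rightarrow> nat \<Rightarrow> 'a" where
  "witt_add p x y = (\<lambda>n. mpoly_eval (case_sum x y) (witt_add_poly p n))"

definition witt_mult :: "nat \<Rightarrow> (nat \<Rightarrow> 'a::comm_ring_1) \<Rightarrow> (nat \<Rightarrow> 'a) \<Rightarrow> nat \<Rightarrow> 'a" where
  "witt_mult p x y = (\<lambda>n. mpoly_eval (case_sum x y) (witt_mult_poly p n))"

lemma witt_ghost_add:
  assumes "prime p"
  shows "witt_ghost p n (witt_add p x y) = witt_ghost p n x + witt_ghost p n y"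
proof -
  interpret ring_map "mpoly_eval (case_sum x y)" by (rule ring_map_mpoly_eval)
  show ?thesis
    using arg_cong[OF witt_add_poly_ghost[OF assms], of "mpoly_eval (case_sum x y)" n]
    by (simp add: witt_ghost add witt_add_def)
qed

lemma witt_ghost_mult:
  assumes "prime p"
  shows "witt_ghost p n (witt_mult p x y) = witt_ghost p n x * witt_ghost p n y"
proof -
  interpret ring_map "mpoly_eval (case_sum x y)" by (rule ring_map_mpoly_eval)
  show ?thesis
    using arg_cong[OF witt_mult_poly_ghost[OF assms], of "mpoly_eval (case_sum x y)" n]
    by (simp add: witt_ghost mult witt_mult_def)
qed

lemma witt_add_0: "prime p \<Longrightarrow> witt_add p x y 0 = x 0 + y 0"
  using witt_ghost_add[of p 0 x y] by simp

lemma witt_mult_0: "prime p \<Longrightarrow> witt_mult p x y 0 = x 0 * y 0"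
  using witt_ghost_mult[of p 0 x y] by simp

lemma (in ring_map) hom_witt_add: "(\<lambda>i. h (witt_add p x y i)) = witt_add p (\<lambda>i. h (x i)) (\<lambda>i. h (y i))"
proof -
  have "(\<lambda>v. h (case_sum x y v)) = case_sum (\<lambda>i. h (x i)) (\<lambda>i. h (y i))"
    by (auto split: sum.splits)
  then show ?thesis by (simp add: witt_add_def mpoly_eval)
qed

lemma (in ring_map) hom_witt_mult: "(\<lambda>i. h (witt_mult p x y i)) = witt_mult p (\<lambda>i. h (x i)) (\<lambda>i. h (y i))"
proof -
  have "(\<lambda>v. h (case_sum x y v)) = case_sum (\<lambda>i. h (x i)) (\<lambda>i. h (y i))"
    by (auto split: sum.splits)
  then show ?thesis by (simp add: witt_mult_def mpoly_eval)
qed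

lemma teichmuller_simps [simp]: "teichmuller a 0 = a" "teichmuller a (Suc n) = 0"
  by (simp_all add: teichmuller_def)

lemma witt_ghost_teichmuller: "p > 0 \<Longrightarrow> witt_ghost p n (teichmuller a) = a ^ p ^ n"
proof -
  assume p: "p > 0"
  have "witt_ghost p n (teichmuller a) = (\<Sum>i\<in>{0}. of_nat (p ^ i) * teichmuller a i ^ p ^ (n - i))"
    unfolding witt_ghost_def using p
    by (intro sum.mono_neutral_right) (auto simp: teichmuller_def power_0_left)
  then show ?thesis by (simp add: teichmuller_def)
qed

lemma witt_ghost_zero: "p > 0 \<Longrightarrow> witt_ghost p n (\<lambda>_. 0) = 0"
  using witt_ghost_teichmuller[of p n 0] by (simp add: teichmuller_def power_0_left cong: if_cong)

text \<open>The Verschiebung.\<close>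

definition witt_shift :: "(nat \<Rightarrow> 'a::zero) \<Rightarrow> nat \<Rightarrow> 'a" where
  "witt_shift x n = (case n of 0 \<Rightarrow> 0 | Suc m \<Rightarrow> x m)"

lemma witt_shift_simps [simp]: "witt_shift x 0 = 0" "witt_shift x (Suc n) = x n"
  by (simp_all add: witt_shift_def)

lemma witt_ghost_shift:
  assumes "p > 0"
  shows "witt_ghost p (Suc n) (witt_shift x) = of_nat p * witt_ghost p n x"
proof -
  have "witt_ghost p (Suc n) (witt_shift x) =
      (\<Sum>i\<le>n. of_nat (p ^ Suc i) * x i ^ p ^ (n - i))"
    unfolding witt_ghost_def using assms
    by (subst sum.atMost_Suc_shift) (simp add: power_0_left)
  then show ?thesis by (simp add: witt_ghost_def sum_distrib_left mult.assoc)
qed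

lemma (in ring_map) hom_witt_shift: "(\<lambda>i. h (witt_shift x i)) = witt_shift (\<lambda>i. h (x i))"
  by (auto simp: witt_shift_def zero split: nat.splits)

lemma (in ring_map) hom_teichmuller: "(\<lambda>i. h (teichmuller x i)) = teichmuller (h x)"
  by (auto simp: teichmuller_def zero)

text \<open>
  Every ring is a quotient of a torsion-free one carrying a Frobenius lift, where identities
  between Witt vectors may be checked on ghost components.
\<close>

locale witt_lift =
  fixes p :: nat and ty :: "'a::comm_ring_1 itself"
  assumes p: "prime p"
begin

definition lift :: "(nat \<Rightarrow> 'a) \<Rightarrow> nat \<Rightarrow> 'a int_mpoly" where
  "lift x = (\<lambda>i. mpoly_var (x i))"

definition proj :: "(nat \<Rightarrow> 'a int_mpoly) \<Rightarrow> nat \<Rightarrow> 'a" where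
  "proj u = (\<lambda>i. mpoly_eval (\<lambda>a. a) (u i))"

lemma p_pos: "p > 0" using p prime_gt_0_nat by blast

sublocale ring_map "mpoly_eval (\<lambda>a. a) :: 'a int_mpoly \<Rightarrow> 'a"
  by (rule ring_map_mpoly_eval)

lemma proj_lift: "proj (lift x) = x"
  by (simp add: proj_def lift_def)

lemma proj_hom:
  "proj (witt_add p u v) = witt_add p (proj u) (proj v)"
  "proj (witt_mult p u v) = witt_mult p (proj u) (proj v)"
  "proj (witt_shift u) = witt_shift (proj u)"
  "proj (teichmuller b) = teichmuller (mpoly_eval (\<lambda>a. a) b)"
  by (simp_all add: proj_def hom_witt_add hom_witt_mult hom_witt_shift hom_teichmuller)

lemma tf: "torsion_free p TYPE('a int_mpoly)"
  by (rule torsion_free_mpoly) (rule p_pos)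

lemma ident:
  assumes "\<And>n. witt_ghost p n u = witt_ghost p n v"
  shows "proj u = proj v"
  using witt_ghost_inject[OF tf assms] by simp

text \<open>For identities special to characteristic p: ghosts agreeing modulo p^(n+1) give
  components agreeing modulo p, and that difference dies in the quotient.\<close>

lemma ident_p:
  assumes "\<And>n. of_nat p ^ Suc n dvd witt_ghost p n u - witt_ghost p n v" "of_nat p = (0::'a)"
  shows "proj u = proj v"
proof
  fix i
  have "of_nat p dvd u i - v i" by (rule witt_ghost_cong_inject[OF tf assms(1)])
  from dvd[OF this] show "proj u i = proj v i"
    by (simp add: proj_def hom_simps assms(2))
qed

lemmas ghost_simps = witt_ghost_add[OF p] witt_ghost_mult[OF p] witt_ghost_teichmuller[OF p_pos]
  witt_ghost_zero[OF p_pos] proj_hom proj_lift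

lemma proj_zero: "proj (\<lambda>_. 0) = (\<lambda>_. 0)"
  by (simp add: proj_def)

lemma witt_add_assoc: "witt_add p (witt_add p x y) z = witt_add p x (witt_add p y (z :: nat \<Rightarrow> 'a))"
  using ident[of "witt_add p (witt_add p (lift x) (lift y)) (lift z)"
      "witt_add p (lift x) (witt_add p (lift y) (lift z))"]
  by (simp add: ghost_simps add_ac)

lemma witt_add_commute: "witt_add p x y = witt_add p y (x :: nat \<Rightarrow> 'a)"
  using ident[of "witt_add p (lift x) (lift y)" "witt_add p (lift y) (lift x)"]
  by (simp add: ghost_simps add_ac)

lemma witt_add_zero: "witt_add p (\<lambda>_. 0) x = (x :: nat \<Rightarrow> 'a)"
  using ident[of "witt_add p (\<lambda>_. 0) (lift x)" "lift x"]
  by (simp add: ghost_simps proj_zero)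

text \<open>Existence only: for p = 2 negation is not componentwise, so the inverse is taken from
  Dwork's criterion upstairs.\<close>

lemma witt_add_inverse: "\<exists>y. witt_add p x y = (\<lambda>_. 0 :: 'a)"
proof -
  obtain v where "\<forall>n. witt_ghost p n v = - witt_ghost p n (lift x)"
    using frob_lift.dwork_uminus[OF mpoly_frob_lift[OF p] tf] by blast
  then have "proj (witt_add p (lift x) v) = proj (\<lambda>_. 0)"
    by (intro ident) (simp add: ghost_simps)
  then show ?thesis by (auto simp: ghost_simps proj_zero)
qed

lemma witt_mult_assoc: "witt_mult p (witt_mult p x y) z = witt_mult p x (witt_mult p y (z :: nat \<Rightarrow> 'a))"
  using ident[of "witt_mult p (witt_mult p (lift x) (lift y)) (lift z)"
      "witt_mult p (lift x) (witt_mult p (lift y) (lift z))"]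
  by (simp add: ghost_simps mult_ac)

lemma witt_mult_commute: "witt_mult p x y = witt_mult p y (x :: nat \<Rightarrow> 'a)"
  using ident[of "witt_mult p (lift x) (lift y)" "witt_mult p (lift y) (lift x)"]
  by (simp add: ghost_simps mult_ac)

lemma witt_mult_one: "witt_mult p (teichmuller 1) x = (x :: nat \<Rightarrow> 'a)"
  using ident[of "witt_mult p (teichmuller 1) (lift x)" "lift x"]
  by (simp add: ghost_simps)

lemma witt_distrib: "witt_mult p (witt_add p x y) z =
    witt_add p (witt_mult p x z) (witt_mult p y (z :: nat \<Rightarrow> 'a))"
  using ident[of "witt_mult p (witt_add p (lift x) (lift y)) (lift z)"
      "witt_add p (witt_mult p (lift x) (lift z)) (witt_mult p (lift y) (lift z))"]
  by (simp add: ghost_simps algebra_simps)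

lemma witt_mult_teichmuller: "witt_mult p (teichmuller a) (teichmuller b) = teichmuller (a * b :: 'a)"
  using ident[of "witt_mult p (teichmuller (mpoly_var a)) (teichmuller (mpoly_var b))"
      "teichmuller (mpoly_var a * mpoly_var b)"]
  by (simp add: ghost_simps power_mult_distrib mult)

lemma witt_add_shift: "witt_add p (witt_shift x) (witt_shift y) = witt_shift (witt_add p x (y :: nat \<Rightarrow> 'a))"
proof -
  have "witt_ghost p n (witt_add p (witt_shift (lift x)) (witt_shift (lift y))) =
      witt_ghost p n (witt_shift (witt_add p (lift x) (lift y)))" for n
    by (cases n) (simp_all add: ghost_simps witt_ghost_shift[OF p_pos] witt_add_0[OF p] algebra_simps)
  from ident[OF this] show ?thesis by (simp add: ghost_simps)
qed

lemma witt_decompose: "witt_add p (teichmuller (x 0)) (witt_shift (\<lambda>i. x (Suc i))) = (x :: nat \<Rightarrow> 'a)"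
proof -
  have *: "witt_ghost p (Suc n) u = u 0 ^ p ^ Suc n + of_nat p * witt_ghost p n (\<lambda>i. u (Suc i))"
    for u :: "nat \<Rightarrow> 'a int_mpoly" and n
    unfolding witt_ghost_def
    by (subst sum.atMost_Suc_shift) (simp add: sum_distrib_left mult.assoc)
  have "witt_ghost p n (witt_add p (teichmuller (lift x 0)) (witt_shift (\<lambda>i. lift x (Suc i)))) =
      witt_ghost p n (lift x)" for n
    by (cases n) (simp_all add: ghost_simps witt_ghost_shift[OF p_pos] witt_add_0[OF p] p_pos power_0_left *)
  from ident[OF this] show ?thesis
    by (simp add: ghost_simps) (simp add: lift_def proj_def)
qed

text \<open>
  This is \<open>p = VF\<close>; the \<open>p\<close>-fold sum is spelled out because the type of Witt vectors only
  becomes a ring below.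
\<close>

lemma witt_times_p:
  assumes "of_nat p = (0::'a)"
  shows "(witt_add p x ^^ p) (\<lambda>_. 0) = witt_shift (\<lambda>i. x i ^ p :: 'a)"
proof -
  let ?v = "(witt_add p (lift x) ^^ p) (\<lambda>_. 0)"
  have gh: "witt_ghost p n ((witt_add p (lift x) ^^ m) (\<lambda>_. 0)) = of_nat m * witt_ghost p n (lift x)" for n m
    by (induction m) (simp_all add: ghost_simps algebra_simps)
  have pr: "proj ((witt_add p (lift x) ^^ m) (\<lambda>_. 0)) = (witt_add p x ^^ m) (\<lambda>_. 0)" for m
    by (induction m) (simp_all add: ghost_simps proj_zero)
  have "of_nat p ^ Suc n dvd witt_ghost p n ?v - witt_ghost p n (witt_shift (\<lambda>i. lift x i ^ p))" for n
  proof (cases n)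
    case (Suc m)
    have "witt_ghost p n ?v - witt_ghost p n (witt_shift (\<lambda>i. lift x i ^ p)) =
        of_nat p * (of_nat p ^ Suc m * lift x (Suc m))"
      unfolding Suc gh witt_ghost_shift[OF p_pos] witt_ghost_Suc[of p m "lift x"]
      by (simp add: algebra_simps)
    then show ?thesis by (simp only: Suc power_Suc mult.assoc[symmetric] dvd_triv_left)
  qed (use gh[of 0 p] in simp)
  from ident_p[OF this assms] show ?thesis
    by (simp add: pr ghost_simps) (simp add: proj_def lift_def hom_simps)
qed

end

text \<open>A separate type lets the type-class algebra act on Witt vectors; in the instance below
  the prime is read off the coefficients as \<open>CHAR('a)\<close>.\<close>

datatype 'a witt = Witt (wcoeff: "nat \<Rightarrow> 'a")

lemma witt_eqI: "(\<And>n. wcoeff x n = wcoeff y n) \<Longrightarrow> x = y"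
  by (cases x; cases y) auto

instantiation witt :: (comm_ring_prime_char) comm_ring_1
begin

definition "0 = Witt (\<lambda>_. 0 :: 'a)"
definition "1 = Witt (teichmuller (1 :: 'a))"
definition "x + y = Witt (witt_add CHAR('a) (wcoeff x) (wcoeff y))" for x y :: "'a witt"
definition "x * y = Witt (witt_mult CHAR('a) (wcoeff x) (wcoeff y))" for x y :: "'a witt"
definition "- x = Witt (SOME y. witt_add CHAR('a) (wcoeff x) y = (\<lambda>_. 0))" for x :: "'a witt"
definition "x - y = x + (- y)" for x y :: "'a witt"

instance
proof
  interpret witt_lift "CHAR('a)" "TYPE('a)" by unfold_locales simp
  fix a b c :: "'a witt"
  show "a + b + c = a + (b + c)" by (simp add: plus_witt_def witt_add_assoc)
  show "a + b = b + a" by (simp add: plus_witt_def witt_add_commute[of "wcoeff a"])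
  show "0 + a = a" by (simp add: plus_witt_def zero_witt_def witt_add_zero)
  show "- a + a = 0"
    using someI_ex[OF witt_add_inverse, of "wcoeff a"]
    by (simp add: plus_witt_def zero_witt_def uminus_witt_def witt_add_commute[of _ "wcoeff a"])
  show "a - b = a + - b" by (simp add: minus_witt_def)
  show "a * b * c = a * (b * c)" by (simp add: times_witt_def witt_mult_assoc)
  show "a * b = b * a" by (simp add: times_witt_def witt_mult_commute[of "wcoeff a"])
  show "1 * a = a" by (simp add: times_witt_def one_witt_def witt_mult_one)
  show "(a + b) * c = a * c + b * c" by (simp add: plus_witt_def times_witt_def witt_distrib)
  show "(0::'a witt) \<noteq> 1"
    by (auto simp: zero_witt_def one_witt_def teichmuller_def fun_eq_iff)
qed

end

definition tei :: "'a::comm_ring_1 \<Rightarrow> 'a witt" where "tei a = Witt (teichmuller a)"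
definition ver :: "'a::zero witt \<Rightarrow> 'a witt" where "ver x = Witt (witt_shift (wcoeff x))"
definition wtail :: "'a witt \<Rightarrow> 'a witt" where "wtail x = Witt (\<lambda>i. wcoeff x (Suc i))"
definition wmap :: "('a \<Rightarrow> 'b) \<Rightarrow> 'a witt \<Rightarrow> 'b witt" where "wmap h x = Witt (\<lambda>i. h (wcoeff x i))"
abbreviation frob :: "'a::comm_ring_1 \<Rightarrow> 'a" where "frob x \<equiv> x ^ CHAR('a)"
abbreviation wfrob :: "'a::comm_ring_1 witt \<Rightarrow> 'a witt" where "wfrob \<equiv> wmap frob"

lemma wcoeff_wmap [simp]: "wcoeff (wmap h x) i = h (wcoeff x i)"
  by (simp add: wmap_def)

lemma wcoeff_tei [simp]: "wcoeff (tei a) 0 = a" "wcoeff (tei a) (Suc i) = 0"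
  by (simp_all add: tei_def)

lemma wcoeff_ver [simp]: "wcoeff (ver x) 0 = 0" "wcoeff (ver x) (Suc i) = wcoeff x i"
  by (simp_all add: ver_def)

lemma wcoeff_wtail [simp]: "wcoeff (wtail x) i = wcoeff x (Suc i)"
  by (simp add: wtail_def)

lemma wcoeff_0 [simp]: "wcoeff (0 :: 'a::comm_ring_prime_char witt) i = 0"
  by (simp add: zero_witt_def)

lemma wcoeff_add_0 [simp]: "wcoeff (x + y) 0 = wcoeff x 0 + wcoeff (y :: 'a::comm_ring_prime_char witt) 0"
  by (simp add: plus_witt_def witt_add_0)

lemma wcoeff_mult_0 [simp]: "wcoeff (x * y) 0 = wcoeff x 0 * wcoeff (y :: 'a::comm_ring_prime_char witt) 0"
  by (simp add: times_witt_def witt_mult_0)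

lemma tei_0 [simp]: "tei (0 :: 'a::comm_ring_prime_char) = 0"
  by (auto simp: tei_def zero_witt_def teichmuller_def)

lemma tei_1 [simp]: "tei (1 :: 'a::comm_ring_prime_char) = 1"
  by (simp add: tei_def one_witt_def)

lemma ring_map_wcoeff_0: "ring_map (\<lambda>x :: 'a::comm_ring_prime_char witt. wcoeff x 0)"
  by unfold_locales (simp_all flip: tei_1)

context
  fixes ty :: "'a::comm_ring_prime_char itself"
begin

interpretation witt_lift "CHAR('a)" "TYPE('a)" by unfold_locales simp

lemma tei_mult: "tei (a * b) = tei a * tei (b :: 'a)"
  by (simp add: tei_def times_witt_def witt_mult_teichmuller)

lemma ver_add: "ver (x + y) = ver x + ver (y :: 'a witt)"
  by (simp add: ver_def plus_witt_def witt_add_shift)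

lemma witt_split: "x = tei (wcoeff x 0) + ver (wtail (x :: 'a witt))"
  using witt_decompose[of "wcoeff x"]
  by (simp add: tei_def plus_witt_def ver_def wtail_def)

lemma times_p_eq: "of_nat CHAR('a) * x = ver (wfrob (x :: 'a witt))"
proof -
  have "of_nat n * x = Witt ((witt_add CHAR('a) (wcoeff x) ^^ n) (\<lambda>_. 0))" for n
  proof (induction n)
    case (Suc n)
    have "of_nat (Suc n) * x = x + of_nat n * x" by (simp add: algebra_simps)
    then show ?case unfolding Suc by (simp add: plus_witt_def)
  qed (simp flip: zero_witt_def)
  then show ?thesis
    by (simp add: witt_times_p ver_def wmap_def)
qed

end

lemma tei_power: "tei (a ^ n) = tei (a :: 'a::comm_ring_prime_char) ^ n"
  by (induction n) (simp_all add: tei_mult)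

lemma ver_0 [simp]: "ver (0 :: 'a::comm_ring_prime_char witt) = 0"
  using ver_add[of 0 "0 :: 'a witt"] by simp

lemma ver_of_nat_mult: "ver (of_nat n * x) = of_nat n * ver (x :: 'a::comm_ring_prime_char witt)"
  by (induction n) (simp_all add: algebra_simps ver_add)

lemma ver_diff: "ver (x - y) = ver x - ver (y :: 'a::comm_ring_prime_char witt)"
  using ver_add[of "x - y" y] by (simp add: algebra_simps)

text \<open>Witt addition mixes components in general, but [a] and V(w) have disjoint supports: the
  vector with components a, w_0, w_1, ... splits as exactly this sum.\<close>

lemma wcoeff_tei_ver [simp]:
  "wcoeff (tei a + ver w) (Suc i) = wcoeff (w :: 'a::comm_ring_prime_char witt) i"
proof -
  define x where "x = Witt (case_nat a (wcoeff w))"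
  have "wtail x = w" by (rule witt_eqI) (simp add: x_def)
  moreover have "wcoeff x 0 = a" by (simp add: x_def)
  ultimately have "x = tei a + ver w" using witt_split[of x] by simp
  then have "wcoeff (tei a + ver w) (Suc i) = wcoeff x (Suc i)" by simp
  then show ?thesis by (simp add: x_def)
qed

lemma ring_map_wmap:
  fixes h :: "'a::comm_ring_prime_char \<Rightarrow> 'b::comm_ring_prime_char"
  assumes "ring_map h"
  shows "ring_map (wmap h)"
proof -
  interpret ring_map h by fact
  \<comment> \<open>A homomorphism between rings of prime characteristic forces the two primes to
    coincide, so both sides use the same Witt polynomials.\<close>
  have "of_nat CHAR('a) = (0 :: 'b)"
    using of_nat[of "CHAR('a)"] by (simp add: zero)
  then have C: "CHAR('b) = CHAR('a)"
    by (auto simp: of_nat_eq_0_iff_char_dvd intro!: primes_dvd_imp_eq)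
  show ?thesis
    by unfold_locales
      (simp_all add: wmap_def plus_witt_def times_witt_def one_witt_def hom_witt_add hom_witt_mult C
         hom_teichmuller one)
qed

lemma ring_map_frob: "ring_map (\<lambda>x :: 'a::comm_ring_prime_char. x ^ CHAR('a))"
  by unfold_locales (simp_all add: freshmans_dream power_mult_distrib)

lemma ring_map_wfrob: "ring_map (wfrob :: 'a::comm_ring_prime_char witt \<Rightarrow> 'a witt)"
  by (rule ring_map_wmap[OF ring_map_frob])

lemma wmap_tei: "ring_map h \<Longrightarrow> wmap h (tei a) = tei (h a)"
  by (auto intro!: witt_eqI simp: tei_def teichmuller_def ring_map.zero)

lemma wmap_ver: "ring_map h \<Longrightarrow> wmap h (ver a) = ver (wmap h a)"
  by (auto intro!: witt_eqI simp: ver_def witt_shift_def ring_map.zero split: nat.splits)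

lemma ring_map_comp: "ring_map f \<Longrightarrow> ring_map g \<Longrightarrow> ring_map (\<lambda>x. f (g x))"
  by (simp add: ring_map_def)

section \<open>Witt vectors over a finite field\<close>

lemma frob_inj: "frob x = frob y \<Longrightarrow> x = (y :: 'k::idom_prime_char)"
proof -
  assume eq: "frob x = frob y"
  interpret ring_map "frob :: 'k \<Rightarrow> 'k" by (rule ring_map_frob)
  have "frob (x - y) = 0" using eq by (simp add: diff)
  then show ?thesis by simp
qed

lemma bij_frob: "bij (frob :: 'k::finite_field \<Rightarrow> 'k)"
proof -
  have "inj (frob :: 'k \<Rightarrow> 'k)" by (rule injI) (rule frob_inj)
  then show ?thesis by (simp add: bij_def finite_UNIV_inj_surj)
qed

lemma bij_wfrob: "bij (wfrob :: 'k::finite_field witt \<Rightarrow> 'k witt)"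
proof (rule bijI)
  show "inj (wfrob :: 'k witt \<Rightarrow> 'k witt)"
  proof (rule injI)
    fix x y :: "'k witt"
    assume "wfrob x = wfrob y"
    then have "frob (wcoeff x i) = frob (wcoeff y i)" for i by (metis wcoeff_wmap)
    then show "x = y" by (intro witt_eqI) (rule frob_inj)
  qed
  show "surj (wfrob :: 'k witt \<Rightarrow> 'k witt)"
  proof (rule surjI)
    fix x :: "'k witt"
    show "wfrob (wmap (inv_into UNIV frob) x) = x"
      by (rule witt_eqI) (simp add: surj_f_inv_f[OF bij_is_surj[OF bij_frob]])
  qed
qed

text \<open>From p = VF and bijectivity of F: over a finite field V is p times the inverse of
  F.\<close>

lemma ver_eq_times_p:
  fixes x :: "'k::finite_field witt"
  obtains y where "ver x = of_nat CHAR('k) * y" "wfrob y = x"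
  using bij_is_surj[OF bij_wfrob] times_p_eq by (metis surjE)

lemma torsion_free_witt: "torsion_free CHAR('k) TYPE('k::finite_field witt)"
  unfolding torsion_free_def
proof (intro allI impI)
  fix x :: "'k witt"
  assume "of_nat CHAR('k) * x = 0"
  then have "wcoeff (ver (wfrob x)) (Suc i) = 0" for i by (simp add: times_p_eq)
  then show "x = 0" by (auto intro!: witt_eqI)
qed

text \<open>Over a perfect field the p-adic filtration is the filtration by V, that is, W(k)/p^n
  consists of Witt vectors of length n. This is the bridge between congruences and components
  everywhere below.\<close>

lemma witt_cong_iff:
  fixes x y :: "'k::finite_field witt"
  shows "of_nat CHAR('k) ^ n dvd x - y \<longleftrightarrow> (\<forall>i<n. wcoeff x i = wcoeff y i)"
proof (induction n arbitrary: x y)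
  case (Suc n)
  show ?case
  proof
    assume "of_nat CHAR('k) ^ Suc n dvd x - y"
    then obtain z where z: "x = y + of_nat CHAR('k) ^ n * (of_nat CHAR('k) * z)"
      by (auto elim!: dvdE simp: algebra_simps)
    have "of_nat CHAR('k) ^ n * (of_nat CHAR('k) * z) = ver (of_nat CHAR('k) ^ n * wfrob z)"
      using ver_of_nat_mult[of "CHAR('k) ^ n" "wfrob z"] by (simp add: times_p_eq)
    then have x: "x = tei (wcoeff y 0) + ver (wtail y + of_nat CHAR('k) ^ n * wfrob z)"
      by (subst z, subst witt_split[of y]) (simp add: ver_add)
    have "\<forall>i<n. wcoeff (wtail y + of_nat CHAR('k) ^ n * wfrob z) i = wcoeff (wtail y) i"
      by (subst Suc.IH[symmetric]) simp
    then show "\<forall>i<Suc n. wcoeff x i = wcoeff y i"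
      unfolding x by (auto simp: less_Suc_eq_0_disj)
  next
    assume eq: "\<forall>i<Suc n. wcoeff x i = wcoeff y i"
    then have "\<forall>i<n. wcoeff (wtail x) i = wcoeff (wtail y) i" by auto
    then have "of_nat CHAR('k) ^ n dvd wtail x - wtail y" by (simp only: Suc.IH)
    then obtain z where z: "wtail x - wtail y = of_nat CHAR('k) ^ n * z" by (elim dvdE)
    obtain z' where z': "ver z = of_nat CHAR('k) * z'" by (rule ver_eq_times_p)
    have "x - y = ver (wtail x - wtail y)"
      using eq by (subst witt_split[of x], subst witt_split[of y]) (simp add: ver_diff)
    also have "\<dots> = of_nat CHAR('k) ^ n * ver z"
      unfolding z using ver_of_nat_mult[of "CHAR('k) ^ n"] by simp
    finally show "of_nat CHAR('k) ^ Suc n dvd x - y" by (simp add: z' mult_ac)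
  qed
qed simp

lemma witt_dvd_iff: "of_nat CHAR('k) dvd (x :: 'k::finite_field witt) \<longleftrightarrow> wcoeff x 0 = 0"
  using witt_cong_iff[of 1 x 0] by simp

lemma witt_cong_eqI:
  fixes x y :: "'k::finite_field witt"
  assumes "\<And>n. of_nat CHAR('k) ^ n dvd x - y"
  shows "x = y"
  by (rule witt_eqI) (use assms witt_cong_iff in blast)

lemma witt_p_part:
  fixes x :: "'k::finite_field witt"
  assumes "x \<noteq> 0"
  obtains n y where "x = of_nat CHAR('k) ^ n * y" "wcoeff y 0 \<noteq> 0"
proof -
  define n where "n = (LEAST n. wcoeff x n \<noteq> 0)"
  have "\<exists>n. wcoeff x n \<noteq> 0" using assms by (auto intro: witt_eqI)
  then have n: "wcoeff x n \<noteq> 0" unfolding n_def by (rule LeastI_ex)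
  have "wcoeff x i = 0" if "i < n" for i
    using that not_less_Least unfolding n_def by blast
  then have "of_nat CHAR('k) ^ n dvd x - 0" by (subst witt_cong_iff) auto
  then obtain y where y: "x = of_nat CHAR('k) ^ n * y" by auto
  have "wcoeff y 0 \<noteq> 0"
  proof
    assume "wcoeff y 0 = 0"
    then have "of_nat CHAR('k) ^ Suc n dvd x - 0"
      unfolding y by (auto simp: mult_ac simp flip: witt_dvd_iff)
    then show False using n by (subst (asm) witt_cong_iff) auto
  qed
  with y that show ?thesis by blast
qed

text \<open>Nonzero elements are powers of p times elements with nonzero reduction; reductions
  multiply in k and powers of p cancel.\<close>

instance witt :: (finite_field) idom
proof
  fix x y :: "'a witt"
  assume "x \<noteq> 0" "y \<noteq> 0"
  obtain n x' where x: "x = of_nat CHAR('a) ^ n * x'" "wcoeff x' 0 \<noteq> 0"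
    by (rule witt_p_part[OF \<open>x \<noteq> 0\<close>])
  obtain m y' where y: "y = of_nat CHAR('a) ^ m * y'" "wcoeff y' 0 \<noteq> 0"
    by (rule witt_p_part[OF \<open>y \<noteq> 0\<close>])
  show "x * y \<noteq> 0"
  proof
    assume "x * y = 0"
    then have "of_nat CHAR('a) ^ (n + m) * (x' * y') = of_nat CHAR('a) ^ (n + m) * 0"
      by (simp add: x y power_add mult_ac)
    then have "x' * y' = 0" by (rule torsion_free_power[OF torsion_free_witt])
    then have "wcoeff (x' * y') 0 = 0" by (simp only: wcoeff_0)
    then show False using x y by simp
  qed
qed

text \<open>The polynomial X^p - X has at most p roots, and the prime field already supplies p of
  them.\<close>

lemma frob_eq_iff_Ints: "frob x = x \<longleftrightarrow> (x :: 'k::finite_field) \<in> \<int>"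
proof
  assume "x \<in> \<int>"
  then obtain c where c: "x = of_int c" by (auto elim: Ints_cases)
  interpret ring_map "frob :: 'k \<Rightarrow> 'k" by (rule ring_map_frob)
  show "frob x = x" by (simp add: c of_int)
next
  let ?p = "CHAR('k)"
  define q :: "'k poly" where "q = Polynomial.monom 1 ?p - Polynomial.monom 1 1"
  have p1: "?p > 1" using CHAR_prime[where ?'a = 'k] prime_gt_1_nat by blast
  have "coeff q ?p = 1" using p1 by (simp add: q_def)
  then have q: "q \<noteq> 0" by auto
  have deg: "degree q \<le> ?p"
    unfolding q_def using p1 by (intro degree_diff_le degree_monom_le[THEN order_trans]) auto
  have roots: "{y. poly q y = 0} = {y. frob y = y}"
    by (auto simp: q_def poly_monom)
  have fin: "finite {y :: 'k. frob y = y}" by simp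
  have sub: "of_nat ` {..<?p} \<subseteq> {y :: 'k. frob y = y}"
  proof -
    interpret ring_map "frob :: 'k \<Rightarrow> 'k" by (rule ring_map_frob)
    show ?thesis by (auto simp: of_nat)
  qed
  have "inj_on (of_nat :: nat \<Rightarrow> 'k) {..<?p}"
  proof (rule inj_onI)
    have "i = j" if "i \<le> j" "j < ?p" "of_nat i = (of_nat j :: 'k)" for i j
    proof -
      have "of_nat (j - i) = (0 :: 'k)" using that by (simp add: of_nat_diff)
      then have "?p dvd j - i" by (simp add: of_nat_eq_0_iff_char_dvd)
      then show ?thesis using that by (auto dest: dvd_imp_le)
    qed
    then show "i = j" if "i \<in> {..<?p}" "j \<in> {..<?p}" "of_nat i = (of_nat j :: 'k)" for i j
      using that by (metis lessThan_iff nle_le)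
  qed
  then have "card (of_nat ` {..<?p} :: 'k set) = ?p" by (simp add: card_image)
  moreover have "card {y :: 'k. frob y = y} \<le> ?p"
    using card_poly_roots_bound[OF q] deg roots by simp
  ultimately have "of_nat ` {..<?p} = {y :: 'k. frob y = y}"
    using card_seteq[OF fin sub] by simp
  moreover assume "frob x = x"
  ultimately have "x \<in> of_nat ` {..<?p}" by blast
  then show "x \<in> \<int>" by auto
qed

text \<open>Thus \<open>Zp\<close> is the F-fixed part of W(k); this turns questions of membership
  and of scalars into equations.\<close>

lemma wfrob_eq_iff: "wfrob x = x \<longleftrightarrow> range (wcoeff (x :: 'k::finite_field witt)) \<subseteq> \<int>"
proof -
  have "wfrob x = x \<longleftrightarrow> (\<forall>i. frob (wcoeff x i) = wcoeff x i)"
    by (metis wcoeff_wmap witt_eqI)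
  then show ?thesis by (auto simp: frob_eq_iff_Ints)
qed

section \<open>Laurent series over Witt vectors\<close>

text \<open>A coefficientwise map may kill leading coefficients and move the subdegree; with free
  lower bounds the product formula can be compared before and after the map.\<close>

lemma fls_times_nth_bounds:
  fixes f g :: "'a::comm_ring_1 fls"
  assumes "\<And>i. i < df \<Longrightarrow> f $$ i = 0" "\<And>i. i < dg \<Longrightarrow> g $$ i = 0"
  shows "(f * g) $$ n = (\<Sum>i=df..n-dg. f $$ i * g $$ (n - i))"
proof -
  have "(f * g) $$ n = (\<Sum>i=fls_subdegree f..n-fls_subdegree g. f $$ i * g $$ (n - i))"
    by (rule fls_times_nth)
  also have "\<dots> = (\<Sum>i=min df (fls_subdegree f)..n-min dg (fls_subdegree g). f $$ i * g $$ (n - i))"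
    by (intro sum.mono_neutral_left) auto
  also have "\<dots> = (\<Sum>i=df..n-dg. f $$ i * g $$ (n - i))"
    by (intro sum.mono_neutral_right) (auto simp: assms not_le)
  finally show ?thesis .
qed

definition fls_map :: "('a::zero \<Rightarrow> 'b::zero) \<Rightarrow> 'a fls \<Rightarrow> 'b fls" where
  "fls_map h f = Abs_fls (\<lambda>n. h (f $$ n))"

lemma fls_map_nth [simp]: "h 0 = 0 \<Longrightarrow> fls_map h f $$ n = h (f $$ n)"
  unfolding fls_map_def by (rule nth_Abs_fls_lower_bound[of "fls_subdegree f"]) auto

lemma ring_map_fls_map:
  assumes "ring_map h"
  shows "ring_map (fls_map h)"
proof -
  interpret ring_map h by fact
  show ?thesis
  proof
    fix f g
    show "fls_map h (f + g) = fls_map h f + fls_map h g"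
      by (rule fls_eqI) (simp add: hom_simps)
    show "fls_map h (f * g) = fls_map h f * fls_map h g"
    proof (rule fls_eqI)
      fix n
      show "fls_map h (f * g) $$ n = (fls_map h f * fls_map h g) $$ n"
        by (subst fls_times_nth_bounds[of "fls_subdegree f" _ "fls_subdegree g"])
           (simp_all add: hom_simps fls_times_nth(2)[of f g])
    qed
    show "fls_map h 1 = 1"
      by (rule fls_eqI) (simp add: hom_simps)
  qed
qed

lemma fls_map_const: "h 0 = 0 \<Longrightarrow> fls_map h (fls_const c) = fls_const (h c)"
  by (rule fls_eqI) simp

lemma fls_of_nat_times_nth [simp]: "(of_nat n * f) $$ i = of_nat n * (f $$ i :: 'a::comm_ring_1)"
  by (simp add: fls_of_nat)

lemma fls_of_nat_power_times_nth [simp]: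
  "(of_nat n ^ m * f) $$ i = of_nat n ^ m * (f $$ i :: 'a::comm_ring_1)"
  using fls_of_nat_times_nth[of "n ^ m" f i] by simp

lemma fls_dvd_nth: "of_nat n ^ m dvd f \<Longrightarrow> of_nat n ^ m dvd (f $$ i :: 'a::comm_ring_1)"
  by (auto elim!: dvdE)

text \<open>The difference \<open>D\<close> of the two sides is additive, vanishes on monomials, and
  its n-th coefficient vanishes once the order of f exceeds n/p. Stripping finitely many leading
  monomials reaches that range.\<close>

lemma fls_power_prime_char:
  fixes f :: "'a::idom_prime_char fls"
  shows "f ^ CHAR('a) = fls_compose_power (fls_map frob f) CHAR('a)"
proof (rule fls_eqI)
  fix n
  let ?p = "CHAR('a)"
  have p: "?p > 0" by simp
  interpret fr: ring_map "frob :: 'a \<Rightarrow> 'a" by (rule ring_map_frob)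
  interpret fm: ring_map "fls_map (frob :: 'a \<Rightarrow> 'a)"
    by (rule ring_map_fls_map) (rule ring_map_frob)
  interpret fp: ring_map "\<lambda>f :: 'a fls. f ^ ?p"
    using ring_map_frob[where ?'a = "'a fls"] by simp
  define D where "D f = f ^ ?p - fls_compose_power (fls_map frob f) ?p" for f :: "'a fls"
  have D_add: "D (f + g) = D f + D g" for f g
    by (simp add: D_def fp.add fm.add)
  have D_mon: "D (fls_const c * fls_X_intpow m) = 0" for c m
  proof -
    have X: "fls_map frob (fls_X_intpow m :: 'a fls) = fls_X_intpow m"
      by (rule fls_eqI) (simp add: power_0_left)
    have "(fls_X_intpow m :: 'a fls) ^ ?p = fls_X_intpow (int ?p * m)"
      by (simp add: fls_X_intpow_power)
    then show ?thesis
      by (simp only: D_def fm.mult X fls_compose_power_mult fls_map_const fr.zero power_mult_distrib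
          fls_compose_power_const_left[OF p] fls_compose_power_X_intpow[OF p])
         (simp add: fls_const_power)
  qed
  have D0: "D f $$ n = 0" if "\<And>i. i < N \<Longrightarrow> f $$ i = 0" "n < int ?p * N" for f N
  proof -
    have "(f ^ k) $$ i = 0" if "i < int k * N" for k i
      using that
    proof (induction k arbitrary: i)
      case (Suc k)
      have "(f * f ^ k) $$ i = (\<Sum>j=N..i - int k * N. f $$ j * (f ^ k) $$ (i - j))"
        by (rule fls_times_nth_bounds) (use Suc \<open>\<And>i. i < N \<Longrightarrow> f $$ i = 0\<close> in auto)
      also have "\<dots> = 0" using Suc.prems by (intro sum.neutral) (auto simp: algebra_simps)
      finally show ?case by simp
    qed simp
    moreover have "fls_compose_power (fls_map frob f) ?p $$ n = 0"
    proof (cases "int ?p dvd n")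
      case True
      then have "int ?p * (n div int ?p) < int ?p * N" using that(2) by simp
      then have "n div int ?p < N" using p by (simp add: mult_less_cancel_left)
      then show ?thesis using that(1) by (simp add: fls_nth_compose_power p fr.zero)
    qed (simp add: fls_nth_compose_power p)
    ultimately show ?thesis using that(2) by (simp add: D_def)
  qed
  have "D f $$ n = 0" if "\<And>i. i < N \<Longrightarrow> f $$ i = 0" for f N
    using that
  proof (induction "nat (n + 1 - int ?p * N)" arbitrary: f N rule: less_induct)
    case less
    show ?case
    proof (cases "n < int ?p * N")
      case False
      define m where "m = fls_const (f $$ N) * fls_X_intpow N"
      have "D (f - m) $$ n = 0"
      proof (rule less.hyps)
        show "nat (n + 1 - int ?p * (N + 1)) < nat (n + 1 - int ?p * N)"
          using False p by (simp add: algebra_simps)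
        show "(f - m) $$ i = 0" if "i < N + 1" for i
          using that less.prems by (cases "i = N") (auto simp: m_def)
      qed
      moreover have "D f = D (f - m) + D m" by (simp flip: D_add)
      ultimately show ?thesis by (simp add: m_def D_mon)
    qed (use D0 less.prems in blast)
  qed
  from this[of "fls_subdegree f" f]
  show "(f ^ ?p) $$ n = fls_compose_power (fls_map frob f) ?p $$ n"
    by (simp add: D_def)
qed

section \<open>Reduction, Teichmueller section and Frobenius lift on W(k)((T))\<close>

abbreviation fls_red :: "'k::finite_field witt fls \<Rightarrow> 'k fls" where
  "fls_red \<equiv> fls_map (\<lambda>x. wcoeff x 0)"

text \<open>Only a set-theoretic section of \<open>fls_red\<close>, not a homomorphism: for p = 2
  the square of 1 + T lifts to 1 + T^2, not to (1 + T)^2.\<close>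

abbreviation fls_tei :: "'k::finite_field fls \<Rightarrow> 'k witt fls" where
  "fls_tei \<equiv> fls_map tei"

definition fls_frob :: "'k::finite_field witt fls \<Rightarrow> 'k witt fls" where
  "fls_frob f = fls_compose_power (fls_map wfrob f) CHAR('k)"

lemma ring_map_fls_red: "ring_map fls_red"
  by (rule ring_map_fls_map[OF ring_map_wcoeff_0])

lemma fls_red_tei [simp]: "fls_red (fls_tei f) = f"
  by (rule fls_eqI) simp

lemma ring_map_fls_frob: "ring_map fls_frob"
proof -
  interpret ring_map "fls_map (wfrob :: 'a::finite_field witt \<Rightarrow> 'a witt)"
    by (rule ring_map_fls_map[OF ring_map_wfrob])
  show ?thesis by unfold_locales (simp_all add: fls_frob_def hom_simps)
qed

lemma fls_frob_nth:
  "fls_frob (f :: 'k::finite_field witt fls) $$ n =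
    (if int CHAR('k) dvd n then wfrob (f $$ (n div int CHAR('k))) else 0)"
  by (simp add: fls_frob_def fls_nth_compose_power ring_map.zero[OF ring_map_wfrob])

lemma fls_red_eq_0_iff:
  "fls_red f = 0 \<longleftrightarrow> of_nat CHAR('k) dvd (f :: 'k::finite_field witt fls)"
proof
  assume red: "fls_red f = 0"
  \<comment> \<open>Division by p on multiples of p; the value 0 at 0 lets \<open>fls_map d\<close>
    act coefficientwise without disturbing the lower bound on the exponents.\<close>
  define d where "d x = (if x = 0 then 0 else SOME y. x = of_nat CHAR('k) * y)" for x :: "'k witt"
  have d0: "d 0 = 0" by (simp add: d_def)
  have d: "of_nat CHAR('k) * d x = x" if "wcoeff x 0 = 0" for x
  proof (cases "x = 0")
    case False
    have "\<exists>y. x = of_nat CHAR('k) * y" using that by (auto simp flip: witt_dvd_iff elim: dvdE)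
    from someI_ex[OF this] show ?thesis using False by (simp add: d_def)
  qed (simp add: d_def)
  have "wcoeff (f $$ n) 0 = 0" for n
    using arg_cong[OF red, of "\<lambda>f. f $$ n"] by simp
  then have "f = of_nat CHAR('k) * fls_map d f"
    by (intro fls_eqI) (simp add: d d0)
  then show "of_nat CHAR('k) dvd f" by (rule dvdI)
next
  assume "of_nat CHAR('k) dvd f"
  then obtain g where "f = of_nat CHAR('k) * g" by (elim dvdE)
  then show "fls_red f = 0"
    using of_nat_CHAR[where ?'a = "'k fls"] by (simp add: ring_map.hom_simps[OF ring_map_fls_red])
qed

lemma fls_red_eq_iff:
  "fls_red f = fls_red g \<longleftrightarrow> of_nat CHAR('k) dvd (f - g :: 'k::finite_field witt fls)"
  by (simp add: ring_map.hom_simps[OF ring_map_fls_red] flip: fls_red_eq_0_iff)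

lemma fls_red_frob: "fls_red (fls_frob f) = fls_red (f :: 'k::finite_field witt fls) ^ CHAR('k)"
  unfolding fls_power_prime_char
  by (rule fls_eqI) (simp add: fls_frob_nth fls_nth_compose_power power_0_left)

lemma frob_lift_fls_frob: "frob_lift (fls_frob :: 'k::finite_field witt fls \<Rightarrow> _) CHAR('k)"
proof -
  interpret ring_map "fls_frob :: 'k witt fls \<Rightarrow> _" by (rule ring_map_fls_frob)
  show ?thesis
    by unfold_locales
      (simp flip: fls_red_eq_iff add: fls_red_frob ring_map.hom_simps[OF ring_map_fls_red])
qed

text \<open>Chain rule for T going to T^p; the shift is multiplication by T^(p-1).\<close>

lemma fls_deriv_frob:
  fixes f :: "'k::finite_field witt fls"
  shows "fls_deriv (fls_frob f) = of_nat CHAR('k) * fls_shift (1 - int CHAR('k)) (fls_frob (fls_deriv f))"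
proof (rule fls_eqI)
  fix n
  let ?p = "CHAR('k)"
  interpret ring_map "wfrob :: 'k witt \<Rightarrow> _" by (rule ring_map_wfrob)
  have iff: "int ?p dvd n + (1 - int ?p) \<longleftrightarrow> int ?p dvd n + 1"
    by (metis add_diff_eq dvd_add_right_iff dvd_refl diff_add_cancel add.commute)
  show "fls_deriv (fls_frob f) $$ n =
     (of_nat ?p * fls_shift (1 - int ?p) (fls_frob (fls_deriv f))) $$ n"
  proof (cases "int ?p dvd n + 1")
    case True
    then obtain m where m: "n + 1 = int ?p * m" by (elim dvdE)
    have "n + (1 - int ?p) = int ?p * (m - 1)" using m by (simp add: algebra_simps)
    then have div: "(n + (1 - int ?p)) div int ?p = m - 1" "(n + 1) div int ?p = m"
      using m by simp_all
    show ?thesis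
      unfolding fls_deriv_nth fls_of_nat_times_nth fls_shift_nth fls_frob_nth iff div
      using True by (simp add: hom_simps m mult.assoc)
  qed (simp add: fls_frob_nth iff)
qed

text \<open>The left side is the residue of 1/p times the pullback of f dT under the Frobenius lift:
  coefficient -1 after multiplication by T^(p-1) is coefficient -p before it.\<close>

lemma fls_residue_frob:
  "fls_shift (1 - int CHAR('k)) (fls_frob f) $$ - 1 = wfrob (f $$ - 1 :: 'k::finite_field witt)"
  using nonzero_mult_div_cancel_left[of "int CHAR('k)" "- 1"] by (simp add: fls_frob_nth)

section \<open>Residues of logarithmic differentials\<close>

text \<open>The estimate behind p-adic logarithms, that p^k/(k+1) is p-integral: v_p(k+1) is at most
  k, and the part of k+1 prime to p is inverted modulo p^m by Bezout.\<close>

lemma power_dvd_of_nat_Suc_mult: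
  fixes r :: "'a::comm_ring_1"
  assumes p: "prime p" and dvd: "of_nat p ^ m dvd of_nat (Suc k) * r"
  shows "of_nat p ^ Suc m dvd of_nat p ^ Suc k * r"
proof -
  obtain v u where u: "Suc k = p ^ v * u" "\<not> p dvd u"
    using p by (metis multiplicity_decompose' Suc_neq_Zero not_prime_unit)
  have "v \<le> k"
  proof -
    have "u > 0" using u(2) by (cases u) auto
    then have "p ^ v \<le> Suc k" using u(1) by simp
    moreover have "v < p ^ v" using p by (simp add: power_gt_expt prime_gt_Suc_0_nat)
    ultimately show ?thesis by linarith
  qed
  have "coprime (int u) (int p ^ m)"
    using u(2) p by (simp add: coprime_commute prime_imp_coprime)
  then obtain a b where ab: "a * int u + b * int p ^ m = 1"
    using bezout_int[of "int u" "int p ^ m"] by (auto simp: coprime_iff_gcd_eq_1)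
  have "of_nat p ^ v * r = of_int (a * int u + b * int p ^ m) * (of_nat p ^ v * r)"
    by (simp add: ab)
  also have "\<dots> = of_int a * (of_nat (Suc k) * r) + of_nat p ^ m * (of_int b * of_nat p ^ v * r)"
    unfolding u(1) by (simp add: algebra_simps)
  finally have "of_nat p ^ m dvd of_nat p ^ v * r" using dvd by simp
  then have "of_nat p ^ m dvd of_nat p ^ (k - v) * (of_nat p ^ v * r)" by (rule dvd_mult)
  also have "\<dots> = of_nat p ^ k * r"
    using \<open>v \<le> k\<close> by (simp flip: power_add add: mult.assoc[symmetric])
  finally show ?thesis by (simp add: mult.assoc mult_dvd_mono)
qed

text \<open>
  The logarithm of \<open>u = 1 + pe\<close> is expanded only modulo \<open>p\<close>-powers, because the ring of Laurent
  series is not \<open>p\<close>-adically complete. Integration by parts moves the derivative onto \<open>h\<close>.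
\<close>

lemma residue_dlog_cong:
  fixes h :: "'k::finite_field witt fls"
  assumes h: "of_nat CHAR('k) ^ m dvd fls_deriv h"
    and u: "fls_red u = 1" "u * u' = 1"
  shows "of_nat CHAR('k) ^ Suc m dvd (h * (fls_deriv u * u')) $$ - 1"
proof -
  let ?p = "of_nat CHAR('k) :: 'k witt fls"
  have "fls_red u = fls_red 1" using u by (simp add: ring_map.one[OF ring_map_fls_red])
  then have "?p dvd u - 1" by (simp only: fls_red_eq_iff)
  then obtain e where "u - 1 = ?p * e" by (elim dvdE)
  then have e: "u = 1 + ?p * e" by (simp add: diff_eq_eq add.commute)
  define q where "q = - (?p * e)"
  have qk: "q ^ k = (- 1) ^ k * (?p ^ k * e ^ k)" for k
    by (simp add: q_def power_minus[of "?p * e"] power_mult_distrib)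
  \<comment> \<open>The geometric series for 1/u with exact remainder; stopping at q^m is enough
    because du carries one more factor p.\<close>
  have "u' = u' * ((1 - q) * (\<Sum>k<m. q ^ k) + q ^ m)"
    by (simp flip: one_diff_power_eq)
  also have "\<dots> = (u * u') * (\<Sum>k<m. q ^ k) + q ^ m * u'"
    by (simp add: e q_def algebra_simps)
  finally have u': "u' = (\<Sum>k<m. q ^ k) + q ^ m * u'" by (simp add: u)
  have du: "fls_deriv u = ?p * fls_deriv e" by (simp add: e)
  have "h * (fls_deriv u * u') = (\<Sum>k<m. h * (?p * fls_deriv e) * q ^ k) + h * (?p * fls_deriv e) * (q ^ m * u')"
    by (subst u') (simp add: du algebra_simps sum_distrib_left)
  also have "\<dots> = (\<Sum>k<m. ?p ^ Suc k * ((- 1) ^ k * (h * (e ^ k * fls_deriv e)))) +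
      ?p ^ Suc m * ((- 1) ^ m * (h * fls_deriv e * e ^ m * u'))"
    by (simp add: qk mult_ac)
  finally have eq: "(h * (fls_deriv u * u')) $$ - 1 =
     (\<Sum>k<m. of_nat CHAR('k) ^ Suc k * (((- 1) ^ k * (h * (e ^ k * fls_deriv e))) $$ - 1)) +
      of_nat CHAR('k) ^ Suc m * (((- 1) ^ m * (h * fls_deriv e * e ^ m * u')) $$ - 1)"
    by (simp only: fls_plus_nth fls_nth_sum fls_of_nat_power_times_nth)
  \<comment> \<open>After multiplication by k+1 the form e^k de becomes d(e^(k+1)) and dh appears,
    divisible by p^m; the preceding estimate undoes the multiplication.\<close>
  have "of_nat CHAR('k) ^ Suc m dvd of_nat CHAR('k) ^ Suc k * (((- 1) ^ k * (h * (e ^ k * fls_deriv e))) $$ - 1)" for k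
  proof (rule power_dvd_of_nat_Suc_mult)
    have "of_nat (Suc k) * ((- 1) ^ k * (h * (e ^ k * fls_deriv e))) = (- 1) ^ k * (h * fls_deriv (e ^ Suc k))"
      by (simp add: fls_deriv_power algebra_simps del: fls_deriv_mult power_Suc)
    then have "of_nat (Suc k) * (((- 1) ^ k * (h * (e ^ k * fls_deriv e))) $$ - 1) =
        ((- 1) ^ k * (h * fls_deriv (e ^ Suc k))) $$ - 1"
      by (metis fls_of_nat_times_nth)
    also have "\<dots> = (((- 1) ^ k * h) * fls_deriv (e ^ Suc k)) $$ - 1" by (simp only: mult.assoc)
    also have "\<dots> = - ((fls_deriv ((- 1) ^ k * h) * e ^ Suc k) $$ - 1)"
      using fls_residue_times_deriv[of "(- 1) ^ k * h" "e ^ Suc k"] by (simp only: fls_residue_def minus_minus)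
    also have "fls_deriv ((- 1) ^ k * h) = (- 1) ^ k * fls_deriv h"
      by (cases "even k") simp_all
    finally have r: "of_nat (Suc k) * (((- 1) ^ k * (h * (e ^ k * fls_deriv e))) $$ - 1) =
       - (((- 1) ^ k * fls_deriv h * e ^ Suc k) $$ - 1)" .
    have "of_nat CHAR('k) ^ m dvd (- 1) ^ k * fls_deriv h * e ^ Suc k"
      using h by (intro dvd_mult2 dvd_mult)
    from fls_dvd_nth[OF this, of "- 1"]
    show "of_nat CHAR('k) ^ m dvd of_nat (Suc k) * (((- 1) ^ k * (h * (e ^ k * fls_deriv e))) $$ - 1)"
      unfolding r by simp
  qed simp
  then show ?thesis unfolding eq by (intro dvd_add dvd_sum) auto
qed

text \<open>With z inverse to y this is Res(w_n(x) dy/y); z is an argument because inversion is not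
  an operation of the coefficient ring's Laurent series.\<close>

definition log_residue ::
    "nat \<Rightarrow> (nat \<Rightarrow> 'k::finite_field witt fls) \<Rightarrow> 'k witt fls \<Rightarrow> 'k witt fls \<Rightarrow> 'k witt" where
  "log_residue n x y z = (witt_ghost CHAR('k) n x * (fls_deriv y * z)) $$ - 1"

lemma deriv_inverse:
  fixes y z :: "'a::comm_ring_1 fls"
  assumes "y * z = 1"
  shows "y * fls_deriv z = - (fls_deriv y * z)"
proof -
  have "fls_deriv (y * z) = 0" unfolding assms by simp
  then show ?thesis by (simp add: eq_neg_iff_add_eq_0)
qed

lemma dlog_mult:
  fixes y z y' z' :: "'a::comm_ring_1 fls"
  assumes "y * z = 1" "y' * z' = 1"
  shows "fls_deriv (y * y') * (z * z') = fls_deriv y * z + fls_deriv y' * z'"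
proof -
  have "fls_deriv (y * y') * (z * z') = (y * z) * (fls_deriv y' * z') + fls_deriv y * z * (y' * z')"
    by (simp add: algebra_simps)
  then show ?thesis by (simp add: assms)
qed

lemma dlog_power:
  fixes y z :: "'a::comm_ring_1 fls"
  assumes "y * z = 1"
  shows "fls_deriv (y ^ n) * z ^ n = of_nat n * (fls_deriv y * z)"
proof (induction n)
  case (Suc n)
  have "y ^ n * z ^ n = 1" using assms by (simp flip: power_mult_distrib)
  from dlog_mult[OF assms this] show ?case by (simp only: power_Suc Suc of_nat_Suc distrib_right mult_1)
qed simp

text \<open>Each summand p^i x_i^(p^(n-i)) brings p^(n-i) down from its exponent, for p^n in
  total.\<close>

lemma deriv_witt_ghost_dvd:
  fixes x :: "nat \<Rightarrow> 'a::comm_ring_1 fls"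
  shows "of_nat p ^ n dvd fls_deriv (witt_ghost p n x)"
proof -
  have "of_nat p ^ n dvd fls_deriv (of_nat (p ^ i) * x i ^ p ^ (n - i))" if "i \<le> n" for i
  proof -
    have "fls_deriv (of_nat (p ^ i) * x i ^ p ^ (n - i)) =
        of_nat p ^ (i + (n - i)) * (x i ^ (p ^ (n - i) - 1) * fls_deriv (x i))"
      by (simp add: fls_deriv_power power_add mult_ac del: of_nat_power)
         (simp add: mult_ac)
    then show ?thesis using that by simp
  qed
  then show ?thesis
    unfolding witt_ghost_def fls_deriv_sum by (intro dvd_sum) auto
qed

lemma log_residue_cong_left:
  fixes x x' :: "nat \<Rightarrow> 'k::finite_field witt fls"
  assumes "\<And>i. fls_red (x i) = fls_red (x' i)"
  shows "of_nat CHAR('k) ^ Suc n dvd log_residue n x y z - log_residue n x' y z"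
proof -
  have "of_nat CHAR('k) ^ Suc n dvd (witt_ghost CHAR('k) n x - witt_ghost CHAR('k) n x') * (fls_deriv y * z)"
    by (intro dvd_mult2 witt_ghost_cong) (use assms in \<open>simp add: fls_red_eq_iff\<close>)
  from fls_dvd_nth[OF this, of "- 1"] show ?thesis
    by (simp add: log_residue_def algebra_simps)
qed

text \<open>The quotient of two lifts of the same series reduces to 1, and its logarithmic
  derivative is the difference of theirs.\<close>

lemma log_residue_cong_right:
  fixes x :: "nat \<Rightarrow> 'k::finite_field witt fls"
  assumes "fls_red y = fls_red y'" "y * z = 1" "y' * z' = 1"
  shows "of_nat CHAR('k) ^ Suc n dvd log_residue n x y z - log_residue n x y' z'"
proof -
  interpret red: ring_map "fls_red :: 'k witt fls \<Rightarrow> _" by (rule ring_map_fls_red)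
  have zy: "z' * y' = 1" using assms by (simp add: mult.commute)
  have "fls_red (y * z') = fls_red (y' * z')" by (simp only: red.mult assms(1))
  then have "fls_red (y * z') = 1" by (simp only: assms(3) red.one)
  moreover have "(y * z') * (z * y') = (y * z) * (y' * z')" by (simp only: mult_ac)
  then have "(y * z') * (z * y') = 1" by (simp add: assms)
  ultimately have "of_nat CHAR('k) ^ Suc n dvd
    (witt_ghost CHAR('k) n x * (fls_deriv (y * z') * (z * y'))) $$ - 1"
    by (rule residue_dlog_cong[OF deriv_witt_ghost_dvd])
  also have "fls_deriv (y * z') * (z * y') = fls_deriv y * z - fls_deriv y' * z'"
    using dlog_mult[OF assms(2) zy] deriv_inverse[OF assms(3)] by (simp add: mult_ac)
  finally show ?thesis by (simp add: log_residue_def algebra_simps)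
qed

text \<open>Let h = w_n(x), let w dT = dy/y, and let phi be the Frobenius lift. The unit u =
  phi(y)/y^p has logarithmic derivative p (T^(p-1) phi(w) - w). Pairing it with phi(h) and dividing
  by p gives F Res(h w dT) congruent to Res(phi(h) w dT), while phi(h) is congruent to
  w_n(x^p).\<close>

lemma log_residue_power:
  fixes x :: "nat \<Rightarrow> 'k::finite_field witt fls"
  assumes yz: "y * z = 1"
  shows "of_nat CHAR('k) ^ Suc n dvd
    log_residue n (\<lambda>i. x i ^ CHAR('k)) y z - wfrob (log_residue n x y z)"
proof -
  let ?p = "CHAR('k)"
  interpret red: ring_map "fls_red :: 'k witt fls \<Rightarrow> _" by (rule ring_map_fls_red)
  interpret fr: frob_lift "fls_frob :: 'k witt fls \<Rightarrow> _" ?p by (rule frob_lift_fls_frob)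
  define h where "h = witt_ghost ?p n x"
  define w where "w = fls_deriv y * z"
  \<comment> \<open>This is T^(p-1), from d(T^p) = p T^(p-1) dT.\<close>
  define sh where "sh = fls_shift (1 - int ?p) (1 :: 'k witt fls)"
  have sh: "fls_shift (1 - int ?p) f = sh * f" for f
    by (simp add: sh_def fls_shifted_times_simps)
  have dfrob: "fls_deriv (fls_frob f) = of_nat ?p * (sh * fls_frob (fls_deriv f))" for f
    by (simp add: fls_deriv_frob sh)
  have fyz: "fls_frob y * fls_frob z = 1" using yz by (simp flip: fr.mult add: fr.one)
  have pyz: "z ^ ?p * y ^ ?p = 1" using yz by (simp flip: power_mult_distrib add: mult.commute)
  have zy: "z * y = 1" using yz by (simp add: mult.commute)
  define u where "u = fls_frob y * z ^ ?p"
  define u' where "u' = fls_frob z * y ^ ?p"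
  have uu': "u * u' = 1"
  proof -
    have "u * u' = (fls_frob y * fls_frob z) * (z ^ ?p * y ^ ?p)" by (simp only: u_def u'_def mult_ac)
    then show ?thesis by (simp add: fyz pyz)
  qed
  have "fls_red u = (fls_red (y * z)) ^ ?p"
    by (simp add: u_def red.mult red.power fls_red_frob power_mult_distrib)
  then have redu: "fls_red u = 1" by (simp add: yz red.one)
  have "of_nat ?p ^ n dvd fls_deriv h" unfolding h_def by (rule deriv_witt_ghost_dvd)
  from fr.dvd[OF this] have "of_nat ?p ^ n dvd fls_frob (fls_deriv h)" by (simp add: fr.hom_simps)
  \<comment> \<open>Differentiating a Frobenius pullback gains one p beyond the p^n of dh; it pays
    for the later division by p.\<close>
  then have "of_nat ?p ^ Suc n dvd fls_deriv (fls_frob h)"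
    by (simp add: dfrob mult_dvd_mono)
  from residue_dlog_cong[OF this redu uu']
  have 1: "of_nat ?p ^ Suc (Suc n) dvd (fls_frob h * (fls_deriv u * u')) $$ - 1" .
  have "fls_deriv u * u' = of_nat ?p * (sh * fls_frob w) + of_nat ?p * (fls_deriv z * y)"
    unfolding u_def u'_def dlog_mult[OF fyz pyz] dlog_power[OF zy]
    by (simp add: dfrob w_def fr.mult mult.assoc)
  also have "fls_deriv z * y = - w" using deriv_inverse[OF yz] by (simp add: w_def mult.commute)
  finally have dlog_u: "fls_deriv u * u' = of_nat ?p * (sh * fls_frob w) + of_nat ?p * - w" .
  have "fls_frob h * (fls_deriv u * u') =
      of_nat ?p * (fls_shift (1 - int ?p) (fls_frob (h * w)) - fls_frob h * w)"
    unfolding sh dlog_u by (simp add: fr.mult algebra_simps)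
  with 1 have "of_nat ?p ^ (1 + Suc n) dvd of_nat ?p ^ 1 * (wfrob ((h * w) $$ - 1) - (fls_frob h * w) $$ - 1)"
    using fls_residue_frob[of "h * w"] by (simp only: fls_of_nat_times_nth fls_minus_nth) simp
  then have 2: "of_nat ?p ^ Suc n dvd wfrob ((h * w) $$ - 1) - (fls_frob h * w) $$ - 1"
    by (rule torsion_free_power_dvd[OF torsion_free_witt])
  have "of_nat ?p ^ Suc n dvd (fls_frob h - witt_ghost ?p n (\<lambda>i. x i ^ ?p)) * w"
    unfolding h_def by (intro dvd_mult2 fr.witt_ghost_power)
  from fls_dvd_nth[OF this, of "- 1"]
  have "of_nat ?p ^ Suc n dvd (fls_frob h * w) $$ - 1 - log_residue n (\<lambda>i. x i ^ ?p) y z"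
    by (simp add: log_residue_def w_def algebra_simps)
  from dvd_add[OF 2 this]
  have "of_nat ?p ^ Suc n dvd - (log_residue n (\<lambda>i. x i ^ ?p) y z - wfrob (log_residue n x y z))"
    by (simp add: log_residue_def h_def w_def)
  then show ?thesis by (simp only: dvd_minus_iff)
qed

lemma log_residue_Suc:
  fixes x :: "nat \<Rightarrow> 'k::finite_field witt fls"
  assumes "y * z = 1"
  shows "of_nat CHAR('k) ^ Suc n dvd log_residue (Suc n) x y z - wfrob (log_residue n x y z)"
proof -
  have "log_residue (Suc n) x y z = log_residue n (\<lambda>i. x i ^ CHAR('k)) y z +
      of_nat CHAR('k) ^ Suc n * ((x (Suc n) * (fls_deriv y * z)) $$ - 1)"
    unfolding log_residue_def witt_ghost_Suc distrib_right fls_plus_nth mult.assoc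
      fls_of_nat_power_times_nth ..
  then have eq: "log_residue (Suc n) x y z - wfrob (log_residue n x y z) =
      (log_residue n (\<lambda>i. x i ^ CHAR('k)) y z - wfrob (log_residue n x y z)) +
      of_nat CHAR('k) ^ Suc n * ((x (Suc n) * (fls_deriv y * z)) $$ - 1)" by simp
  show ?thesis unfolding eq by (intro dvd_add log_residue_power assms) simp
qed

lemma log_residue_add:
  fixes x x' :: "nat \<Rightarrow> 'k::finite_field witt fls"
  shows "log_residue n (witt_add CHAR('k) x x') y z = log_residue n x y z + log_residue n x' y z"
  by (simp add: log_residue_def witt_ghost_add distrib_right)

lemma log_residue_mult:
  fixes x :: "nat \<Rightarrow> 'k::finite_field witt fls"
  assumes "y * z = 1" "y' * z' = 1"
  shows "log_residue n x (y * y') (z * z') = log_residue n x y z + log_residue n x y' z'"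
  unfolding log_residue_def dlog_mult[OF assms] by (simp add: distrib_left)

section \<open>The trace\<close>

text \<open>A ring homomorphism fixes the image of the integers automatically, so the group consists
  of all ring automorphisms of k.\<close>

lemma galois_iff:
  "\<sigma> \<in> (galois_prime_field :: ('k::finite_field \<Rightarrow> 'k) set) \<longleftrightarrow> ring_map \<sigma> \<and> bij \<sigma>"
proof -
  have "\<forall>x\<in>\<int>. \<sigma> x = x" if "ring_map \<sigma>"
    using ring_map.of_int[OF that] by (auto elim!: Ints_cases)
  moreover have "\<sigma> \<in> ring_iso ring_of_type_algebra ring_of_type_algebra \<longleftrightarrow> ring_map \<sigma> \<and> bij \<sigma>"
    unfolding ring_iso_def ring_hom_def ring_of_type_algebra_def ring_map_def Pi_UNIV
    by (simp add: all_conj_distrib conj_ac)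
  ultimately show ?thesis
    unfolding galois_prime_field_def mem_Collect_eq by argo
qed

definition wtrace :: "'k::finite_field witt \<Rightarrow> 'k witt" where
  "wtrace x = (\<Sum>\<sigma>\<in>galois_prime_field. wmap \<sigma> x)"

lemma wmap_galois_add: "\<sigma> \<in> galois_prime_field \<Longrightarrow> wmap \<sigma> (x + y) = wmap \<sigma> x + wmap \<sigma> (y :: 'k::finite_field witt)"
  by (simp add: galois_iff ring_map.add[OF ring_map_wmap])

lemma wtrace_add: "wtrace (x + y) = wtrace x + wtrace y"
  by (simp add: wtrace_def wmap_galois_add sum.distrib)

lemma wtrace_diff: "wtrace (x - y) = wtrace x - wtrace y"
  using wtrace_add[of "x - y" y] by (simp add: algebra_simps)

lemma wtrace_0 [simp]: "wtrace 0 = 0"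
  by (simp add: wtrace_def galois_iff ring_map.zero[OF ring_map_wmap])

lemma wtrace_of_nat_mult: "wtrace (of_nat n * x) = of_nat n * wtrace x"
proof (induction n)
  case 0
  show ?case by simp
qed (simp add: wtrace_add algebra_simps)

lemma wtrace_dvd: "of_nat n ^ m dvd x \<Longrightarrow> of_nat n ^ m dvd wtrace x"
  using wtrace_of_nat_mult[of "n ^ m"] by (metis dvd_def of_nat_power)

text \<open>Precomposition with Frobenius is injective on the finite Galois group, hence permutes
  it.\<close>

lemma wtrace_frob: "wtrace (wfrob x) = wtrace (x :: 'k::finite_field witt)"
proof -
  let ?G = "galois_prime_field :: ('k \<Rightarrow> 'k) set"
  let ?c = "\<lambda>\<sigma> :: 'k \<Rightarrow> 'k. \<lambda>x. \<sigma> (frob x)"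
  have fin: "finite ?G" by (rule finite_subset[OF subset_UNIV]) simp
  have inj: "inj_on ?c ?G"
  proof (rule inj_onI)
    fix \<sigma> \<tau> :: "'k \<Rightarrow> 'k" assume eq: "?c \<sigma> = ?c \<tau>"
    show "\<sigma> = \<tau>"
    proof
      fix y :: 'k
      obtain x where "y = frob x" by (rule surjE[OF bij_is_surj[OF bij_frob], of y])
      then show "\<sigma> y = \<tau> y" using fun_cong[OF eq, of x] by simp
    qed
  qed
  have "?c \<sigma> \<in> ?G" if "\<sigma> \<in> ?G" for \<sigma>
  proof -
    have \<sigma>: "ring_map \<sigma>" "bij \<sigma>" using that galois_iff by auto
    have "bij (\<sigma> \<circ> frob)" by (rule bij_comp[OF bij_frob \<sigma>(2)])
    then show ?thesis
      unfolding galois_iff comp_def using ring_map_comp[OF \<sigma>(1) ring_map_frob] by (rule conjI[rotated])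
  qed
  then have im: "?c ` ?G = ?G"
    by (intro endo_inj_surj fin inj) auto
  have "wtrace x = (\<Sum>\<sigma>\<in>?c ` ?G. wmap \<sigma> x)" by (simp add: im wtrace_def)
  also have "\<dots> = (\<Sum>\<sigma>\<in>?G. wmap (?c \<sigma>) x)"
    by (rule sum.reindex_cong[OF inj]) simp_all
  also have "\<dots> = wtrace (wfrob x)"
    unfolding wtrace_def by (intro sum.cong refl witt_eqI) simp
  finally show ?thesis by simp
qed

lemma wfrob_wtrace: "wfrob (wtrace x) = wtrace (x :: 'k::finite_field witt)"
proof -
  have "wfrob (wtrace x) = (\<Sum>\<sigma>\<in>galois_prime_field. wfrob (wmap \<sigma> x))"
    unfolding wtrace_def by (rule ring_map.sum[OF ring_map_wfrob])
  also have "\<dots> = (\<Sum>\<sigma>\<in>galois_prime_field. wmap \<sigma> (wfrob x))"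
    by (intro sum.cong refl witt_eqI) (simp add: galois_iff ring_map.power)
  also have "\<dots> = wtrace (wfrob x)" by (simp add: wtrace_def)
  finally show ?thesis by (simp add: wtrace_frob)
qed

lemma dvd_diff_trans: "(d :: 'a::comm_ring_1) dvd a - b \<Longrightarrow> d dvd b - c \<Longrightarrow> d dvd a - c"
  using dvd_add[of d "a - b" "b - c"] by simp

section \<open>The pairing on Laurent series\<close>

text \<open>The lift of a nonzero series is a unit since its leading coefficient is the Teichmueller
  lift of a nonzero element, whose inverse seeds \<open>fls_right_inverse\<close>.\<close>

definition fls_tei_inverse :: "'k::finite_field fls \<Rightarrow> 'k witt fls" where
  "fls_tei_inverse y = fls_right_inverse (fls_tei y) (tei (inverse (y $$ fls_subdegree y)))"

lemma fls_subdegree_tei [simp]: "fls_subdegree (fls_tei y) = fls_subdegree (y :: 'k::finite_field fls)"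
proof (cases "y = 0")
  case True
  then have "fls_tei y = 0" by (intro fls_eqI) simp
  then show ?thesis using True by simp
next
  case False
  have "tei (y $$ fls_subdegree y) \<noteq> 0"
    using False wcoeff_tei(1)[of "y $$ fls_subdegree y"] by (metis nth_fls_subdegree_zero_iff wcoeff_0)
  then show ?thesis by (intro fls_subdegree_eqI) simp_all
qed

lemma fls_tei_leading:
  assumes "y \<noteq> (0 :: 'k::finite_field fls)"
  shows "fls_tei y $$ fls_subdegree (fls_tei y) * tei (inverse (y $$ fls_subdegree y)) = 1"
    and "tei (inverse (y $$ fls_subdegree y)) * fls_tei y $$ fls_subdegree (fls_tei y) = 1"
  using assms by (simp_all flip: tei_mult)

lemma fls_tei_inverse:
  "y \<noteq> 0 \<Longrightarrow> fls_tei y * fls_tei_inverse y = 1"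
  unfolding fls_tei_inverse_def by (rule fls_right_inverse) (rule fls_tei_leading)

text \<open>The approximation at level n, canonical only modulo p^(n+1); Teichmueller lifts are one
  choice among many.\<close>

definition residue_pairing :: "nat \<Rightarrow> 'k::finite_field fls witt \<Rightarrow> 'k fls \<Rightarrow> 'k witt" where
  "residue_pairing n x y =
     wtrace (log_residue n (\<lambda>i. fls_tei (wcoeff x i)) (fls_tei y) (fls_tei_inverse y))"

lemma residue_pairing_cong:
  fixes x :: "'k::finite_field fls witt"
  assumes "\<And>i. fls_red (u i) = wcoeff x i" "y \<noteq> 0" "fls_red v = y" "v * v' = 1"
  shows "of_nat CHAR('k) ^ Suc n dvd wtrace (log_residue n u v v') - residue_pairing n x y"
proof -
  have "of_nat CHAR('k) ^ Suc n dvd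
     log_residue n u v v' - log_residue n (\<lambda>i. fls_tei (wcoeff x i)) v v'"
    by (rule log_residue_cong_left) (simp add: assms)
  moreover have "of_nat CHAR('k) ^ Suc n dvd
     log_residue n (\<lambda>i. fls_tei (wcoeff x i)) v v' -
     log_residue n (\<lambda>i. fls_tei (wcoeff x i)) (fls_tei y) (fls_tei_inverse y)"
    by (rule log_residue_cong_right) (simp_all add: assms fls_tei_inverse)
  ultimately have "of_nat CHAR('k) ^ Suc n dvd log_residue n u v v' -
     log_residue n (\<lambda>i. fls_tei (wcoeff x i)) (fls_tei y) (fls_tei_inverse y)"
    by (rule dvd_diff_trans)
  from wtrace_dvd[OF this] show ?thesis by (simp add: residue_pairing_def wtrace_diff)
qed

lemma residue_pairing_Suc:
  fixes x :: "'k::finite_field fls witt"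
  assumes "y \<noteq> 0"
  shows "of_nat CHAR('k) ^ Suc n dvd residue_pairing (Suc n) x y - residue_pairing n x y"
  using wtrace_dvd[OF log_residue_Suc[OF fls_tei_inverse[OF assms], of n "\<lambda>i. fls_tei (wcoeff x i)"]]
  by (simp add: residue_pairing_def wtrace_diff wtrace_frob)

lemma residue_pairing_le:
  fixes x :: "'k::finite_field fls witt"
  assumes "y \<noteq> 0" "m \<le> n"
  shows "of_nat CHAR('k) ^ Suc m dvd residue_pairing n x y - residue_pairing m x y"
  using assms(2)
proof (induction n rule: dec_induct)
  case (step n)
  have "of_nat CHAR('k) ^ Suc m dvd residue_pairing (Suc n) x y - residue_pairing n x y"
    using step by (intro dvd_trans[OF le_imp_power_dvd residue_pairing_Suc[OF assms(1)]]) simp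
  from dvd_add[OF this step.IH] show ?case by simp
qed simp

text \<open>The p-adic limit of the levels: level i is right modulo p^(i+1), so its components up to
  and including i are final, and component i is read there.\<close>

definition witt_pairing :: "'k::finite_field fls witt \<Rightarrow> 'k fls \<Rightarrow> 'k witt" where
  "witt_pairing x y = Witt (\<lambda>i. wcoeff (residue_pairing i x y) i)"

lemma witt_pairing_cong:
  fixes x :: "'k::finite_field fls witt"
  assumes "y \<noteq> 0"
  shows "of_nat CHAR('k) ^ Suc n dvd witt_pairing x y - residue_pairing n x y"
  unfolding witt_cong_iff
proof (intro allI impI)
  fix i assume "i < Suc n"
  then have "of_nat CHAR('k) ^ Suc i dvd residue_pairing n x y - residue_pairing i x y"
    by (intro residue_pairing_le assms) simp
  then show "wcoeff (witt_pairing x y) i = wcoeff (residue_pairing n x y) i"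
    unfolding witt_cong_iff by (simp add: witt_pairing_def)
qed

lemma witt_cong_eqI':
  fixes x y :: "'k::finite_field witt"
  assumes "\<And>n. of_nat CHAR('k) ^ Suc n dvd x - y"
  shows "x = y"
proof (rule witt_cong_eqI)
  fix n
  show "of_nat CHAR('k) ^ n dvd x - y"
    by (rule dvd_trans[OF _ assms[of n]]) simp
qed

text \<open>The pairing may be computed from any lifts. Each property below follows from a lift
  suited to it.\<close>

lemma witt_pairing_lifts:
  fixes x :: "'k::finite_field fls witt"
  assumes "\<And>i. fls_red (u i) = wcoeff x i" "y \<noteq> 0" "fls_red v = y" "v * v' = 1"
  shows "of_nat CHAR('k) ^ Suc n dvd witt_pairing x y - wtrace (log_residue n u v v')"
  using dvd_diff[OF witt_pairing_cong[OF assms(2), of n x] residue_pairing_cong[OF assms, of n]] by simp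

lemma wfrob_witt_pairing:
  assumes "y \<noteq> 0"
  shows "wfrob (witt_pairing x y) = witt_pairing (x :: 'k::finite_field fls witt) y"
proof (rule witt_eqI)
  fix i
  have "wcoeff (wfrob (residue_pairing i x y)) i = wcoeff (residue_pairing i x y) i"
    by (simp only: residue_pairing_def wfrob_wtrace)
  then show "wcoeff (wfrob (witt_pairing x y)) i = wcoeff (witt_pairing x y) i"
    by (simp add: witt_pairing_def)
qed

lemma witt_pairing_add:
  fixes x :: "'k::finite_field fls witt"
  assumes y: "y \<noteq> 0"
  shows "witt_pairing (x + x') y = witt_pairing x y + witt_pairing x' y"
proof (rule witt_cong_eqI')
  fix n
  let ?u = "\<lambda>i. fls_tei (wcoeff x i)" and ?u' = "\<lambda>i. fls_tei (wcoeff x' i)"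
  interpret ring_map "fls_red :: 'k witt fls \<Rightarrow> _" by (rule ring_map_fls_red)
  \<comment> \<open>The Witt sum of the lifts replaces the Teichmueller lift of the sum; its ghost
    components are exactly additive.\<close>
  have "(\<lambda>i. fls_red (witt_add CHAR('k) ?u ?u' i)) = wcoeff (x + x')"
    unfolding hom_witt_add by (simp add: plus_witt_def)
  then have *: "fls_red (witt_add CHAR('k) ?u ?u' i) = wcoeff (x + x') i" for i by (rule fun_cong)
  note inv = fls_tei_inverse[OF y]
  have "of_nat CHAR('k) ^ Suc n dvd witt_pairing (x + x') y -
     wtrace (log_residue n (witt_add CHAR('k) ?u ?u') (fls_tei y) (fls_tei_inverse y))"
    by (rule witt_pairing_lifts) (simp_all add: * inv y)
  moreover have "of_nat CHAR('k) ^ Suc n dvd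
     (witt_pairing x y - residue_pairing n x y) + (witt_pairing x' y - residue_pairing n x' y)"
    by (intro dvd_add witt_pairing_cong y)
  ultimately show "of_nat CHAR('k) ^ Suc n dvd
      witt_pairing (x + x') y - (witt_pairing x y + witt_pairing x' y)"
    unfolding log_residue_add wtrace_add residue_pairing_def[symmetric]
    by (drule_tac dvd_diff) (assumption, simp add: algebra_simps)
qed

lemma witt_pairing_mult:
  fixes x :: "'k::finite_field fls witt"
  assumes y: "y \<noteq> 0" "y' \<noteq> 0"
  shows "witt_pairing x (y * y') = witt_pairing x y + witt_pairing x y'"
proof (rule witt_cong_eqI')
  fix n
  let ?u = "\<lambda>i. fls_tei (wcoeff x i)"
  interpret ring_map "fls_red :: 'k witt fls \<Rightarrow> _" by (rule ring_map_fls_red)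
  note inv = fls_tei_inverse[OF y(1)] fls_tei_inverse[OF y(2)]
  have inv': "(fls_tei y * fls_tei y') * (fls_tei_inverse y * fls_tei_inverse y') = 1"
  proof -
    have "(fls_tei y * fls_tei y') * (fls_tei_inverse y * fls_tei_inverse y') =
      (fls_tei y * fls_tei_inverse y) * (fls_tei y' * fls_tei_inverse y')" by (simp only: mult_ac)
    then show ?thesis by (simp add: inv)
  qed
  have "of_nat CHAR('k) ^ Suc n dvd witt_pairing x (y * y') -
     wtrace (log_residue n ?u (fls_tei y * fls_tei y') (fls_tei_inverse y * fls_tei_inverse y'))"
    by (rule witt_pairing_lifts) (simp_all add: inv' y mult)
  moreover have "of_nat CHAR('k) ^ Suc n dvd
     (witt_pairing x y - residue_pairing n x y) + (witt_pairing x y' - residue_pairing n x y')"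
    by (intro dvd_add witt_pairing_cong y)
  ultimately show "of_nat CHAR('k) ^ Suc n dvd
      witt_pairing x (y * y') - (witt_pairing x y + witt_pairing x y')"
    unfolding log_residue_mult[OF inv] wtrace_add residue_pairing_def[symmetric]
    by (drule_tac dvd_diff) (assumption, simp add: algebra_simps)
qed

lemma witt_pairing_wfrob:
  fixes x :: "'k::finite_field fls witt"
  assumes y: "y \<noteq> 0"
  shows "witt_pairing (wfrob x) y = witt_pairing x y"
proof (rule witt_cong_eqI')
  fix n
  let ?u = "\<lambda>i. fls_tei (wcoeff x i)"
  interpret ring_map "fls_red :: 'k witt fls \<Rightarrow> _" by (rule ring_map_fls_red)
  note inv = fls_tei_inverse[OF y]
  have 1: "of_nat CHAR('k) ^ Suc n dvd witt_pairing (wfrob x) y -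
     wtrace (log_residue n (\<lambda>i. ?u i ^ CHAR('k)) (fls_tei y) (fls_tei_inverse y))"
    by (rule witt_pairing_lifts) (simp_all add: inv y power)
  have 2: "of_nat CHAR('k) ^ Suc n dvd
     wtrace (log_residue n (\<lambda>i. ?u i ^ CHAR('k)) (fls_tei y) (fls_tei_inverse y))
     - residue_pairing n x y"
    using wtrace_dvd[OF log_residue_power[OF inv]]
    by (simp add: wtrace_diff wtrace_frob residue_pairing_def)
  from dvd_diff[OF dvd_add[OF 1 2] witt_pairing_cong[OF y, of n x]]
  show "of_nat CHAR('k) ^ Suc n dvd witt_pairing (wfrob x) y - witt_pairing x y" by simp
qed

text \<open>F^n applied to the expansion of a as the sum of the p^i [a_i^(1/p^i)], truncated after i
  = n.\<close>

lemma witt_ghost_tei_cong: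
  fixes a :: "'k::finite_field witt"
  shows "of_nat CHAR('k) ^ Suc n dvd witt_ghost CHAR('k) n (\<lambda>i. tei (wcoeff a i)) - (wfrob ^^ n) a"
proof (induction n arbitrary: a)
  case 0
  show ?case using witt_cong_iff[of 1 "tei (wcoeff a 0)" a] by simp
next
  case (Suc n)
  let ?p = "CHAR('k)"
  interpret ring_map "wfrob :: 'k witt \<Rightarrow> _" by (rule ring_map_wfrob)
  have fr: "(wfrob ^^ m) (x + y) = (wfrob ^^ m) x + (wfrob ^^ m) y" for m and x y :: "'k witt"
    by (induction m) (simp_all add: add)
  have ft: "(wfrob ^^ m) (tei c) = tei c ^ ?p ^ m" for m and c :: 'k
    by (induction m) (simp_all add: power wmap_tei[OF ring_map_frob] tei_power mult.commute flip: power_mult)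
  have fv: "(wfrob ^^ m) (ver x) = ver ((wfrob ^^ m) x)" for m and x :: "'k witt"
    by (induction m) (simp_all add: wmap_ver[OF ring_map_frob])
  have "witt_ghost ?p (Suc n) (\<lambda>i. tei (wcoeff a i)) =
      tei (wcoeff a 0) ^ ?p ^ Suc n + of_nat ?p * witt_ghost ?p n (\<lambda>i. tei (wcoeff (wtail a) i))"
    unfolding witt_ghost_def
    by (subst sum.atMost_Suc_shift) (simp add: sum_distrib_left mult.assoc)
  moreover have "(wfrob ^^ Suc n) a = tei (wcoeff a 0) ^ ?p ^ Suc n + of_nat ?p * (wfrob ^^ n) (wtail a)"
    by (subst witt_split[of a]) (simp only: fr ft fv times_p_eq, simp)
  ultimately have "witt_ghost ?p (Suc n) (\<lambda>i. tei (wcoeff a i)) - (wfrob ^^ Suc n) a =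
     of_nat ?p * (witt_ghost ?p n (\<lambda>i. tei (wcoeff (wtail a) i)) - (wfrob ^^ n) (wtail a))"
    by (simp add: algebra_simps)
  also have "of_nat ?p ^ Suc (Suc n) dvd \<dots>"
    unfolding power_Suc[of _ "Suc n"] by (intro mult_dvd_mono Suc.IH) simp
  finally show ?case .
qed

lemma witt_pairing_const:
  fixes a :: "'k::finite_field witt"
  assumes t: "t \<noteq> 0" "fls_subdegree t = 1"
  shows "witt_pairing (wmap fls_const a) t = wtrace a"
proof (rule witt_cong_eqI')
  fix n
  let ?p = "CHAR('k)"
  \<comment> \<open>Lifting by constants pulls the ghost component out of the residue, leaving
    Res(dt/t) = 1 for the lifted uniformizer.\<close>
  define u where "u i = fls_const (tei (wcoeff a i))" for i
  interpret c: ring_map "fls_const :: 'k witt \<Rightarrow> _"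
    by unfold_locales (simp_all add: fls_plus_const)
  have res: "(fls_deriv (fls_tei t) * fls_tei_inverse t) $$ - 1 = 1"
    using fls_residue_deriv_times_lr_inverse_eq_subdegree(1)[OF fls_tei_leading(2,1)[OF t(1)]]
    by (simp add: fls_tei_inverse_def t)
  have "log_residue n u (fls_tei t) (fls_tei_inverse t) = witt_ghost ?p n (\<lambda>i. tei (wcoeff a i))"
    unfolding log_residue_def u_def c.witt_ghost[symmetric] by (simp add: res)
  moreover have "of_nat ?p ^ Suc n dvd
      witt_pairing (wmap fls_const a) t - wtrace (log_residue n u (fls_tei t) (fls_tei_inverse t))"
  proof (rule witt_pairing_lifts)
    show "fls_red (u i) = wcoeff (wmap fls_const a) i" for i
      by (simp add: u_def fls_map_const)
  qed (simp_all add: t fls_tei_inverse)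
  moreover have "wtrace ((wfrob ^^ n) a) = wtrace a" by (induction n) (simp_all add: wtrace_frob)
  then have "of_nat ?p ^ Suc n dvd wtrace (witt_ghost ?p n (\<lambda>i. tei (wcoeff a i))) - wtrace a"
    using wtrace_dvd[OF witt_ghost_tei_cong[of n a]] by (simp add: wtrace_diff)
  ultimately show "of_nat ?p ^ Suc n dvd witt_pairing (wmap fls_const a) t - wtrace a"
    by (simp only:) (rule dvd_diff_trans)
qed

lemma of_nat_witt_eq_0_iff: "of_nat m = (0 :: 'k::finite_field witt) \<longleftrightarrow> m = 0"
proof
  assume 0: "of_nat m = (0 :: 'k witt)"
  show "m = 0"
  proof (rule ccontr)
    assume "m \<noteq> 0"
    then obtain v u where u: "m = CHAR('k) ^ v * u" "\<not> CHAR('k) dvd u"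
      by (metis multiplicity_decompose' CHAR_prime not_prime_unit)
    have "of_nat CHAR('k) ^ v * of_nat u = of_nat CHAR('k) ^ v * (0 :: 'k witt)"
      using 0 u(1) by simp
    then have "of_nat u = (0 :: 'k witt)" by (rule torsion_free_power[OF torsion_free_witt])
    then have "wcoeff (of_nat u :: 'k witt) 0 = 0" by simp
    then have "of_nat u = (0 :: 'k)" by (simp add: ring_map.of_nat[OF ring_map_wcoeff_0])
    then show False using u(2) by (simp add: of_nat_eq_0_iff_char_dvd)
  qed
qed simp

text \<open>The form is -1/m times d(z^m). The factor m is cancelled in characteristic zero and may
  be divisible by p, as it is for the exponents i p^n of ghost components.\<close>

lemma residue_power_dlog:
  fixes y z :: "'k::finite_field witt fls"
  assumes yz: "y * z = 1" and m: "m > 0"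
  shows "(z ^ m * (fls_deriv y * z)) $$ - 1 = 0"
proof -
  have zy: "z * y = 1" using yz by (simp add: mult.commute)
  have "fls_deriv (z ^ m) = fls_deriv (z ^ m) * y ^ m * z ^ m"
    using zy by (simp add: mult.assoc flip: power_mult_distrib add: mult.commute)
  also have "\<dots> = - (of_nat m * (z ^ m * (fls_deriv y * z)))"
    unfolding dlog_power[OF zy] using deriv_inverse[OF yz] by (simp add: mult_ac)
  finally have "fls_deriv (z ^ m) $$ - 1 = - (of_nat m * ((z ^ m * (fls_deriv y * z)) $$ - 1))"
    by simp
  then show ?thesis using m by (simp add: of_nat_witt_eq_0_iff)
qed

text \<open>Lifting by the Teichmueller vector of [c] z^i makes the n-th ghost component a single
  power, a constant times z^(i p^n).\<close>

lemma witt_pairing_tei: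
  fixes c :: "'k::finite_field"
  assumes t: "t \<noteq> 0" and i: "i > 0"
  shows "witt_pairing (tei (fls_const c * t powi (- i))) t = 0"
proof (rule witt_cong_eqI')
  fix n
  let ?p = "CHAR('k)" and ?z = "fls_tei_inverse t" and ?y = "fls_tei t"
  interpret red: ring_map "fls_red :: 'k witt fls \<Rightarrow> _" by (rule ring_map_fls_red)
  note inv = fls_tei_inverse[OF t]
  have "t * fls_red ?z = 1" using arg_cong[OF inv, of fls_red] by (simp add: red.mult red.one)
  then have "fls_red ?z = inverse t" by (metis inverse_unique)
  moreover have "t powi (- i) = inverse t ^ nat i"
    using i by (simp add: power_int_def)
  ultimately have red: "fls_red (teichmuller (fls_const (tei c) * ?z ^ nat i) j) =
      wcoeff (tei (fls_const c * t powi (- i))) j" for j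
    by (cases j) (simp_all add: red.hom_simps fls_map_const)
  have m: "nat i * ?p ^ n > 0" using i by simp
  have "log_residue n (teichmuller (fls_const (tei c) * ?z ^ nat i)) ?y ?z =
      (fls_const (tei c ^ ?p ^ n) * (?z ^ (nat i * ?p ^ n) * (fls_deriv ?y * ?z))) $$ - 1"
    by (simp add: log_residue_def witt_ghost_teichmuller power_mult_distrib power_mult mult.assoc
        flip: fls_const_power)
  also have "\<dots> = 0" using residue_power_dlog[OF inv m] by simp
  finally have "log_residue n (teichmuller (fls_const (tei c) * ?z ^ nat i)) ?y ?z = 0" .
  moreover have "of_nat ?p ^ Suc n dvd witt_pairing (tei (fls_const c * t powi (- i))) t -
     wtrace (log_residue n (teichmuller (fls_const (tei c) * ?z ^ nat i)) ?y ?z)"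
    by (rule witt_pairing_lifts) (simp_all add: red t inv)
  ultimately show "of_nat ?p ^ Suc n dvd witt_pairing (tei (fls_const c * t powi (- i))) t - 0"
    by simp
qed

section \<open>Witt vectors modulo \<open>\<wp>\<close>\<close>

definition wp_range :: "'a::comm_ring_prime_char witt set" where
  "wp_range = range (\<lambda>w. wfrob w - w)"

lemma wp_range_add:
  fixes x y :: "'a::comm_ring_prime_char witt"
  shows "x \<in> wp_range \<Longrightarrow> y \<in> wp_range \<Longrightarrow> x + y \<in> wp_range"
proof -
  interpret ring_map "wfrob :: 'a witt \<Rightarrow> _" by (rule ring_map_wfrob)
  assume "x \<in> wp_range" "y \<in> wp_range"
  then obtain v w where "x = wfrob v - v" "y = wfrob w - w" by (auto simp: wp_range_def)
  then have "x + y = wfrob (v + w) - (v + w)" by (simp add: add)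
  then show ?thesis by (auto simp: wp_range_def)
qed

lemma wp_range_0: "(0 :: 'a::comm_ring_prime_char witt) \<in> wp_range"
proof -
  interpret ring_map "wfrob :: 'a witt \<Rightarrow> _" by (rule ring_map_wfrob)
  have "(0 :: 'a witt) = wfrob 0 - 0" by (simp add: zero)
  then show ?thesis unfolding wp_range_def by blast
qed

lemma wp_range_uminus:
  fixes x :: "'a::comm_ring_prime_char witt"
  shows "x \<in> wp_range \<Longrightarrow> - x \<in> wp_range"
proof -
  interpret ring_map "wfrob :: 'a witt \<Rightarrow> _" by (rule ring_map_wfrob)
  assume "x \<in> wp_range"
  then obtain w where "x = wfrob w - w" by (auto simp: wp_range_def)
  then have "- x = wfrob (- w) - (- w)" by (simp add: uminus)
  then show ?thesis unfolding wp_range_def by (rule range_eqI)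
qed

lemma wp_range_mult:
  fixes r x :: "'a::comm_ring_prime_char witt"
  shows "wfrob r = r \<Longrightarrow> x \<in> wp_range \<Longrightarrow> r * x \<in> wp_range"
proof -
  interpret ring_map "wfrob :: 'a witt \<Rightarrow> _" by (rule ring_map_wfrob)
  assume r: "wfrob r = r" and "x \<in> wp_range"
  then obtain w where "x = wfrob w - w" by (auto simp: wp_range_def)
  then have "r * x = wfrob (r * w) - r * w" by (simp add: mult r right_diff_distrib)
  then show ?thesis unfolding wp_range_def by (rule range_eqI)
qed

section \<open>Dictionary between the record \<open>witt_ring\<close> and the type of Witt
  vectors\<close>

context
  fixes p :: nat and ty :: "'a::comm_ring_prime_char itself"
  assumes p: "p = CHAR('a)"
begin

text \<open>\<open>A\<close> affects only the carrier; leaving it free serves both the full ring and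
  \<open>Zp\<close>.\<close>

lemma add_witt_ring: "x \<oplus>\<^bsub>witt_ring p A\<^esub> y = wcoeff (Witt x + Witt y)" for x y :: "nat \<Rightarrow> 'a"
  by (simp add: witt_ring_def plus_witt_def witt_add_def p witt_poly_eval_eq)

lemma mult_witt_ring: "x \<otimes>\<^bsub>witt_ring p A\<^esub> y = wcoeff (Witt x * Witt y)" for x y :: "nat \<Rightarrow> 'a"
  by (simp add: witt_ring_def times_witt_def witt_mult_def p witt_poly_eval_eq)

lemma zero_witt_ring: "\<zero>\<^bsub>witt_ring p A\<^esub> = wcoeff (0 :: 'a witt)"
  by (simp add: witt_ring_def zero_witt_def)

lemma one_witt_ring: "\<one>\<^bsub>witt_ring p A\<^esub> = wcoeff (1 :: 'a witt)"
  by (simp add: witt_ring_def one_witt_def)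

lemma carrier_witt_ring: "carrier (witt_ring p A) = {x :: nat \<Rightarrow> 'a. range x \<subseteq> A}"
  by (simp add: witt_ring_def)

lemmas witt_ring_simps = add_witt_ring mult_witt_ring zero_witt_ring one_witt_ring carrier_witt_ring

lemma abelian_group_witt_ring: "abelian_group (witt_ring p (UNIV :: 'a set))"
proof (rule abelian_groupI)
  fix x :: "nat \<Rightarrow> 'a"
  show "\<exists>y\<in>carrier (witt_ring p UNIV). y \<oplus>\<^bsub>witt_ring p UNIV\<^esub> x = \<zero>\<^bsub>witt_ring p UNIV\<^esub>"
    by (rule bexI[of _ "wcoeff (- Witt x)"]) (simp_all add: witt_ring_simps)
qed (simp_all add: witt_ring_simps algebra_simps)

lemma minus_witt_ring: "x \<ominus>\<^bsub>witt_ring p UNIV\<^esub> y = wcoeff (Witt x - Witt y)" for x y :: "nat \<Rightarrow> 'a"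
proof -
  interpret abelian_group "witt_ring p (UNIV :: 'a set)" by (rule abelian_group_witt_ring)
  have "\<ominus>\<^bsub>witt_ring p UNIV\<^esub> y = wcoeff (- Witt y)"
    by (rule minus_equality) (simp_all add: witt_ring_simps)
  then show ?thesis by (simp add: a_minus_def witt_ring_simps)
qed

lemma add_pow_witt_ring: "[(m::nat)] \<cdot>\<^bsub>witt_ring p A\<^esub> x = wcoeff (of_nat m * Witt x)" for x :: "nat \<Rightarrow> 'a"
proof (induction m)
  case (Suc m)
  have "[Suc m] \<cdot>\<^bsub>witt_ring p A\<^esub> x = ([m] \<cdot>\<^bsub>witt_ring p A\<^esub> x) \<oplus>\<^bsub>witt_ring p A\<^esub> x"
    by (simp add: add_pow_def nat_pow_def)
  then show ?case by (simp add: Suc witt_ring_simps algebra_simps)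
qed (simp add: add_pow_def nat_pow_def zero_witt_ring)

lemma finsum_witt_ring:
  assumes "finite S"
  shows "finsum (witt_ring p UNIV) f S = wcoeff (\<Sum>i\<in>S. Witt (f i :: nat \<Rightarrow> 'a))"
  using assms
proof (induction S)
  case empty
  interpret abelian_group "witt_ring p (UNIV :: 'a set)" by (rule abelian_group_witt_ring)
  show ?case by (simp add: zero_witt_ring)
next
  case (insert i S)
  interpret abelian_group "witt_ring p (UNIV :: 'a set)" by (rule abelian_group_witt_ring)
  have "finsum (witt_ring p UNIV) f (insert i S) =
      f i \<oplus>\<^bsub>witt_ring p UNIV\<^esub> finsum (witt_ring p UNIV) f S"
    using insert by (intro finsum_insert) (auto simp: carrier_witt_ring)
  then show ?case using insert by (simp add: witt_ring_simps)
qed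

lemma range_witt_wp: "range (witt_wp p) = wcoeff ` (wp_range :: 'a witt set)"
proof -
  have eq: "witt_wp p x = wcoeff (wfrob (Witt x) - Witt x)" for x :: "nat \<Rightarrow> 'a"
    unfolding witt_wp_def minus_witt_ring by (simp add: witt_frob_def wmap_def p)
  show ?thesis
  proof (intro equalityI subsetI)
    fix z :: "nat \<Rightarrow> 'a" assume "z \<in> range (witt_wp p)"
    then obtain x where z: "z = witt_wp p x" by (elim rangeE)
    have "wfrob (Witt x) - Witt x \<in> wp_range" unfolding wp_range_def by (rule rangeI)
    then show "z \<in> wcoeff ` wp_range" unfolding z eq by (rule imageI)
  next
    fix z :: "nat \<Rightarrow> 'a" assume "z \<in> wcoeff ` wp_range"
    then obtain w where "z = wcoeff (wfrob w - w)" unfolding wp_range_def by (elim imageE rangeE) simp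
    then have z: "z = witt_wp p (wcoeff w)" by (simp add: eq)
    show "z \<in> range (witt_wp p)" unfolding z by (rule rangeI)
  qed
qed

lemma in_witt_class_iff: "y \<in> witt_class p (wcoeff x) \<longleftrightarrow> Witt y - x \<in> wp_range" for x :: "'a witt"
proof -
  have "y \<in> witt_class p (wcoeff x) \<longleftrightarrow> (\<exists>w\<in>wp_range. y = wcoeff (w + x))"
    unfolding witt_class_def a_r_coset_def' range_witt_wp
    by (auto simp: add_witt_ring)
  also have "\<dots> \<longleftrightarrow> Witt y - x \<in> wp_range"
    by (metis diff_add_cancel add_diff_cancel_right' witt.sel witt.collapse)
  finally show ?thesis .
qed

lemma witt_class_eq_iff: "witt_class p (wcoeff x) = witt_class p (wcoeff y) \<longleftrightarrow> x - y \<in> wp_range" for x y :: "'a witt"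
proof
  assume "witt_class p (wcoeff x) = witt_class p (wcoeff y)"
  moreover have "wcoeff x \<in> witt_class p (wcoeff x)"
    by (simp add: in_witt_class_iff wp_range_0)
  ultimately have "wcoeff x \<in> witt_class p (wcoeff y)" by simp
  then show "x - y \<in> wp_range" by (simp add: in_witt_class_iff)
next
  assume xy: "x - y \<in> wp_range"
  have "Witt z - x \<in> wp_range \<longleftrightarrow> Witt z - y \<in> wp_range" for z
  proof
    assume "Witt z - x \<in> wp_range"
    from wp_range_add[OF this xy] show "Witt z - y \<in> wp_range" by simp
  next
    assume "Witt z - y \<in> wp_range"
    from wp_range_add[OF this wp_range_uminus[OF xy]] show "Witt z - x \<in> wp_range" by simp
  qed
  then show "witt_class p (wcoeff x) = witt_class p (wcoeff y)"
    by (auto simp: in_witt_class_iff)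
qed

lemma carrier_witt_mod_wp: "carrier (witt_mod_wp p) = range (\<lambda>x :: 'a witt. witt_class p (wcoeff x))"
proof -
  have "carrier (witt_mod_wp p) = range (\<lambda>x :: nat \<Rightarrow> 'a. witt_class p x)"
    by (auto simp: witt_mod_wp_def A_FactGroup_def FactGroup_def RCOSETS_def witt_class_def
        a_r_coset_def carrier_witt_ring)
  also have "\<dots> = range (\<lambda>x :: 'a witt. witt_class p (wcoeff x))"
    by (metis (no_types, lifting) image_cong image_image surj_def witt.sel)
  finally show ?thesis .
qed

lemma mult_witt_mod_wp:
  "witt_class p (wcoeff x) \<otimes>\<^bsub>witt_mod_wp p\<^esub> witt_class p (wcoeff y) = witt_class p (wcoeff (x + y))"
  for x y :: "'a witt"
proof -
  have "witt_class p (wcoeff x) \<otimes>\<^bsub>witt_mod_wp p\<^esub> witt_class p (wcoeff y) =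
     {wcoeff (Witt u + Witt v) | u v. u \<in> witt_class p (wcoeff x) \<and> v \<in> witt_class p (wcoeff y)}"
    by (auto simp: witt_mod_wp_def A_FactGroup_def FactGroup_def set_mult_def add_witt_ring)
  also have "\<dots> = witt_class p (wcoeff (x + y))"
  proof (intro equalityI subsetI)
    fix z assume "z \<in> {wcoeff (Witt u + Witt v) | u v. u \<in> witt_class p (wcoeff x) \<and> v \<in> witt_class p (wcoeff y)}"
    then obtain u v where z: "z = wcoeff (Witt u + Witt v)"
      and "Witt u - x \<in> wp_range" "Witt v - y \<in> wp_range"
      by (auto simp: in_witt_class_iff)
    from wp_range_add[OF this(2,3)] have "Witt u + Witt v - (x + y) \<in> wp_range"
      by (simp add: algebra_simps)
    then show "z \<in> witt_class p (wcoeff (x + y))" by (simp add: z in_witt_class_iff)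
  next
    fix z assume "z \<in> witt_class p (wcoeff (x + y))"
    then have "Witt (wcoeff (Witt z - y)) - x \<in> wp_range" by (simp add: in_witt_class_iff algebra_simps)
    moreover have "Witt (wcoeff y) - y \<in> wp_range" by (simp add: wp_range_0)
    moreover have "z = wcoeff (Witt (wcoeff (Witt z - y)) + Witt (wcoeff y))" by simp
    ultimately show "z \<in> {wcoeff (Witt u + Witt v) | u v. u \<in> witt_class p (wcoeff x) \<and> v \<in> witt_class p (wcoeff y)}"
      unfolding in_witt_class_iff[symmetric] by blast
  qed
  finally show ?thesis .
qed

end

lemma ring_map_fls_const: "ring_map (fls_const :: 'a::comm_ring_1 \<Rightarrow> _)"
  by unfold_locales (simp_all add: fls_plus_const)

lemma wp_smult:
  fixes r :: "'k::finite_field witt" and x :: "'k fls witt"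
  assumes p: "p = CHAR('k)" and r: "wfrob r = r"
  shows "witt_mod_wp_smult p (wcoeff r) (witt_class p (wcoeff x)) =
    witt_class p (wcoeff (wmap fls_const r * x))"
proof -
  have p': "p = CHAR('k fls)" by (simp add: p)
  note [simp] = witt_ring_simps[OF p']
  let ?r = "wmap fls_const r"
  have c: "Witt (witt_const (wcoeff r)) = ?r"
    by (simp add: wmap_def witt_const_def)
  have fr: "wfrob ?r = ?r"
  proof (rule witt_eqI)
    fix i
    show "wcoeff (wfrob ?r) i = wcoeff ?r i"
      using arg_cong[OF r, of "\<lambda>r. wcoeff r i"] by (simp flip: fls_const_power)
  qed
  have "witt_mod_wp_smult p (wcoeff r) (witt_class p (wcoeff x)) =
     {wcoeff (w + ?r * Witt u) | w u. w \<in> wp_range \<and> u \<in> witt_class p (wcoeff x)}"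
    unfolding witt_mod_wp_smult_def set_add_def set_mult_def range_witt_wp[OF p']
    by (auto simp: c)
  also have "\<dots> = witt_class p (wcoeff (?r * x))"
  proof (intro equalityI subsetI)
    fix z assume "z \<in> {wcoeff (w + ?r * Witt u) | w u. w \<in> wp_range \<and> u \<in> witt_class p (wcoeff x)}"
    then obtain w u where z: "z = wcoeff (w + ?r * Witt u)"
      and w: "w \<in> wp_range" "Witt u - x \<in> wp_range"
      by (auto simp: in_witt_class_iff[OF p'])
    from wp_range_add[OF w(1) wp_range_mult[OF fr w(2)]]
    have "w + ?r * Witt u - ?r * x \<in> wp_range" by (simp add: algebra_simps)
    then show "z \<in> witt_class p (wcoeff (?r * x))" by (simp add: z in_witt_class_iff[OF p'])
  next
    fix z assume "z \<in> witt_class p (wcoeff (?r * x))"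
    then have "Witt z - ?r * x \<in> wp_range" by (simp add: in_witt_class_iff[OF p'])
    moreover have "wcoeff x \<in> witt_class p (wcoeff x)"
      by (simp add: in_witt_class_iff[OF p'] wp_range_0)
    moreover have "z = wcoeff ((Witt z - ?r * x) + ?r * Witt (wcoeff x))" by simp
    ultimately show "z \<in> {wcoeff (w + ?r * Witt u) | w u. w \<in> wp_range \<and> u \<in> witt_class p (wcoeff x)}"
      by blast
  qed
  finally show ?thesis .
qed

lemma Zp_iff: "x \<in> carrier (Zp p) \<longleftrightarrow> wfrob (Witt x) = Witt x" if "p = CHAR('k)" for x :: "nat \<Rightarrow> 'k::finite_field"
  by (simp add: Zp_def witt_ring_def wfrob_eq_iff)

lemma witt_trace_eq: "p = CHAR('k) \<Longrightarrow> witt_trace p a = wcoeff (wtrace (Witt (a :: nat \<Rightarrow> 'k::finite_field)))"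
  by (simp add: witt_trace_def finsum_witt_ring finite_subset[OF subset_UNIV] wtrace_def wmap_def)

subsection \<open>Residues of \<open>p\<close>-adic integers\<close>

lemma of_nat_witt_dvd:
  assumes "of_nat CHAR('k) ^ n dvd (of_nat m :: 'k::finite_field witt)"
  shows "CHAR('k) ^ n dvd m"
  using assms
proof (induction n arbitrary: m)
  case (Suc n)
  have "of_nat CHAR('k) dvd (of_nat m :: 'k witt)"
    using Suc.prems by (auto intro: dvd_mult_left)
  then have "of_nat m = (0 :: 'k)"
    by (simp add: witt_dvd_iff ring_map.of_nat[OF ring_map_wcoeff_0])
  then obtain m' where m': "m = CHAR('k) * m'" by (auto simp: of_nat_eq_0_iff_char_dvd)
  then have "of_nat CHAR('k) ^ (1 + n) dvd of_nat CHAR('k) ^ 1 * (of_nat m' :: 'k witt)"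
    using Suc.prems by simp
  then have "of_nat CHAR('k) ^ n dvd (of_nat m' :: 'k witt)"
    by (rule torsion_free_power_dvd[OF torsion_free_witt])
  then show ?case using Suc.IH by (simp add: m' mult_dvd_mono)
qed simp

text \<open>Density of the integers in the p-adic integers. The leading component of s lies in the
  prime field, so it lifts to a natural number; the quotient by p stays F-fixed because p
  cancels.\<close>

lemma wfrob_fixed_approx:
  fixes r :: "'k::finite_field witt"
  assumes "wfrob r = r"
  shows "\<exists>m s. wfrob s = s \<and> r = of_nat m + of_nat CHAR('k) ^ n * s"
proof (induction n)
  case 0
  show ?case using assms by (intro exI[of _ 0] exI[of _ r]) simp
next
  case (Suc n)
  interpret ring_map "wfrob :: 'k witt \<Rightarrow> _" by (rule ring_map_wfrob)
  obtain m s where s: "wfrob s = s" "r = of_nat m + of_nat CHAR('k) ^ n * s" using Suc by blast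
  have "wcoeff s 0 \<in> \<int>" using s(1) by (auto simp: wfrob_eq_iff)
  then obtain c where c: "wcoeff s 0 = of_int c" by (auto elim: Ints_cases)
  define e where "e = nat (c mod int CHAR('k))"
  have "of_nat e = (of_int (c mod int CHAR('k)) :: 'k)"
    by (simp add: e_def of_nat_nat)
  also have "\<dots> = of_int c"
    using div_mult_mod_eq[of c "int CHAR('k)"]
    by (metis add_0 mult_zero_right of_int_add of_int_mult of_int_of_nat_eq of_nat_CHAR)
  finally have "wcoeff (s - of_nat (e)) 0 = 0"
    using ring_map.diff[OF ring_map_wcoeff_0, of s] ring_map.of_nat[OF ring_map_wcoeff_0[where ?'a = 'k], of e] c by simp
  then obtain s' where s': "s - of_nat (e) = of_nat CHAR('k) * s'"
    by (auto simp flip: witt_dvd_iff elim: dvdE)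
  have "of_nat CHAR('k) * wfrob s' = wfrob (s - of_nat e)"
    unfolding s' by (simp add: mult of_nat)
  also have "\<dots> = s - of_nat e" by (simp add: diff of_nat s(1))
  finally have "of_nat CHAR('k) ^ 1 * wfrob s' = of_nat CHAR('k) ^ 1 * s'"
    unfolding s' by simp
  then have "wfrob s' = s'" by (rule torsion_free_power[OF torsion_free_witt])
  moreover have "s = of_nat (e) + of_nat CHAR('k) * s'"
    using s' by (simp add: algebra_simps)
  then have "r = of_nat (m + CHAR('k) ^ n * e) + of_nat CHAR('k) ^ Suc n * s'"
    by (simp add: s(2) algebra_simps)
  ultimately show ?case by blast
qed

context
  fixes p :: nat and r :: "'k::finite_field witt"
  assumes p: "p = CHAR('k)" and r: "wfrob r = r"
begin

lemma Zp_residue_eq: "Zp_residue p n (wcoeff r) =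
   (LEAST m. \<exists>s. wfrob s = s \<and> r = of_nat m + of_nat p ^ n * s)"
proof -
  have "(\<exists>s\<in>carrier (Zp p). wcoeff r = ([m] \<cdot>\<^bsub>Zp p\<^esub> \<one>\<^bsub>Zp p\<^esub>) \<oplus>\<^bsub>Zp p\<^esub> ([(p ^ n)] \<cdot>\<^bsub>Zp p\<^esub> s))
     \<longleftrightarrow> (\<exists>s. wfrob s = s \<and> r = of_nat m + of_nat p ^ n * s)" for m
  proof -
    have "(\<exists>s\<in>carrier (Zp p). wcoeff r = ([m] \<cdot>\<^bsub>Zp p\<^esub> \<one>\<^bsub>Zp p\<^esub>) \<oplus>\<^bsub>Zp p\<^esub> ([(p ^ n)] \<cdot>\<^bsub>Zp p\<^esub> s))
     \<longleftrightarrow> (\<exists>s. wfrob (Witt s) = Witt s \<and> wcoeff r = wcoeff (of_nat m + of_nat p ^ n * Witt s))"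
      unfolding Bex_def Zp_iff[OF p]
      by (simp add: Zp_def add_pow_witt_ring[OF p] witt_ring_simps[OF p])
    also have "\<dots> \<longleftrightarrow> (\<exists>s. wfrob s = s \<and> r = of_nat m + of_nat p ^ n * s)"
      by (metis witt.collapse witt.sel)
    finally show ?thesis .
  qed
  then show ?thesis by (simp add: Zp_residue_def)
qed

lemma Zp_residue: "of_nat p ^ n dvd r - of_nat (Zp_residue p n (wcoeff r))"
proof -
  have "\<exists>s. wfrob s = s \<and> r = of_nat (Zp_residue p n (wcoeff r)) + of_nat p ^ n * s"
    unfolding Zp_residue_eq by (rule LeastI_ex) (use wfrob_fixed_approx[OF r] p in blast)
  then obtain s where "r = of_nat (Zp_residue p n (wcoeff r)) + of_nat p ^ n * s" by blast
  then have "r - of_nat (Zp_residue p n (wcoeff r)) = of_nat p ^ n * s" by (simp add: algebra_simps)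
  then show ?thesis by simp
qed

text \<open>Minimality makes the residues increase with the level, so their difference is a genuine
  natural number and can serve as an exponent.\<close>

lemma Zp_residue_Suc:
  "\<exists>k. Zp_residue p (Suc n) (wcoeff r) = Zp_residue p n (wcoeff r) + p ^ n * k"
proof -
  let ?m = "Zp_residue p n (wcoeff r)" and ?m' = "Zp_residue p (Suc n) (wcoeff r)"
  interpret ring_map "wfrob :: 'k witt \<Rightarrow> _" by (rule ring_map_wfrob)
  have "\<exists>s. wfrob s = s \<and> r = of_nat ?m' + of_nat p ^ Suc n * s"
    unfolding Zp_residue_eq by (rule LeastI_ex) (use wfrob_fixed_approx[OF r] p in blast)
  then obtain s where "wfrob s = s" "r = of_nat ?m' + of_nat p ^ n * (of_nat p * s)" by (auto simp: mult_ac)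
  then have "wfrob (of_nat p * s) = of_nat p * s \<and> r = of_nat ?m' + of_nat p ^ n * (of_nat p * s)"
    by (simp add: hom_simps)
  then have le: "?m \<le> ?m'" unfolding Zp_residue_eq[of n] by (intro Least_le exI)
  have "of_nat p ^ n dvd r - of_nat ?m'" using Zp_residue[of "Suc n"] by (auto intro: dvd_mult_right)
  then have "of_nat p ^ n dvd (of_nat (?m' - ?m) :: 'k witt)"
    using dvd_diff[OF Zp_residue[of n]] le by (fastforce simp: of_nat_diff)
  then have "p ^ n dvd ?m' - ?m" unfolding p by (rule of_nat_witt_dvd)
  then obtain k where "?m' - ?m = p ^ n * k" by (elim dvdE)
  then show ?thesis using le by (intro exI[of _ k]) linarith
qed

end

subsection \<open>The completed multiplicative group\<close>

definition power_coset :: "nat \<Rightarrow> 'a::field \<Rightarrow> 'a set" where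
  "power_coset m y = {z ^ m * y | z. z \<noteq> 0}"

lemma power_coset_self: "y \<in> power_coset m y"
  unfolding power_coset_def by (rule CollectI, rule exI[of _ 1]) simp

lemma power_coset_eq_iff:
  assumes "y \<noteq> 0" "y' \<noteq> 0"
  shows "power_coset m y = power_coset m y' \<longleftrightarrow> (\<exists>z. z \<noteq> 0 \<and> y' = z ^ m * y)"
proof
  assume "power_coset m y = power_coset m y'"
  then have "y' \<in> power_coset m y" using power_coset_self by blast
  then show "\<exists>z. z \<noteq> 0 \<and> y' = z ^ m * y" by (auto simp: power_coset_def)
next
  assume "\<exists>z. z \<noteq> 0 \<and> y' = z ^ m * y"
  then obtain z where z: "z \<noteq> 0" "y' = z ^ m * y" by blast
  have "u ^ m * y = (u / z) ^ m * y'" "u ^ m * y' = (u * z) ^ m * y" for u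
    using z by (simp_all add: power_divide power_mult_distrib)
  moreover have "u / z \<noteq> 0" "u * z \<noteq> 0" if "u \<noteq> 0" for u using that z by simp_all
  ultimately show "power_coset m y = power_coset m y'"
    unfolding power_coset_def by blast
qed

lemma power_laurent_units: "x [^]\<^bsub>laurent_units\<^esub> (n::nat) = x ^ n"
  by (induction n) (simp_all add: laurent_units_def ring_of_type_algebra_def nat_pow_def mult.commute)

lemma carrier_laurent_units: "carrier laurent_units = {x. x \<noteq> 0}"
  by (auto simp: laurent_units_def ring_of_type_algebra_def)

lemma mult_laurent_units: "x \<otimes>\<^bsub>laurent_units\<^esub> y = x * y"
  by (simp add: laurent_units_def ring_of_type_algebra_def)

lemmas laurent_units_simps = power_laurent_units carrier_laurent_units mult_laurent_units

lemma power_subgroup_eq: "power_subgroup laurent_units m = power_coset m 1"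
  by (auto simp: power_subgroup_def power_coset_def laurent_units_simps)

lemma r_coset_power_subgroup: "power_subgroup laurent_units m #>\<^bsub>laurent_units\<^esub> y = power_coset m y"
  by (auto simp: r_coset_def power_subgroup_eq power_coset_def laurent_units_simps)

lemma to_p_completion_eq: "to_p_completion p laurent_units y n = power_coset (p ^ n) y"
  by (simp add: to_p_completion_def r_coset_power_subgroup)

text \<open>Two exponents with m dividing m' cover the product in one quotient and the transition
  maps between levels alike.\<close>

lemma set_mult_power_coset:
  assumes "m dvd m'"
  shows "power_coset m y <#>\<^bsub>laurent_units\<^esub> power_coset m' y' = power_coset m (y * y')"
proof (intro equalityI subsetI)
  obtain l where l: "m' = m * l" using assms by (elim dvdE)
  fix x assume "x \<in> power_coset m y <#>\<^bsub>laurent_units\<^esub> power_coset m' y'"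
  then obtain u v where "u \<noteq> 0" "v \<noteq> 0" "x = (u ^ m * y) * (v ^ m' * y')"
    by (auto simp: set_mult_def power_coset_def laurent_units_simps)
  then have "u * v ^ l \<noteq> 0 \<and> x = (u * v ^ l) ^ m * (y * y')"
    by (simp add: power_mult_distrib l mult_ac flip: power_mult)
  then show "x \<in> power_coset m (y * y')" unfolding power_coset_def by blast
next
  fix x assume "x \<in> power_coset m (y * y')"
  then obtain u where "u \<noteq> 0" "x = (u ^ m * y) * y'" by (auto simp: power_coset_def mult_ac)
  moreover from this have "u ^ m * y \<in> power_coset m y" unfolding power_coset_def by blast
  ultimately show "x \<in> power_coset m y <#>\<^bsub>laurent_units\<^esub> power_coset m' y'"
    using power_coset_self[of y' m'] unfolding set_mult_def laurent_units_simps by blast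
qed

lemma carrier_FactGroup_laurent_units:
  "carrier (laurent_units Mod power_subgroup laurent_units m) = {power_coset m y | y. y \<noteq> 0}"
  by (auto simp: carrier_FactGroup r_coset_power_subgroup laurent_units_simps)

lemma power_FactGroup_laurent_units:
  "power_coset m y [^]\<^bsub>laurent_units Mod power_subgroup laurent_units m\<^esub> (n::nat) = power_coset m (y ^ n)"
  by (induction n)
    (simp_all add: set_mult_power_coset mult.commute power_subgroup_eq)

text \<open>
  Elements of the completion are handled through sequences of representatives of their components.
\<close>

definition compatible :: "nat \<Rightarrow> (nat \<Rightarrow> 'a::field) \<Rightarrow> bool" where
  "compatible p y \<longleftrightarrow> (\<forall>n. y n \<noteq> 0 \<and> (\<exists>z. z \<noteq> 0 \<and> y (Suc n) = z ^ p ^ n * y n))"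

definition completion_of :: "nat \<Rightarrow> (nat \<Rightarrow> 'a::field) \<Rightarrow> nat \<Rightarrow> 'a set" where
  "completion_of p y = (\<lambda>n. power_coset (p ^ n) (y n))"

lemma carrier_completion:
  "b \<in> carrier (p_completion p laurent_units) \<longleftrightarrow> (\<exists>y. compatible p y \<and> b = completion_of p y)"
proof
  assume b: "b \<in> carrier (p_completion p laurent_units)"
  have b': "\<forall>n. b n \<in> {power_coset (p ^ n) y | y. y \<noteq> 0} \<and>
      b n = power_subgroup laurent_units (p ^ n) <#>\<^bsub>laurent_units\<^esub> b (Suc n)"
    using b unfolding p_completion_def partial_object.select_convs mem_Collect_eq
      carrier_FactGroup_laurent_units .
  have "\<exists>y. y \<noteq> 0 \<and> b n = power_coset (p ^ n) y" for n
    using b'[THEN spec[of _ n], THEN conjunct1] by (elim CollectE exE conjE) (intro exI conjI)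
  then have "\<exists>y. \<forall>n. y n \<noteq> 0 \<and> b n = power_coset (p ^ n) (y n)" by (intro choice allI)
  then obtain y where y': "\<forall>n. y n \<noteq> 0 \<and> b n = power_coset (p ^ n) (y n)" by (elim exE)
  note y = y'[THEN spec, THEN conjunct1] y'[THEN spec, THEN conjunct2]
  have "power_coset (p ^ n) (y n) = power_coset (p ^ n) (y (Suc n))" for n
  proof -
    have "b n = power_coset (p ^ n) 1 <#>\<^bsub>laurent_units\<^esub> b (Suc n)"
      using b'[THEN spec[of _ n], THEN conjunct2] unfolding power_subgroup_eq .
    then show ?thesis by (simp add: y set_mult_power_coset)
  qed
  then have "compatible p y" using y(1) by (simp add: compatible_def power_coset_eq_iff)
  then show "\<exists>y. compatible p y \<and> b = completion_of p y"
    using y(2) by (auto simp: completion_of_def)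
next
  assume "\<exists>y. compatible p y \<and> b = completion_of p y"
  then obtain y where y: "compatible p y" and b: "b = completion_of p y" by blast
  have eq: "power_coset (p ^ n) (y n) = power_coset (p ^ n) (y (Suc n))" for n
    using y by (simp add: compatible_def power_coset_eq_iff)
  have "completion_of p y n \<in> carrier (laurent_units Mod power_subgroup laurent_units (p ^ n))" for n
    unfolding completion_of_def carrier_FactGroup_laurent_units using y compatible_def by blast
  moreover have "completion_of p y n =
      power_subgroup laurent_units (p ^ n) <#>\<^bsub>laurent_units\<^esub> completion_of p y (Suc n)" for n
    unfolding completion_of_def power_subgroup_eq using eq[of n] by (simp add: set_mult_power_coset)
  ultimately show "b \<in> carrier (p_completion p laurent_units)"
    unfolding b p_completion_def partial_object.select_convs mem_Collect_eq by blast
qed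

lemma mult_completion:
  "completion_of p y \<otimes>\<^bsub>p_completion p laurent_units\<^esub> completion_of p y' = completion_of p (\<lambda>n. y n * y' n)"
  by (simp add: p_completion_def completion_of_def set_mult_power_coset)

lemma compatible_mult:
  assumes "compatible p y" "compatible p y'"
  shows "compatible p (\<lambda>n. y n * y' n)"
  unfolding compatible_def
proof (intro allI conjI)
  fix n
  show "y n * y' n \<noteq> 0" using assms by (simp add: compatible_def)
  obtain z z' where "z \<noteq> 0" "z' \<noteq> 0" "y (Suc n) = z ^ p ^ n * y n" "y' (Suc n) = z' ^ p ^ n * y' n"
    using assms unfolding compatible_def by blast
  then have "z * z' \<noteq> 0 \<and> y (Suc n) * y' (Suc n) = (z * z') ^ p ^ n * (y n * y' n)"
    by (simp add: power_mult_distrib mult_ac)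
  then show "\<exists>z. z \<noteq> 0 \<and> y (Suc n) * y' (Suc n) = z ^ p ^ n * (y n * y' n)" by blast
qed

lemma compatible_const: "y \<noteq> 0 \<Longrightarrow> compatible p (\<lambda>_. y)"
  unfolding compatible_def by (auto intro: exI[of _ 1])

lemma to_p_completion_const: "to_p_completion p laurent_units y = completion_of p (\<lambda>_. y)"
  by (auto simp: to_p_completion_eq completion_of_def)

lemma p_completion_pow_eq:
  "p_completion_pow p laurent_units (completion_of p y) r =
     completion_of p (\<lambda>n. y n ^ Zp_residue p n r)"
  by (simp add: p_completion_pow_def completion_of_def power_FactGroup_laurent_units)

lemma compatible_pow:
  fixes r :: "'k::finite_field witt"
  assumes p: "p = CHAR('k)" and r: "wfrob r = r" and y: "compatible p y"
  shows "compatible p (\<lambda>n. y n ^ Zp_residue p n (wcoeff r))"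
  unfolding compatible_def
proof (intro allI conjI)
  fix n
  let ?m = "Zp_residue p n (wcoeff r)"
  show "y n ^ ?m \<noteq> 0" using y by (simp add: compatible_def)
  obtain z where z: "z \<noteq> 0" "y (Suc n) = z ^ p ^ n * y n"
    using y unfolding compatible_def by blast
  obtain k where k: "Zp_residue p (Suc n) (wcoeff r) = ?m + p ^ n * k"
    using Zp_residue_Suc[OF p r] by blast
  \<comment> \<open>Base and exponent both move with n: z^m accounts for the change of base in the
    first m factors, y_(n+1)^k for the additional exponent p^n k.\<close>
  have "z ^ ?m * y (Suc n) ^ k \<noteq> 0" using y z by (simp add: compatible_def)
  moreover have "y (Suc n) ^ Zp_residue p (Suc n) (wcoeff r) = (z ^ ?m * y (Suc n) ^ k) ^ p ^ n * y n ^ ?m"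
    unfolding k power_add
    by (subst (1) z(2)) (simp add: power_mult_distrib mult_ac flip: power_mult)
  ultimately show "\<exists>z. z \<noteq> 0 \<and> y (Suc n) ^ Zp_residue p (Suc n) (wcoeff r) = z ^ p ^ n * y n ^ ?m"
    by blast
qed

section \<open>Extension of the pairing to the completion\<close>

text \<open>Here s n is final only modulo p^n, that is, in the components below n, so component i of
  the limit comes from s (i+1).\<close>

lemma witt_complete:
  fixes s :: "nat \<Rightarrow> 'k::finite_field witt"
  assumes s: "\<And>n. of_nat CHAR('k) ^ n dvd s (Suc n) - s n"
  shows "\<exists>r. \<forall>n. of_nat CHAR('k) ^ n dvd r - s n"
proof (intro exI allI)
  fix n
  have *: "of_nat CHAR('k) ^ m dvd s n - s m" if "m \<le> n" for m n
    using that
  proof (induction n rule: dec_induct)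
    case (step n)
    have "of_nat CHAR('k) ^ m dvd s (Suc n) - s n"
      by (rule dvd_trans[OF le_imp_power_dvd s]) (use step in simp)
    from dvd_diff_trans[OF this step.IH] show ?case .
  qed simp
  show "of_nat CHAR('k) ^ n dvd Witt (\<lambda>i. wcoeff (s (Suc i)) i) - s n"
    unfolding witt_cong_iff
  proof (intro allI impI)
    fix i assume "i < n"
    then have "of_nat CHAR('k) ^ Suc i dvd s n - s (Suc i)" by (intro *) simp
    then show "wcoeff (Witt (\<lambda>i. wcoeff (s (Suc i)) i)) i = wcoeff (s n) i"
      unfolding witt_cong_iff by simp
  qed
qed

lemma witt_pairing_0 [simp]: "y \<noteq> 0 \<Longrightarrow> witt_pairing (0 :: 'k::finite_field fls witt) y = 0"
  using witt_pairing_add[of y 0 0] by (simp only: add_0_left add_cancel_right_right simp_thms)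

lemma witt_pairing_diff:
  fixes x :: "'k::finite_field fls witt"
  shows "y \<noteq> 0 \<Longrightarrow> witt_pairing (x - x') y = witt_pairing x y - witt_pairing x' y"
  using witt_pairing_add[of y "x - x'" x'] by (simp add: algebra_simps)

lemma witt_pairing_of_nat:
  fixes x :: "'k::finite_field fls witt"
  shows "y \<noteq> 0 \<Longrightarrow> witt_pairing (of_nat m * x) y = of_nat m * witt_pairing x y"
  by (induction m) (simp_all add: algebra_simps witt_pairing_add)

lemma witt_pairing_1 [simp]: "witt_pairing (x :: 'k::finite_field fls witt) 1 = 0"
  using witt_pairing_mult[of 1 1 x] by (simp only: mult_1_left add_cancel_right_right one_neq_zero simp_thms)

lemma witt_pairing_power:
  fixes x :: "'k::finite_field fls witt"
  shows "y \<noteq> 0 \<Longrightarrow> witt_pairing x (y ^ m) = of_nat m * witt_pairing x y"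
  by (induction m) (simp_all add: algebra_simps witt_pairing_mult)

lemma witt_pairing_wp_range:
  fixes x :: "'k::finite_field fls witt"
  assumes "y \<noteq> 0" "x - x' \<in> wp_range"
  shows "witt_pairing x y = witt_pairing x' y"
proof -
  obtain w where w: "x - x' = wfrob w - w" using assms(2) unfolding wp_range_def by (elim rangeE)
  have "witt_pairing (wfrob w - w) y = 0"
    by (simp only: witt_pairing_diff[OF assms(1)] witt_pairing_wfrob[OF assms(1)] diff_self)
  then show ?thesis using witt_pairing_diff[OF assms(1), of x x'] by (simp add: w)
qed

text \<open>Additivity gives linearity over the integers. Writing r = m + p^n s turns the defect for
  r into p^n times the defect for s, for every n.\<close>

lemma witt_pairing_scale:
  fixes x :: "'k::finite_field fls witt"
  assumes y: "y \<noteq> 0" and r: "wfrob r = r"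
  shows "witt_pairing (wmap fls_const r * x) y = r * witt_pairing x y"
proof (rule witt_cong_eqI)
  fix n
  interpret ring_map "wmap fls_const :: 'k witt \<Rightarrow> _"
    by (intro ring_map_wmap ring_map_fls_const)
  obtain m s where s: "wfrob s = s" "r = of_nat m + of_nat CHAR('k) ^ n * s"
    using wfrob_fixed_approx[OF r] by blast
  have "wmap fls_const r * x = of_nat m * x + of_nat (CHAR('k) ^ n) * (wmap fls_const s * x)"
    by (simp add: s(2) hom_simps algebra_simps)
  then have "witt_pairing (wmap fls_const r * x) y =
      of_nat m * witt_pairing x y + of_nat (CHAR('k) ^ n) * witt_pairing (wmap fls_const s * x) y"
    by (simp only: witt_pairing_add[OF y] witt_pairing_of_nat[OF y])
  then have "witt_pairing (wmap fls_const r * x) y - r * witt_pairing x y =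
      of_nat CHAR('k) ^ n * (witt_pairing (wmap fls_const s * x) y - s * witt_pairing x y)"
    by (simp add: s(2) algebra_simps)
  then show "of_nat CHAR('k) ^ n dvd witt_pairing (wmap fls_const r * x) y - r * witt_pairing x y"
    by simp
qed

section \<open>The pairing on compatible sequences and on classes\<close>

definition completed_pairing :: "'k::finite_field fls witt \<Rightarrow> (nat \<Rightarrow> 'k fls) \<Rightarrow> 'k witt" where
  "completed_pairing x y = (SOME r. \<forall>n. of_nat CHAR('k) ^ n dvd r - witt_pairing x (y n))"

lemma completed_pairing:
  fixes x :: "'k::finite_field fls witt"
  assumes "compatible CHAR('k) y"
  shows "of_nat CHAR('k) ^ n dvd completed_pairing x y - witt_pairing x (y n)"
proof -
  have "of_nat CHAR('k) ^ n dvd witt_pairing x (y (Suc n)) - witt_pairing x (y n)" for n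
  proof -
    obtain z where z: "z \<noteq> 0" "y (Suc n) = z ^ CHAR('k) ^ n * y n" "y n \<noteq> 0"
      using assms unfolding compatible_def by blast
    have zn: "z ^ CHAR('k) ^ n \<noteq> 0" using z(1) by simp
    have "witt_pairing x (y (Suc n)) = of_nat (CHAR('k) ^ n) * witt_pairing x z + witt_pairing x (y n)"
      by (simp only: z(2) witt_pairing_mult[OF zn z(3)] witt_pairing_power[OF z(1)])
    then show ?thesis by simp
  qed
  then have "\<exists>r. \<forall>n. of_nat CHAR('k) ^ n dvd r - witt_pairing x (y n)" by (rule witt_complete)
  from someI_ex[OF this] show ?thesis unfolding completed_pairing_def by blast
qed

lemma completed_pairing_eqI:
  fixes x :: "'k::finite_field fls witt"
  assumes "compatible CHAR('k) y" "\<And>n. of_nat CHAR('k) ^ n dvd r - witt_pairing x (y n)"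
  shows "completed_pairing x y = r"
proof (rule witt_cong_eqI)
  fix n
  from dvd_diff[OF completed_pairing[OF assms(1), of n x] assms(2)[of n]]
  show "of_nat CHAR('k) ^ n dvd completed_pairing x y - r" by simp
qed

text \<open>Another representative at level n differs by a p^n-th power, which changes the pairing
  by a multiple of p^n.\<close>

lemma completed_pairing_cong:
  fixes x x' :: "'k::finite_field fls witt"
  assumes y: "compatible CHAR('k) y" "compatible CHAR('k) y'"
    and eq: "completion_of CHAR('k) y = completion_of CHAR('k) y'" and x: "x - x' \<in> wp_range"
  shows "completed_pairing x y = completed_pairing x' y'"
proof (rule completed_pairing_eqI[OF y(1)])
  fix n
  have nz: "y n \<noteq> 0" "y' n \<noteq> 0" using y by (simp_all add: compatible_def)
  have "power_coset (CHAR('k) ^ n) (y n) = power_coset (CHAR('k) ^ n) (y' n)"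
    using fun_cong[OF eq, of n] by (simp add: completion_of_def)
  then obtain z where z: "z \<noteq> 0" "y' n = z ^ CHAR('k) ^ n * y n"
    using power_coset_eq_iff[OF nz] by blast
  have zn: "z ^ CHAR('k) ^ n \<noteq> 0" using z(1) by simp
  have "witt_pairing x' (y' n) = of_nat (CHAR('k) ^ n) * witt_pairing x' z + witt_pairing x' (y n)"
    by (simp only: z(2) witt_pairing_mult[OF zn nz(1)] witt_pairing_power[OF z(1)])
  then have "of_nat CHAR('k) ^ n dvd witt_pairing x' (y' n) - witt_pairing x (y n)"
    by (simp add: witt_pairing_wp_range[OF nz(1) x])
  from dvd_diff_trans[OF completed_pairing[OF y(2)] this]
  show "of_nat CHAR('k) ^ n dvd completed_pairing x' y' - witt_pairing x (y n)" .
qed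

lemma wfrob_completed_pairing:
  fixes x :: "'k::finite_field fls witt"
  assumes "compatible CHAR('k) y"
  shows "wfrob (completed_pairing x y) = completed_pairing x y"
proof (rule completed_pairing_eqI[OF assms, symmetric])
  fix n
  interpret ring_map "wfrob :: 'k witt \<Rightarrow> _" by (rule ring_map_wfrob)
  have "y n \<noteq> 0" using assms by (simp add: compatible_def)
  then have "wfrob (completed_pairing x y) - witt_pairing x (y n) =
      wfrob (completed_pairing x y - witt_pairing x (y n))"
    by (simp add: diff wfrob_witt_pairing)
  then show "of_nat CHAR('k) ^ n dvd wfrob (completed_pairing x y) - witt_pairing x (y n)"
    using dvd[OF completed_pairing[OF assms, of n x]] by (simp add: power of_nat)
qed

text \<open>The restriction makes the map extensional, so that it can be the only function with the
  required properties.\<close>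

definition schmid_witt :: "nat \<Rightarrow> (nat \<Rightarrow> 'k::finite_field fls) set \<times> (nat \<Rightarrow> 'k fls set) \<Rightarrow> nat \<Rightarrow> 'k" where
  "schmid_witt p = restrict (\<lambda>(c, b). wcoeff (completed_pairing
      (SOME x. c = witt_class p (wcoeff x)) (SOME y. compatible p y \<and> b = completion_of p y)))
    (carrier (witt_mod_wp p) \<times> carrier (laurent_units_completion p))"

context
  fixes p :: nat and ty :: "'k::finite_field itself"
  assumes p: "p = CHAR('k)"
begin

lemma p_fls: "p = CHAR('k fls)" by (simp add: p)

lemma class_in_carrier: "witt_class p (wcoeff x) \<in> carrier (witt_mod_wp p)" for x :: "'k fls witt"
  by (simp add: carrier_witt_mod_wp[OF p_fls])

lemma completion_in_carrier:
  "compatible p y \<Longrightarrow> completion_of p y \<in> carrier (laurent_units_completion p)" for y :: "nat \<Rightarrow> 'k fls"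
  using carrier_completion by blast

lemma schmid_witt_eq:
  fixes x :: "'k fls witt"
  assumes y: "compatible p y"
  shows "schmid_witt p (witt_class p (wcoeff x), completion_of p y) = wcoeff (completed_pairing x y)"
proof -
  let ?x = "SOME x'. witt_class p (wcoeff x) = witt_class p (wcoeff x')"
  let ?y = "SOME y'. compatible p y' \<and> completion_of p y = completion_of p y'"
  have x': "witt_class p (wcoeff x) = witt_class p (wcoeff ?x)" by (rule someI[of _ x]) simp
  have y': "compatible p ?y \<and> completion_of p y = completion_of p ?y"
    by (rule someI[of _ y]) (simp add: y)
  have "completed_pairing x y = completed_pairing ?x ?y"
    using y y' x' witt_class_eq_iff[OF p_fls, of x ?x] unfolding p
    by (intro completed_pairing_cong) simp_all
  then show ?thesis
    unfolding schmid_witt_def using class_in_carrier completion_in_carrier[OF y] by simp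
qed

lemma carrier_cases:
  assumes "c \<in> carrier (witt_mod_wp p)" "b \<in> carrier (laurent_units_completion p)"
  obtains x :: "'k fls witt" and y where
    "c = witt_class p (wcoeff x)" "compatible p y" "b = completion_of p y"
  using assms by (auto simp: carrier_witt_mod_wp[OF p_fls] carrier_completion)

lemma schmid_witt_funcset:
  "schmid_witt p \<in> carrier (witt_mod_wp p) \<times> carrier (laurent_units_completion p)
    \<rightarrow>\<^sub>E carrier (Zp p :: (nat \<Rightarrow> 'k) ring)"
proof (rule PiE_I)
  fix cb :: "(nat \<Rightarrow> 'k fls) set \<times> (nat \<Rightarrow> 'k fls set)"
  assume "cb \<in> carrier (witt_mod_wp p) \<times> carrier (laurent_units_completion p)"
  then obtain c b where cb: "cb = (c, b)" "c \<in> carrier (witt_mod_wp p)" "b \<in> carrier (laurent_units_completion p)"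
    by (elim SigmaE)
  obtain x :: "'k fls witt" and y where "c = witt_class p (wcoeff x)" "compatible p y" "b = completion_of p y"
    by (rule carrier_cases[OF cb(2,3)])
  then have "schmid_witt p cb = wcoeff (completed_pairing x y)"
    unfolding cb(1) by (simp add: schmid_witt_eq)
  moreover have "wfrob (completed_pairing x y) = completed_pairing x y"
    using \<open>compatible p y\<close> p by (simp add: wfrob_completed_pairing)
  ultimately show "schmid_witt p cb \<in> carrier (Zp p)"
    by (simp only: Zp_iff[OF p] witt.collapse)
qed (simp add: schmid_witt_def)

lemma Zp_simps:
  "x \<oplus>\<^bsub>Zp p\<^esub> y = wcoeff (Witt x + Witt y)" "x \<otimes>\<^bsub>Zp p\<^esub> y = wcoeff (Witt x * Witt y)"
  "\<zero>\<^bsub>Zp p\<^esub> = wcoeff (0 :: 'k witt)" for x y :: "nat \<Rightarrow> 'k"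
  by (simp_all add: Zp_def witt_ring_simps[OF p])

lemma completed_pairing_add_left:
  fixes x :: "'k fls witt"
  assumes y: "compatible p y"
  shows "completed_pairing (x + x') y = completed_pairing x y + completed_pairing x' y"
proof (rule completed_pairing_eqI)
  show y': "compatible CHAR('k) y" using y p by simp
  fix n
  have "y n \<noteq> 0" using y by (simp add: compatible_def)
  then show "of_nat CHAR('k) ^ n dvd completed_pairing x y + completed_pairing x' y - witt_pairing (x + x') (y n)"
    using dvd_add[OF completed_pairing[OF y', of n x] completed_pairing[OF y', of n x']]
    by (simp add: witt_pairing_add algebra_simps)
qed

lemma completed_pairing_mult_right:
  fixes x :: "'k fls witt"
  assumes y: "compatible p y" "compatible p z"
  shows "completed_pairing x (\<lambda>n. y n * z n) = completed_pairing x y + completed_pairing x z"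
proof (rule completed_pairing_eqI)
  show "compatible CHAR('k) (\<lambda>n. y n * z n)" using compatible_mult[OF y] p by simp
  have y': "compatible CHAR('k) y" "compatible CHAR('k) z" using y p by simp_all
  fix n
  have "y n \<noteq> 0" "z n \<noteq> 0" using y by (simp_all add: compatible_def)
  then show "of_nat CHAR('k) ^ n dvd completed_pairing x y + completed_pairing x z - witt_pairing x (y n * z n)"
    using dvd_add[OF completed_pairing[OF y'(1), of n x] completed_pairing[OF y'(2), of n x]]
    by (simp add: witt_pairing_mult algebra_simps)
qed

lemma completed_pairing_scale_left:
  fixes x :: "'k fls witt"
  assumes y: "compatible p y" and r: "wfrob r = r"
  shows "completed_pairing (wmap fls_const r * x) y = r * completed_pairing x y"
proof (rule completed_pairing_eqI)
  show y': "compatible CHAR('k) y" using y p by simp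
  fix n
  have "y n \<noteq> 0" using y by (simp add: compatible_def)
  then show "of_nat CHAR('k) ^ n dvd r * completed_pairing x y - witt_pairing (wmap fls_const r * x) (y n)"
    using dvd_mult[OF completed_pairing[OF y', of n x], of r]
    by (simp add: witt_pairing_scale r right_diff_distrib)
qed

lemma completed_pairing_power_right:
  fixes x :: "'k fls witt"
  assumes y: "compatible p y" and r: "wfrob r = r"
  shows "completed_pairing x (\<lambda>n. y n ^ Zp_residue p n (wcoeff r)) = r * completed_pairing x y"
proof (rule completed_pairing_eqI)
  show "compatible CHAR('k) (\<lambda>n. y n ^ Zp_residue p n (wcoeff r))"
    using compatible_pow[OF p r y] p by simp
  fix n
  let ?m = "Zp_residue p n (wcoeff r)"
  have "y n \<noteq> 0" using y by (simp add: compatible_def)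
  then have "r * completed_pairing x y - witt_pairing x (y n ^ ?m) =
      (r - of_nat ?m) * completed_pairing x y + of_nat ?m * (completed_pairing x y - witt_pairing x (y n))"
    by (simp add: witt_pairing_power algebra_simps)
  moreover have "of_nat CHAR('k) ^ n dvd r - of_nat ?m" using Zp_residue[OF p r] p by simp
  moreover have "of_nat CHAR('k) ^ n dvd completed_pairing x y - witt_pairing x (y n)"
    by (rule completed_pairing) (use y p in simp)
  ultimately show "of_nat CHAR('k) ^ n dvd r * completed_pairing x y - witt_pairing x (y n ^ ?m)"
    by simp
qed

lemma schmid_witt_bilinear: "Zp_bilinear p (schmid_witt p :: _ \<Rightarrow> nat \<Rightarrow> 'k)"
  unfolding Zp_bilinear_def
proof (intro conjI ballI)
  fix c c' :: "(nat \<Rightarrow> 'k fls) set" and b :: "nat \<Rightarrow> 'k fls set"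
  assume c: "c \<in> carrier (witt_mod_wp p)" "c' \<in> carrier (witt_mod_wp p)"
    and b: "b \<in> carrier (laurent_units_completion p)"
  obtain x y where 1: "c = witt_class p (wcoeff x)" "compatible p y" "b = completion_of p y"
    by (rule carrier_cases[OF c(1) b])
  obtain x' where 2: "c' = witt_class p (wcoeff x')"
    by (rule carrier_cases[OF c(2) b])
  show "schmid_witt p (c \<otimes>\<^bsub>witt_mod_wp p\<^esub> c', b) = schmid_witt p (c, b) \<oplus>\<^bsub>Zp p\<^esub> schmid_witt p (c', b)"
    using 1(2) by (simp add: 1 2 mult_witt_mod_wp[OF p_fls] schmid_witt_eq Zp_simps completed_pairing_add_left)
next
  fix c :: "(nat \<Rightarrow> 'k fls) set" and b b' :: "nat \<Rightarrow> 'k fls set"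
  assume c: "c \<in> carrier (witt_mod_wp p)"
    and b: "b \<in> carrier (laurent_units_completion p)" "b' \<in> carrier (laurent_units_completion p)"
  obtain x y where 1: "c = witt_class p (wcoeff x)" "compatible p y" "b = completion_of p y"
    by (rule carrier_cases[OF c b(1)])
  obtain y' where 2: "compatible p y'" "b' = completion_of p y'"
    by (rule carrier_cases[OF c b(2)])
  show "schmid_witt p (c, b \<otimes>\<^bsub>laurent_units_completion p\<^esub> b') =
      schmid_witt p (c, b) \<oplus>\<^bsub>Zp p\<^esub> schmid_witt p (c, b')"
    using 1(2) 2(1) compatible_mult[OF 1(2) 2(1)]
    by (simp add: 1(1,3) 2(2) mult_completion schmid_witt_eq Zp_simps completed_pairing_mult_right)
next
  fix r :: "nat \<Rightarrow> 'k" and c :: "(nat \<Rightarrow> 'k fls) set" and b :: "nat \<Rightarrow> 'k fls set"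
  assume r: "r \<in> carrier (Zp p)" and c: "c \<in> carrier (witt_mod_wp p)"
    and b: "b \<in> carrier (laurent_units_completion p)"
  obtain x y where 1: "c = witt_class p (wcoeff x)" "compatible p y" "b = completion_of p y"
    by (rule carrier_cases[OF c b])
  have r': "wfrob (Witt r) = Witt r" using r by (simp add: Zp_iff p)
  have "witt_mod_wp_smult p r c = witt_class p (wcoeff (wmap fls_const (Witt r) * x))"
    using wp_smult[OF p r', of x] by (simp add: 1)
  then show "schmid_witt p (witt_mod_wp_smult p r c, b) = r \<otimes>\<^bsub>Zp p\<^esub> schmid_witt p (c, b)"
    using 1(2) by (simp add: 1(1,3) schmid_witt_eq Zp_simps completed_pairing_scale_left[OF _ r'])
  show "schmid_witt p (c, p_completion_pow p laurent_units b r) = r \<otimes>\<^bsub>Zp p\<^esub> schmid_witt p (c, b)"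
    using 1(2) compatible_pow[OF p r' 1(2)] completed_pairing_power_right[OF 1(2) r', of x]
    by (simp add: 1(1,3) p_completion_pow_eq schmid_witt_eq Zp_simps)
qed

lemma schmid_witt_to_completion:
  fixes x :: "'k fls witt"
  assumes "t \<noteq> 0"
  shows "schmid_witt p (witt_class p (wcoeff x), to_p_completion p laurent_units t) = wcoeff (witt_pairing x t)"
proof -
  have "completed_pairing x (\<lambda>_. t) = witt_pairing x t"
    by (rule completed_pairing_eqI) (simp_all add: compatible_const assms)
  then show ?thesis
    by (simp add: to_p_completion_const schmid_witt_eq compatible_const assms)
qed

end

section \<open>Uniqueness\<close>

function artin_schreier_coeff :: "(nat \<Rightarrow> 'k::finite_field) \<Rightarrow> nat \<Rightarrow> 'k" where
  "artin_schreier_coeff g n =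
    (if n > 0 \<and> CHAR('k) dvd n then artin_schreier_coeff g (n div CHAR('k)) ^ CHAR('k) else 0) - g n"
  by auto
termination
proof (relation "measure snd")
  fix g :: "nat \<Rightarrow> 'k::finite_field" and n
  assume "n > 0 \<and> CHAR('k) dvd n"
  then show "((g, n div CHAR('k)), g, n) \<in> measure snd"
    using prime_gt_1_nat[OF CHAR_prime[where ?'a = 'k]] by simp
qed simp

declare artin_schreier_coeff.simps [simp del]

text \<open>The solution is minus the sum of all g^(p^j), convergent since g has positive order; its
  n-th coefficient obeys a_n = a_(n/p)^p - g_n, without the first term if p does not divide
  n.\<close>

lemma artin_schreier_regular:
  fixes g :: "'k::finite_field fls"
  assumes g: "\<And>i. i \<le> 0 \<Longrightarrow> g $$ i = 0"
  shows "\<exists>h. g = h ^ CHAR('k) - h"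
proof -
  let ?p = "CHAR('k)"
  define a where "a = artin_schreier_coeff (\<lambda>n. g $$ int n)"
  define h where "h = fps_to_fls (Abs_fps a)"
  have p: "int ?p > 0" by simp
  have a0: "a 0 = 0" unfolding a_def by (subst artin_schreier_coeff.simps) (simp add: g)
  have h: "h $$ i = (if i \<le> 0 then 0 else a (nat i))" for i
    using a0 by (auto simp: h_def)
  have "g = h ^ ?p - h"
  proof (rule fls_eqI)
    fix i
    have hp: "(h ^ ?p) $$ i = (if int ?p dvd i then (h $$ (i div int ?p)) ^ ?p else 0)"
      unfolding fls_power_prime_char by (simp add: fls_nth_compose_power power_0_left)
    show "g $$ i = (h ^ ?p - h) $$ i"
    proof (cases "i \<le> 0")
      case True
      then have "i div int ?p \<le> 0" using p by (intro div_nonpos_pos_le0) simp_all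
      then show ?thesis unfolding fls_minus_nth hp using True by (simp add: h g power_0_left)
    next
      case False
      then obtain n where i: "i = int n" "n > 0" by (metis linorder_not_le zero_less_imp_eq_int)
      have "a n = (if ?p dvd n then a (n div ?p) ^ ?p else 0) - g $$ int n"
        unfolding a_def by (subst artin_schreier_coeff.simps) (use i in simp)
      moreover have "n div ?p > 0" if "?p dvd n" using that i(2) by (auto elim!: dvdE)
      ultimately show ?thesis
        unfolding fls_minus_nth hp using i(2) by (auto simp: h i(1) zdiv_int[symmetric])
    qed
  qed
  then show ?thesis ..
qed

lemma fls_subdegree_powi_minus:
  fixes t :: "'k::field fls"
  assumes "t \<noteq> 0" "fls_subdegree t = 1"
  shows "fls_subdegree (t powi - int n) = - int n"
proof -
  have "t powi - int n = inverse (t ^ n)" by (simp add: power_int_minus)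
  then show ?thesis using assms by (simp add: fls_subdegree_pow)
qed

text \<open>
  Modulo \<open>p\<close>, a Frobenius-invariant additive map on \<open>W(K)\<close> only depends on the zeroth component,
  on which it is additive and kills \<open>\<wp>(K)\<close>. Since \<open>K\<close> is spanned by \<open>\<wp>(K)\<close>, the
  constants and the \<open>ct\<^sup>-\<^sup>i\<close> with \<open>i\<close> prime to \<open>p\<close>, the map vanishes modulo \<open>p\<close>.
\<close>

lemma additive_vanish:
  fixes A :: "'k::finite_field fls witt \<Rightarrow> 'k witt" and t :: "'k fls"
  assumes t: "t \<noteq> 0" "fls_subdegree t = 1"
    and add: "\<And>x y. A (x + y) = A x + A y"
    and frob: "\<And>x. A (wfrob x) = A x"
    and const: "\<And>c. A (tei (fls_const c)) = 0"
    and tei: "\<And>c i. i > 0 \<Longrightarrow> \<not> CHAR('k) dvd i \<Longrightarrow> A (tei (fls_const c * t powi - int i)) = 0"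
  shows "A x = 0"
proof -
  let ?p = "CHAR('k)"
  have zero: "A 0 = 0" using add[of 0 0] by (simp only: add_0_left add_cancel_right_right)
  have of_nat: "A (of_nat m * x) = of_nat m * A x" for m x
    by (induction m) (simp_all add: zero add algebra_simps)
  \<comment> \<open>Because FV = p and A is unchanged by F.\<close>
  have ver: "A (ver v) = of_nat ?p * A v" for v
  proof -
    have "A (ver v) = A (wfrob (ver v))" by (rule frob[symmetric])
    also have "wfrob (ver v) = of_nat ?p * v"
      using times_p_eq[of v] wmap_ver[OF ring_map_frob, of v] by (simp only: semiring_char_fls)
    finally show ?thesis by (simp add: of_nat)
  qed
  have "of_nat ?p ^ n dvd A x" for n x
  proof (induction n arbitrary: x)
    case (Suc n)
    define S where "S f \<longleftrightarrow> of_nat ?p ^ Suc n dvd A (tei f)" for f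
    \<comment> \<open>The induction hypothesis gives p^n and V one more p. Hence V(W(K)) is
      negligible at this level, and \<open>tei\<close>, additive up to V(W(K)), behaves as if
      additive.\<close>
    have ver_dvd: "of_nat ?p ^ Suc n dvd A (ver v)" for v
      unfolding ver using Suc.IH[of v] by (simp add: mult_dvd_mono)
    have A_add: "of_nat ?p ^ Suc n dvd A (tei (f + g)) - (A (tei f) + A (tei g))" for f g
    proof -
      have "tei f + tei g = tei (f + g) + ver (wtail (tei f + tei g))"
        using witt_split[of "tei f + tei g"] by simp
      then have "A (tei f) + A (tei g) = A (tei (f + g)) + A (ver (wtail (tei f + tei g)))"
        by (metis add)
      then have "A (tei (f + g)) - (A (tei f) + A (tei g)) = - A (ver (wtail (tei f + tei g)))" by simp
      then show ?thesis using ver_dvd by (simp only: dvd_minus_iff)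
    qed
    have S_add: "S (f + g)" if "S f" "S g" for f g
      using dvd_add[OF A_add[of f g] dvd_add[OF that[unfolded S_def]]] by (simp add: S_def)
    have S_pow: "S (f ^ ?p) \<longleftrightarrow> S f" for f
    proof -
      have eq: "tei (f ^ ?p) = wfrob (tei f)" using wmap_tei[OF ring_map_frob, of f] by simp
      show ?thesis unfolding S_def eq frob ..
    qed
    have S_wp: "S (h ^ ?p - h)" for h
    proof -
      have "A (tei (h ^ ?p)) = A (tei h)" using wmap_tei[OF ring_map_frob, of h] frob[of "tei h"] by simp
      then show ?thesis using A_add[of "h ^ ?p - h" h] by (simp add: S_def)
    qed
    have S_const: "S (fls_const c)" for c by (simp add: S_def const)
    have S_mon: "S (fls_const c * t powi - int i)" if "i > 0" for c i
      using that
    proof (induction i arbitrary: c rule: less_induct)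
      case (less i)
      show ?case
      proof (cases "?p dvd i")
        case True
        then obtain j where j: "i = ?p * j" by (elim dvdE)
        \<comment> \<open>An exponent divisible by p is lowered by extracting a p-th root of the
          monomial, possible since k is perfect.\<close>
        obtain c' where c': "c = c' ^ ?p" by (rule surjE[OF bij_is_surj[OF bij_frob], of c])
        have "j > 0" "j < i"
          using less.prems prime_gt_1_nat[OF CHAR_prime[where ?'a = 'k]] by (simp_all add: j)
        then have "S (fls_const c' * t powi - int j)" using less.IH by blast
        then have "S ((fls_const c' * t powi - int j) ^ ?p)" by (simp only: S_pow)
        also have "(fls_const c' * t powi - int j) ^ ?p = fls_const c * t powi - int i"
          by (simp only: power_mult_distrib power_int_power' c' j fls_const_power of_nat_mult)
             (simp add: mult.commute)
        finally show ?thesis .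
      qed (use less.prems in \<open>simp add: S_def tei\<close>)
    qed
    have S_all: "S f" if "\<And>i. i < - int N \<Longrightarrow> f $$ i = 0" for N f
      using that
    proof (induction N arbitrary: f)
      case 0
      have "\<exists>h. f - fls_const (f $$ 0) = h ^ ?p - h"
        by (rule artin_schreier_regular) (use 0 in auto)
      then obtain h where "f = fls_const (f $$ 0) + (h ^ ?p - h)" by (metis add.commute diff_add_cancel)
      then show ?case using S_add[OF S_const S_wp] by metis
    next
      case (Suc N)
      define q where "q = t powi - int (Suc N)"
      have sub: "fls_subdegree q = - int (Suc N)"
        unfolding q_def by (rule fls_subdegree_powi_minus[OF t])
      have "q \<noteq> 0" using t by (simp add: q_def)
      then have lead: "q $$ (- int (Suc N)) \<noteq> 0" by (metis nth_fls_subdegree_nonzero sub)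
      define m where "m = fls_const (f $$ (- int (Suc N)) / q $$ (- int (Suc N))) * q"
      have "S (f - m)"
      proof (rule Suc.IH)
        fix i assume "i < - int N"
        then consider "i = - int (Suc N)" | "i < - int (Suc N)" by linarith
        then show "(f - m) $$ i = 0"
          using lead Suc.prems sub by cases (simp_all add: m_def)
      qed
      moreover have "S m" unfolding m_def q_def by (rule S_mon) simp
      ultimately have "S ((f - m) + m)" by (rule S_add)
      then show ?case by simp
    qed
    have "S (wcoeff x 0)"
      by (rule S_all[of "nat (- fls_subdegree (wcoeff x 0))"])
         (rule fls_eq0_below_subdegree, simp split: if_splits)
    moreover have "A x = A (tei (wcoeff x 0)) + A (ver (wtail x))"
      by (subst witt_split[of x]) (rule add)
    ultimately show ?case using ver_dvd by (simp add: S_def)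
  qed simp
  then show ?thesis using witt_cong_eqI[of "A x" 0] by simp
qed

text \<open>T is itself a uniformizer, so multiplication by T does not change H; moving the
  subdegree up and down from 1 in this way reaches every y.\<close>

lemma uniformizer_generate:
  fixes H :: "'k::field fls \<Rightarrow> 'b::ab_group_add"
  assumes mult: "\<And>y z. y \<noteq> 0 \<Longrightarrow> z \<noteq> 0 \<Longrightarrow> H (y * z) = H y + H z"
    and unif: "\<And>t. t \<noteq> 0 \<Longrightarrow> fls_subdegree t = 1 \<Longrightarrow> H t = 0" and y: "y \<noteq> 0"
  shows "H y = 0"
proof -
  have X: "fls_X_inv * fls_X = (1 :: 'k fls)" by (simp flip: fls_inverse_X)
  have shift: "H (y * fls_X) = H y" if "y \<noteq> 0" for y
    using mult[OF that, of fls_X] unif[of fls_X] by simp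
  have "\<forall>y. y \<noteq> 0 \<and> fls_subdegree y = d \<longrightarrow> H y = 0" for d
  proof (induction d rule: int_induct[of _ 1])
    case base
    show ?case using unif by blast
  next
    case (step1 d)
    show ?case
    proof (intro allI impI)
      fix y :: "'k fls" assume y: "y \<noteq> 0 \<and> fls_subdegree y = d + 1"
      have nz: "y * fls_X_inv \<noteq> 0" "fls_subdegree (y * fls_X_inv) = d" using y by simp_all
      then have "H (y * fls_X_inv) = 0" using step1 by blast
      then show "H y = 0" using shift[OF nz(1)] X by (simp only: mult.assoc mult_1_right)
    qed
  next
    case (step2 d)
    show ?case
    proof (intro allI impI)
      fix y :: "'k fls" assume y: "y \<noteq> 0 \<and> fls_subdegree y = d - 1"
      then have "y * fls_X \<noteq> 0 \<and> fls_subdegree (y * fls_X) = d" by simp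
      then have "H (y * fls_X) = 0" using step2 by blast
      then show "H y = 0" using shift y by simp
    qed
  qed
  then show ?thesis using y by blast
qed

lemma compatible_power: "compatible p y \<Longrightarrow> compatible p (\<lambda>n. y n ^ m)"
proof (induction m)
  case 0
  show ?case using compatible_const[of 1] by simp
next
  case (Suc m)
  from compatible_mult[OF Suc.prems Suc.IH[OF Suc.prems]] show ?case by simp
qed

text \<open>Component n may be represented by y_(n+1), and all transition factors after y_1 are at
  least p-th powers.\<close>

lemma completion_decompose:
  assumes "compatible p y"
  shows "\<exists>v. compatible p v \<and> completion_of p y = completion_of p (\<lambda>n. y 1 * v n ^ p)"
proof -
  have "\<forall>n. \<exists>z. z \<noteq> 0 \<and> y (Suc n) = z ^ p ^ n * y n" using assms by (simp add: compatible_def)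
  then obtain z where z: "\<And>n. z n \<noteq> 0" "\<And>n. y (Suc n) = z n ^ p ^ n * y n" by metis
  have nz: "y n \<noteq> 0" for n using assms by (simp add: compatible_def)
  \<comment> \<open>The transition factors telescope to the product of z_j^(p^j) over j from 1 to n;
    v is its p-th root, whence the shifted index.\<close>
  define v where "v n = (\<Prod>j<n. z (Suc j) ^ p ^ j)" for n
  have v: "y (Suc n) = y 1 * v n ^ p" for n
  proof (induction n)
    case (Suc n)
    have "y (Suc (Suc n)) = z (Suc n) ^ p ^ Suc n * y (Suc n)" by (rule z(2))
    also have "\<dots> = y 1 * v (Suc n) ^ p"
      unfolding Suc by (simp add: v_def power_mult_distrib mult_ac flip: power_mult)
    finally show ?case .
  qed (simp add: v_def)
  have "compatible p v"
    unfolding compatible_def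
  proof (intro allI conjI)
    fix n
    show "v n \<noteq> 0" by (simp add: v_def z(1))
    have "v (Suc n) = z (Suc n) ^ p ^ n * v n" by (simp add: v_def)
    then show "\<exists>u. u \<noteq> 0 \<and> v (Suc n) = u ^ p ^ n * v n" using z(1) by blast
  qed
  moreover have "power_coset (p ^ n) (y n) = power_coset (p ^ n) (y (Suc n))" for n
    using power_coset_eq_iff[OF nz nz] z by blast
  then have "completion_of p y = completion_of p (\<lambda>n. y 1 * v n ^ p)"
    unfolding completion_of_def v[symmetric] by blast
  ultimately show ?thesis by blast
qed

text \<open>\<open>F\<close> is evaluated on representatives: \<open>eq\<close> carries independence
  of the representing sequence, and \<open>frob\<close> is what vanishing on \<wp> amounts
  to.\<close>

lemma pairing_vanish:
  fixes F :: "'k::finite_field fls witt \<Rightarrow> (nat \<Rightarrow> 'k fls) \<Rightarrow> 'k witt"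
  assumes eq: "\<And>x y z. compatible CHAR('k) y \<Longrightarrow> compatible CHAR('k) z \<Longrightarrow>
      completion_of CHAR('k) y = completion_of CHAR('k) z \<Longrightarrow> F x y = F x z"
    and add: "\<And>x x' y. compatible CHAR('k) y \<Longrightarrow> F (x + x') y = F x y + F x' y"
    and mult: "\<And>x y z. compatible CHAR('k) y \<Longrightarrow> compatible CHAR('k) z \<Longrightarrow>
      F x (\<lambda>n. y n * z n) = F x y + F x z"
    and frob: "\<And>x y. compatible CHAR('k) y \<Longrightarrow> F (wfrob x) y = F x y"
    and const: "\<And>c t. t \<noteq> 0 \<Longrightarrow> fls_subdegree t = 1 \<Longrightarrow> F (tei (fls_const c)) (\<lambda>_. t) = 0"
    and tei: "\<And>c t i. t \<noteq> 0 \<Longrightarrow> fls_subdegree t = 1 \<Longrightarrow> i > 0 \<Longrightarrow> \<not> CHAR('k) dvd i \<Longrightarrow>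
      F (tei (fls_const c * t powi - int i)) (\<lambda>_. t) = 0"
    and y: "compatible CHAR('k) y"
  shows "F x y = 0"
proof -
  have unif: "F x (\<lambda>_. t) = 0" if t: "t \<noteq> 0" "fls_subdegree t = 1" for x t
  proof (rule additive_vanish[where A = "\<lambda>x. F x (\<lambda>_. t)", OF t])
    show "F (wfrob x) (\<lambda>_. t) = F x (\<lambda>_. t)" for x
      by (rule frob[OF compatible_const[OF t(1)]])
  qed (simp_all add: add const tei compatible_const t)
  have field: "F x (\<lambda>_. u) = 0" if u: "u \<noteq> 0" for x u
    by (rule uniformizer_generate[where H = "\<lambda>u. F x (\<lambda>_. u)", OF _ _ u])
       (simp_all add: mult compatible_const unif)
  have one: "F x (\<lambda>n. 1) = 0" for x using field[of 1] by simp
  have pow: "F x (\<lambda>n. y n ^ m) = of_nat m * F x y" if "compatible CHAR('k) y" for x y m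
    using that by (induction m) (simp_all add: one mult compatible_power algebra_simps)
  have "of_nat CHAR('k) ^ n dvd F x y" if "compatible CHAR('k) y" for n y
    using that
  proof (induction n arbitrary: y)
    case (Suc n)
    obtain v where v: "compatible CHAR('k) v"
      "completion_of CHAR('k) y = completion_of CHAR('k) (\<lambda>n. y 1 * v n ^ CHAR('k))"
      using completion_decompose[OF Suc.prems] by blast
    have y1: "y 1 \<noteq> 0" using Suc.prems by (simp add: compatible_def)
    have vp: "compatible CHAR('k) (\<lambda>n. v n ^ CHAR('k))" by (rule compatible_power[OF v(1)])
    note y1c = compatible_const[OF y1, of "CHAR('k)"]
    have "F x y = F x (\<lambda>n. y 1 * v n ^ CHAR('k))"
      by (rule eq[OF Suc.prems compatible_mult[OF y1c vp] v(2)])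
    also have "\<dots> = of_nat CHAR('k) * F x v"
      by (simp only: mult[OF y1c vp] field[OF y1] pow[OF v(1)] add_0)
    finally show ?case using Suc.IH[OF v(1)] by (simp add: mult_dvd_mono)
  qed simp
  then show ?thesis using y witt_cong_eqI[of "F x y" 0] by simp
qed

lemma pairing_unique:
  fixes f g :: "(nat \<Rightarrow> 'k::finite_field fls) set \<times> (nat \<Rightarrow> 'k fls set) \<Rightarrow> nat \<Rightarrow> 'k"
  assumes p: "p = CHAR('k)"
    and bil: "Zp_bilinear p f" "Zp_bilinear p g"
    and const: "\<And>a t. uniformizer t \<Longrightarrow>
      f (witt_class p (witt_const a), to_p_completion p laurent_units t) =
      g (witt_class p (witt_const a), to_p_completion p laurent_units t)"
    and tei: "\<And>t c i. uniformizer t \<Longrightarrow> i > 0 \<Longrightarrow> \<not> int p dvd i \<Longrightarrow>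
      f (witt_class p (teichmuller (fls_const c * t powi - i)), to_p_completion p laurent_units t) =
      g (witt_class p (teichmuller (fls_const c * t powi - i)), to_p_completion p laurent_units t)"
    and c: "c \<in> carrier (witt_mod_wp p)" and b: "b \<in> carrier (laurent_units_completion p)"
  shows "f (c, b) = g (c, b)"
proof -
  note pf = p_fls[OF p]
  define F where "F x y = Witt (f (witt_class p (wcoeff x), completion_of p y)) -
    Witt (g (witt_class p (wcoeff x), completion_of p y))" for x :: "'k fls witt" and y
  note carr = class_in_carrier[OF p] completion_in_carrier[OF p]
  have bil_add: "Witt (h (witt_class p (wcoeff (x + x')), completion_of p y)) =
      Witt (h (witt_class p (wcoeff x), completion_of p y)) + Witt (h (witt_class p (wcoeff x'), completion_of p y))"
    if "Zp_bilinear p h" "compatible p y"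
    for h :: "(nat \<Rightarrow> 'k::finite_field fls) set \<times> (nat \<Rightarrow> 'k fls set) \<Rightarrow> nat \<Rightarrow> 'k" and x x' y
  proof -
    have "h (witt_class p (wcoeff x) \<otimes>\<^bsub>witt_mod_wp p\<^esub> witt_class p (wcoeff x'), completion_of p y) =
      h (witt_class p (wcoeff x), completion_of p y) \<oplus>\<^bsub>Zp p\<^esub> h (witt_class p (wcoeff x'), completion_of p y)"
      using that(1) carr(1) carr(2)[OF that(2)] unfolding Zp_bilinear_def by blast
    then show ?thesis by (simp add: mult_witt_mod_wp[OF pf] Zp_simps[OF p])
  qed
  have bil_mult: "Witt (h (witt_class p (wcoeff x), completion_of p (\<lambda>n. y n * z n))) =
      Witt (h (witt_class p (wcoeff x), completion_of p y)) + Witt (h (witt_class p (wcoeff x), completion_of p z))"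
    if "Zp_bilinear p h" "compatible p y" "compatible p z"
    for h :: "(nat \<Rightarrow> 'k::finite_field fls) set \<times> (nat \<Rightarrow> 'k fls set) \<Rightarrow> nat \<Rightarrow> 'k" and x y z
  proof -
    have "h (witt_class p (wcoeff x), completion_of p y \<otimes>\<^bsub>laurent_units_completion p\<^esub> completion_of p z) =
      h (witt_class p (wcoeff x), completion_of p y) \<oplus>\<^bsub>Zp p\<^esub> h (witt_class p (wcoeff x), completion_of p z)"
      using that(1) carr(1) carr(2)[OF that(2)] carr(2)[OF that(3)] unfolding Zp_bilinear_def by blast
    then show ?thesis by (simp add: mult_completion Zp_simps[OF p])
  qed
  have F0: "F x y = 0" if "compatible p y" for x y
  proof (rule pairing_vanish)
    show "compatible CHAR('k) y" using that p by simp
    fix x x' :: "'k fls witt" and y z :: "nat \<Rightarrow> 'k fls"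
    assume "compatible CHAR('k) y"
    then have y: "compatible p y" using p by simp
    show "F (x + x') y = F x y + F x' y"
      by (simp add: F_def bil_add[OF bil(1) y] bil_add[OF bil(2) y])
    have "wfrob x - x \<in> wp_range" unfolding wp_range_def by (rule rangeI)
    then have "witt_class p (wcoeff (wfrob x)) = witt_class p (wcoeff x)"
      by (simp add: witt_class_eq_iff[OF pf])
    then show "F (wfrob x) y = F x y" by (simp only: F_def)
    assume "compatible CHAR('k) z"
    then have z: "compatible p z" using p by simp
    show "F x (\<lambda>n. y n * z n) = F x y + F x z"
      by (simp add: F_def bil_mult[OF bil(1) y z] bil_mult[OF bil(2) y z])
    assume "completion_of CHAR('k) y = completion_of CHAR('k) z"
    then have "completion_of p y = completion_of p z" by (simp only: p)
    then show "F x y = F x z" by (simp only: F_def)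
  next
    fix c :: 'k and t :: "'k fls"
    assume "t \<noteq> 0" "fls_subdegree t = 1"
    then have t: "uniformizer t" by (simp add: uniformizer_def)
    have "wcoeff (tei (fls_const c)) = witt_const (teichmuller c)"
      by (auto simp: tei_def witt_const_def teichmuller_def)
    then show "F (tei (fls_const c)) (\<lambda>_. t) = 0"
      using const[OF t, of "teichmuller c"] by (simp add: F_def to_p_completion_const)
    fix i :: nat
    assume i: "i > 0" "\<not> CHAR('k) dvd i"
    have "wcoeff (tei (fls_const c * t powi - int i)) = teichmuller (fls_const c * t powi - int i)"
      by (simp add: tei_def)
    then show "F (tei (fls_const c * t powi - int i)) (\<lambda>_. t) = 0"
      using tei[OF t, of "int i" c] i by (simp add: F_def to_p_completion_const p)
  qed
  obtain x y where xy: "c = witt_class p (wcoeff x)" "compatible p y" "b = completion_of p y"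
    by (rule carrier_cases[OF p c b])
  show ?thesis using F0[OF xy(2), of x] by (simp add: F_def xy(1,3))
qed

theorem proposition4p4:
  fixes p :: nat
  assumes "p = CHAR('k::finite_field)"
  shows "\<exists>!pairing :: (nat \<Rightarrow> 'k fls) set \<times> (nat \<Rightarrow> 'k fls set) \<Rightarrow> nat \<Rightarrow> 'k.
    pairing \<in> carrier (witt_mod_wp p) \<times> carrier (laurent_units_completion p)
                \<rightarrow>\<^sub>E carrier (Zp p) \<and>
    Zp_bilinear p pairing \<and>
    (\<forall>a \<in> carrier (witt_ring p (UNIV :: 'k set)). \<forall>t. uniformizer t \<longrightarrow>
       pairing (witt_class p (witt_const a), to_p_completion p laurent_units t) =
         witt_trace p a) \<and>
    (\<forall>t (c :: 'k) (i :: int). uniformizer t \<longrightarrow> i > 0 \<longrightarrow> \<not> int p dvd i \<longrightarrow>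
       pairing (witt_class p (teichmuller (fls_const c * t powi (- i))),
                to_p_completion p laurent_units t) = \<zero>\<^bsub>Zp p\<^esub>)"
    (is "\<exists>!f. ?P f")
proof (rule ex1I)
  note p = assms
  have const: "schmid_witt p (witt_class p (witt_const a), to_p_completion p laurent_units t) = witt_trace p a"
    if "uniformizer t" for a :: "nat \<Rightarrow> 'k" and t
  proof -
    have t: "t \<noteq> 0" "fls_subdegree t = 1" using that by (simp_all add: uniformizer_def)
    have "witt_const a = wcoeff (wmap fls_const (Witt a))" by (simp add: witt_const_def wmap_def)
    then show ?thesis
      by (simp add: schmid_witt_to_completion[OF p t(1)] witt_pairing_const[OF t] witt_trace_eq[OF p])
  qed
  have tei: "schmid_witt p (witt_class p (teichmuller (fls_const c * t powi - i)),
      to_p_completion p laurent_units t) = \<zero>\<^bsub>Zp p\<^esub>"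
    if "uniformizer t" "i > 0" for c :: 'k and t i
  proof -
    have t: "t \<noteq> 0" using that by (simp add: uniformizer_def)
    have "teichmuller (fls_const c * t powi - i) = wcoeff (tei (fls_const c * t powi - i))"
      by (simp add: tei_def)
    then show ?thesis
      by (simp add: schmid_witt_to_completion[OF p t] witt_pairing_tei[OF t that(2)] Zp_simps[OF p])
  qed
  show P: "?P (schmid_witt p)"
    using schmid_witt_funcset[OF p] schmid_witt_bilinear[OF p] const tei by blast
  fix f assume f: "?P f"
  show "f = schmid_witt p"
  \<comment> \<open>Both maps are extensional, so agreement on the product of the carriers gives
    equality of functions.\<close>
  proof (rule PiE_ext)
    show "f \<in> carrier (witt_mod_wp p) \<times> carrier (laurent_units_completion p) \<rightarrow>\<^sub>E carrier (Zp p)"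
      using f by blast
    show "schmid_witt p \<in> carrier (witt_mod_wp p) \<times> carrier (laurent_units_completion p)
        \<rightarrow>\<^sub>E carrier (Zp p :: (nat \<Rightarrow> 'k) ring)"
      by (rule schmid_witt_funcset[OF p])
    fix cb :: "(nat \<Rightarrow> 'k fls) set \<times> (nat \<Rightarrow> 'k fls set)"
    assume "cb \<in> carrier (witt_mod_wp p) \<times> carrier (laurent_units_completion p)"
    then obtain c b where cb: "cb = (c, b)" "c \<in> carrier (witt_mod_wp p)"
      "b \<in> carrier (laurent_units_completion p)" by (elim SigmaE)
    show "f cb = schmid_witt p cb"
      unfolding cb(1)
    proof (rule pairing_unique[OF p _ schmid_witt_bilinear[OF p] _ _ cb(2,3)])
      show "Zp_bilinear p f" using f by blast
      fix t :: "'k fls" assume t: "uniformizer t"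
      show "f (witt_class p (witt_const a), to_p_completion p laurent_units t) =
          schmid_witt p (witt_class p (witt_const a), to_p_completion p laurent_units t)" for a
        using f t by (simp add: const[OF t] carrier_witt_ring[OF p])
      show "f (witt_class p (teichmuller (fls_const c * t powi - i)), to_p_completion p laurent_units t) =
          schmid_witt p (witt_class p (teichmuller (fls_const c * t powi - i)), to_p_completion p laurent_units t)"
        if "i > 0" "\<not> int p dvd i" for c i
        using f t that by (simp add: tei[OF t])
    qed
  qed
qed

end
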